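(* Let $\langle\cdot\rangle$ denote the expectation value with respect to a unitarily invariant measure on the space $\mathcal H_N$ of $N\times N$ hermitian matrices (in particular a formal measure generating usual maps, maps with loops or stuffed maps). For every partition $\lambda$ with $|\lambda|\le N$, $$\frac{\langle\mathcal P_\lambda(M)\rangle}{|\mathrm{Aut}\,\lambda|}=\sum_{\mu\vdash|\lambda|}N^{-|\mu|}\Big(\sum_{k\ge0}(-N)^{-k}[H_k]_{\lambda,\mu}\Big)\Big\langle\prod_{i=1}^{\ell(\mu)}\mathrm{Tr}\,M^{\mu_i}\Big\rangle,$$ and for every partition $\mu$ with $|\mu|\le N$, $$\frac{\big\langle\prod_{i=1}^{\ell(\mu)}\mathrm{Tr}\,M^{\mu_i}\big\rangle}{|\mathrm{Aut}\,\mu|}=\sum_{\lambda\vdash|\mu|}N^{|\lambda|}\Big(\sum_{k\ge0}N^{-k}[E_k]_{\mu,\lambda}\Big)\langle\mathcal P_\lambda(M)\rangle,$$ where $[H_k]_{\lambda,\mu}$ are the double weakly monotone Hurwitz numbers and $[E_k]_{\mu,\lambda}$ are the double strictly monotone Hurwitz numbers.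
   Context: Expectation values of polynomial functions of the entries of $M$ are assumed defined: either a genuine measure, invariant under $M\mapsto UMU^\dagger$ for $U$ unitary, with nonzero total mass and finite moments, or a formal measure $$dM\,\exp\Big(-N\,\mathrm{Tr}\tfrac{M^2}{2}+\sum_{h\ge0,k\ge1}\frac{N^{2-2h-k}}{k!}\sum_{d_1,\dots,d_k\ge1}\frac{t_{h;d_1,\dots,d_k}}{d_1\cdots d_k}\prod_i\mathrm{Tr}\,M^{d_i}\Big),$$ for which normalized expectation values are defined as formal power series in the $t$'s by expanding around the Gaussian measure. For a partition $\lambda$ of $L\le N$, $\mathcal P_\lambda(M)=\prod_{j=1}^{L}M_{j,\gamma(j)}$, where $\gamma$ is any permutation of $\{1,\dots,L\}$ with cycle type $\lambda$; by unitary invariance $\langle\mathcal P_\lambda(M)\rangle$ depends only on $\lambda$. $C_\lambda$ is the conjugacy class of $\mathfrak S_L$ of cycle type $\lambda\vdash L$, and $|\mathrm{Aut}\,\lambda|=L!/|C_\lambda|$. For a transposition $\tau=(a\;b)$ put $\max\tau=\max(a,b)$. For $\lambda,\mu\vdash L$, $|\mathrm{Aut}\,\lambda|\,[E_k]_{\mu,\lambda}$ (resp. $|\mathrm{Aut}\,\lambda|\,[H_k]_{\mu,\lambda}$) is the number of tuples $(\tau_1,\dots,\tau_k,\sigma)$ with $\tau_i$ transpositions in $\mathfrak S_L$ such that $(\max\tau_i)_{i=1}^k$ is strictly (resp. weakly) increasing, $\sigma\in C_\mu$, and $\tau_1\cdots\tau_k\sigma$ equal to a fixed permutation in $C_\lambda$.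 Equivalently, $[R]_{\mu,\lambda}=\frac{1}{|\mathrm{Aut}\,\lambda|\,|\mathrm{Aut}\,\mu|}\sum_{\nu\vdash L}\chi_\nu(C_\mu)\,r(\mathrm{cont}\,\nu)\,\chi_\nu(C_\lambda)$ with $r=e_k$ (elementary symmetric polynomial) for $E_k$ and $r=h_k$ (complete homogeneous) for $H_k$, where $\chi_\nu$ are the irreducible characters of $\mathfrak S_L$ and $\mathrm{cont}\,\nu$ is the multiset of contents $j-i$ of the boxes $(i,j)$ of the Young diagram of $\nu$. These numbers are symmetric in $(\lambda,\mu)$. *)

theory Defs
  imports "HOL-Analysis.Analysis" "HOL-Combinatorics.Combinatorics"
begin

section \<open>Partitions, conjugacy classes and monotone Hurwitz numbers\<close>

definition partitions :: "nat \<Rightarrow> nat multiset set" where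
  "partitions L = {lam. 0 \<notin># lam \<and> sum_mset lam = L}"

definition cycle_type :: "nat \<Rightarrow> (nat \<Rightarrow> nat) \<Rightarrow> nat multiset" where
  "cycle_type L g = image_mset card (mset_set (orbit g ` {1..L}))"

definition conj_class :: "nat multiset \<Rightarrow> (nat \<Rightarrow> nat) set" where
  "conj_class lam =
     {g. g permutes {1..sum_mset lam} \<and> cycle_type (sum_mset lam) g = lam}"

definition aut :: "nat multiset \<Rightarrow> real" where
  "aut lam = fact (sum_mset lam) / real (card (conj_class lam))"

text \<open>
  A transposition \<open>(a b)\<close> is encoded as the pair with \<open>a < b\<close>, so that its maximum is
  the second component. The following set consists of the tuples
  \<open>(\<tau>\<^sub>1, \<dots>, \<tau>\<^sub>k, \<sigma>)\<close> with \<open>\<tau>\<^sub>1 \<cdots> \<tau>\<^sub>k \<sigma> = p\<close> whose maxima are increasing with respect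
  to the relation \<open>R\<close>.
\<close>

definition monotone_factorizations ::
  "(nat \<Rightarrow> nat \<Rightarrow> bool) \<Rightarrow> nat \<Rightarrow> nat \<Rightarrow> nat multiset \<Rightarrow> (nat \<Rightarrow> nat)
     \<Rightarrow> ((nat \<times> nat) list \<times> (nat \<Rightarrow> nat)) set" where
  "monotone_factorizations R L k mu p =
     {(ts, s). length ts = k
        \<and> (\<forall>(a, b) \<in> set ts. 1 \<le> a \<and> a < b \<and> b \<le> L)
        \<and> sorted_wrt R (map snd ts)
        \<and> s \<in> conj_class mu
        \<and> foldr (\<lambda>(a, b) q. Transposition.transpose a b \<circ> q) ts s = p}"

text \<open>
  The number of factorizations does not depend on the permutation chosen in the class of
  \<open>lam\<close>. The numbers are only meaningful if \<open>mu\<close> and \<open>lam\<close> have the same size.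
\<close>

definition hurwitz ::
  "(nat \<Rightarrow> nat \<Rightarrow> bool) \<Rightarrow> nat \<Rightarrow> nat multiset \<Rightarrow> nat multiset \<Rightarrow> real" where
  "hurwitz R k mu lam =
     real (card (monotone_factorizations R (sum_mset lam) k mu (SOME p. p \<in> conj_class lam)))
       / aut lam"

definition hurwitz_E :: "nat \<Rightarrow> nat multiset \<Rightarrow> nat multiset \<Rightarrow> real" where
  "hurwitz_E = hurwitz (<)"

definition hurwitz_H :: "nat \<Rightarrow> nat multiset \<Rightarrow> nat multiset \<Rightarrow> real" where
  "hurwitz_H = hurwitz (\<le>)"

lemma finite_partitions: "finite (partitions L)"
proof (rule finite_subset)
  show "partitions L \<subseteq> mset ` {xs. set xs \<subseteq> {..L} \<and> length xs \<le> L}"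
  proof
    fix lam assume lam: "lam \<in> partitions L"
    obtain xs where xs: "lam = mset xs" by (metis ex_mset)
    have sum: "sum_list xs = L" and pos: "0 \<notin> set xs"
      using lam xs by (auto simp: partitions_def sum_mset_sum_list)
    have "x \<le> L" if "x \<in> set xs" for x
      using member_le_sum_list[OF that] sum by simp
    moreover have "length xs \<le> sum_list xs"
      using pos by (induction xs) auto
    ultimately show "lam \<in> mset ` {xs. set xs \<subseteq> {..L} \<and> length xs \<le> L}"
      using xs sum by auto
  qed
  show "finite (mset ` {xs. set xs \<subseteq> {..L} \<and> length xs \<le> L})"
    by (intro finite_imageI finite_lists_length_le) auto
qed

section \<open>Matrices\<close>

type_synonym 'n cmat = "complex ^ 'n ^ 'n"

definition adj :: "'n::finite cmat \<Rightarrow> 'n cmat" where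
  "adj A = (\<chi> i j. cnj (A $ j $ i))"

definition hermitian_mats :: "'n::finite cmat set" where
  "hermitian_mats = {A. adj A = A}"

definition unitary_mats :: "'n::finite cmat set" where
  "unitary_mats = {U. U ** adj U = mat 1 \<and> adj U ** U = mat 1}"

definition tr_pow :: "nat \<Rightarrow> 'n::finite cmat \<Rightarrow> complex" where
  "tr_pow d A = trace (((**) A ^^ d) (mat 1))"

definition power_sum :: "nat multiset \<Rightarrow> 'n::finite cmat \<Rightarrow> complex" where
  "power_sum mu A = (\<Prod>d\<in>#mu. tr_pow d A)"

text \<open>The map \<open>e\<close> identifies \<open>{1..N}\<close> with the index type of the matrix.\<close>

definition perm_monomial ::
  "(nat \<Rightarrow> 'n) \<Rightarrow> nat \<Rightarrow> (nat \<Rightarrow> nat) \<Rightarrow> 'n::finite cmat \<Rightarrow> complex" where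
  "perm_monomial e L g A = (\<Prod>j\<in>{1..L}. A $ e j $ e (g j))"

section \<open>Unitarily invariant measures\<close>

definition unitarily_invariant_measure :: "'n::finite cmat measure \<Rightarrow> bool" where
  "unitarily_invariant_measure nu \<longleftrightarrow>
     sets nu = sets (restrict_space borel hermitian_mats)
     \<and> (\<forall>U\<in>unitary_mats. distr nu nu (\<lambda>A. U ** A ** adj U) = nu)"

definition finite_moments :: "'n::finite cmat measure \<Rightarrow> bool" where
  "finite_moments nu \<longleftrightarrow>
     (\<forall>I :: ('n \<times> 'n) multiset. integrable nu (\<lambda>A. \<Prod>(i, j)\<in>#I. A $ i $ j))"

definition measure_expectation ::
  "'n::finite cmat measure \<Rightarrow> ('n cmat \<Rightarrow> complex) \<Rightarrow> complex" where
  "measure_expectation nu f = (\<integral>A. f A \<partial>nu) / of_real (measure nu (space nu))"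

section \<open>Formal measures\<close>

text \<open>
  A formal power series in the commuting variables \<open>t\<^sub>x\<close>, where \<open>x\<close> ranges over an arbitrary
  type, is the function sending a multiset \<open>X\<close> to the coefficient of \<open>\<Prod>x\<in>#X. t\<^sub>x\<close>.
  \<open>mfps_div F Z\<close> is the quotient, obtained by solving \<open>G Z = F\<close> for the coefficients of \<open>G\<close>
  degree by degree.
\<close>

type_synonym 'x mfps = "'x multiset \<Rightarrow> complex"

definition mfps_mult :: "'x mfps \<Rightarrow> 'x mfps \<Rightarrow> 'x mfps" where
  "mfps_mult F G X = (\<Sum>Y | Y \<subseteq># X. F Y * G (X - Y))"

function mfps_div :: "'x mfps \<Rightarrow> 'x mfps \<Rightarrow> 'x mfps" where
  "mfps_div F Z X = (F X - (\<Sum>Y | Y \<subset># X. mfps_div F Z Y * Z (X - Y))) / Z {#}"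
  by pat_completeness auto
termination
  by (relation "Wellfounded.measure (\<lambda>(F, Z, X). size X)") (auto dest: mset_subset_size)

declare mfps_div.simps [simp del]

lemma finite_submultisets: "finite {Y. Y \<subseteq># (X :: 'x multiset)}"
proof (rule finite_subset)
  show "{Y. Y \<subseteq># X} \<subseteq> mset ` {xs. set xs \<subseteq> set_mset X \<and> length xs \<le> size X}"
  proof
    fix Y assume Y: "Y \<in> {Y. Y \<subseteq># X}"
    obtain xs where xs: "Y = mset xs" by (metis ex_mset)
    then show "Y \<in> mset ` {xs. set xs \<subseteq> set_mset X \<and> length xs \<le> size X}"
      using Y set_mset_mono[of Y X] size_mset_mono[of Y X] by auto
  qed
  show "finite (mset ` {xs. set xs \<subseteq> set_mset X \<and> length xs \<le> size X})"
    by (intro finite_imageI finite_lists_length_le) auto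
qed

lemma mfps_mult_div:
  fixes F Z :: "'x mfps"
  assumes "Z {#} \<noteq> 0"
  shows "mfps_mult (mfps_div F Z) Z = F"
proof
  fix X :: "'x multiset"
  have split: "{Y. Y \<subseteq># X} = insert X {Y. Y \<subset># X}"
    by (auto simp: subset_mset.le_less)
  have fin: "finite {Y. Y \<subset># X}"
    by (rule finite_subset[OF _ finite_submultisets[of X]]) (auto simp: subset_mset.le_less)
  have "mfps_mult (mfps_div F Z) Z X
      = mfps_div F Z X * Z {#} + (\<Sum>Y | Y \<subset># X. mfps_div F Z Y * Z (X - Y))"
    unfolding mfps_mult_def split by (subst sum.insert) (use fin in auto)
  also have "mfps_div F Z X * Z {#} = F X - (\<Sum>Y | Y \<subset># X. mfps_div F Z Y * Z (X - Y))"
    by (subst mfps_div.simps) (use assms in simp)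
  finally show "mfps_mult (mfps_div F Z) Z X = F X" by simp
qed

text \<open>
  The image of a real matrix \<open>x\<close> under the following map has entries
  \<open>(x\<^sub>i\<^sub>j + x\<^sub>j\<^sub>i) / 2 + \<i> (x\<^sub>i\<^sub>j - x\<^sub>j\<^sub>i) / 2\<close>. The map is an isometry of Euclidean spaces
  onto the hermitian matrices, for the squared norm \<open>Tr A\<^sup>2\<close> on the latter; up to a constant factor,
  irrelevant after normalization, the image of Lebesgue measure is the product of the
  Lebesgue measures in the diagonal entries and in the real and imaginary parts of the
  entries above the diagonal.
\<close>

definition herm_of_real :: "real ^ 'n ^ 'n \<Rightarrow> 'n::finite cmat" where
  "herm_of_real x =
     (\<chi> i j. Complex ((x $ i $ j + x $ j $ i) / 2) ((x $ i $ j - x $ j $ i) / 2))"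

definition herm_lborel :: "'n::finite cmat measure" where
  "herm_lborel = distr lborel (restrict_space borel hermitian_mats) herm_of_real"

text \<open>
  A pair \<open>(h, ds)\<close> stands for the index of the variable \<open>t\<^bsub>h; d\<^sub>1, \<dots>, d\<^sub>k\<^esub>\<close>, and
  \<open>potential (h, ds)\<close> is the coefficient of this variable in the exponent. Lists \<open>ds\<close> that
  are empty or contain \<open>0\<close> do not index a variable. The variables are not assumed to be
  symmetric in \<open>d\<^sub>1, \<dots>, d\<^sub>k\<close>; usual maps, or maps with loops, are obtained by setting some
  of the variables to \<open>0\<close>, that is, by looking only at the coefficients of the monomials in the
  other variables.
\<close>

definition potential :: "nat \<times> nat list \<Rightarrow> 'n::finite cmat \<Rightarrow> complex" where
  "potential x A = (case x of (h, ds) \<Rightarrow>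
     if ds \<noteq> [] \<and> 0 \<notin> set ds
     then of_nat CARD('n) powi (2 - 2 * int h - int (length ds)) / fact (length ds)
            * (\<Prod>d\<leftarrow>ds. tr_pow d A / of_nat d)
     else 0)"

text \<open>
  The coefficient of \<open>\<Prod>x\<in>#X. t\<^sub>x\<close> in
  \<open>\<integral> f(A) exp (- N Tr A\<^sup>2 / 2 + \<Sum>x. t\<^sub>x potential x A) dA\<close>, where the exponential is expanded in
  the variables before integration.
\<close>

definition formal_integral :: "('n::finite cmat \<Rightarrow> complex) \<Rightarrow> (nat \<times> nat list) mfps" where
  "formal_integral f X =
     (\<integral>A. f A * (\<Prod>x\<in>#X. potential x A) / (\<Prod>x\<in>set_mset X. fact (count X x))
            * exp (- (of_nat CARD('n) * tr_pow 2 A / 2)) \<partial>herm_lborel)"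

text \<open>
  Normalized expectation values are formal power series. An identity that is linear in the
  expectation holds for these series if and only if it holds for each of the functionals
  \<open>\<lambda>f. formal_expectation f X\<close>.
\<close>

definition formal_expectation :: "('n::finite cmat \<Rightarrow> complex) \<Rightarrow> (nat \<times> nat list) mfps" where
  "formal_expectation f = mfps_div (formal_integral f) (formal_integral (\<lambda>_ :: 'n cmat. 1))"

end

theory Submission
  imports Defs "HOL-Probability.Distributions"
begin

text \<open>
  Let \<open>T(i, k)\<close> be the expectation of \<open>\<Prod>j. M\<^bsub>i\<^sub>j,k\<^sub>j\<^esub>\<close>. By unitary invariance, \<open>T(i, k)\<close> is the sum of
  the expectations \<open>P(p)\<close> of the permutation monomials over all permutations \<open>p\<close> with
  \<open>k = i \<circ> p\<close>. This holds for injective \<open>i\<close> by conjugation with diagonal and permutation matrices;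
  the other cases are reduced to it by conjugation with a rotation in a coordinate plane, the
  diagonal matrices separating the weights. Summing over \<open>k = i \<circ> s\<close>, the expectation of the power
  sum attached to \<open>s\<close> is \<open>\<Sum>p. F(p s\<^bsup>-1\<^esup>) P(p)\<close>, where \<open>F(p)\<close> is the number of colourings of
  \<open>{1..L}\<close> by \<open>N\<close> colours that are invariant under \<open>p\<close>.

  Every permutation has exactly one strictly monotone factorization into transpositions, its
  length being \<open>L\<close> minus the number of cycles, so \<open>F\<close> is \<open>N\<^sup>L\<close> times the generating function of
  the strictly monotone words at \<open>1/N\<close>. The generating function of weakly monotone words at
  \<open>-1/N\<close>, which converges since \<open>L \<le> N\<close>, is \<open>N\<^sup>L\<close> times the inverse of \<open>F\<close> in the group algebra: in
  the product, the ways to split a nonempty word into a weakly increasing and a strictly decreasing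
  part cancel in pairs.
\<close>

section \<open>Monotone words in transpositions\<close>

text \<open>Neither characters nor full Schur-Weyl duality is needed: it is enough that permutations
  of tensor factors commute with \<open>U\<close>, together with an explicit elimination of repeated
  indices. In the group algebra of the symmetric group, monotone words evaluate \<open>e_k\<close>
  and \<open>h_k\<close> at the Jucys-Murphy elements, and the cancellation is the identity that the
  sum of \<open>(-1)^k h_k e_(n-k)\<close> is 0 for \<open>n > 0\<close>. It pairs weakly increasing
  words with strictly decreasing ones, while the Hurwitz numbers use strictly increasing ones; this
  is harmless because a permutation and its inverse have the same invariant colourings. That the
  weak generating function is constant on conjugacy classes is not read off from words. It is
  deduced from its being an inverse of the class function \<open>F\<close>. Genuine and formal
  measures share only linearity on monomials and invariance under conjugation. For formal measures
  both are shown for each coefficient, and invariance reduces to that of Lebesgue measure under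
  linear isometries.\<close>

definition words :: "(nat \<Rightarrow> nat \<Rightarrow> bool) \<Rightarrow> nat \<Rightarrow> nat \<Rightarrow> (nat \<times> nat) list set" where
  "words R L k =
     {ts. length ts = k \<and> (\<forall>(a, b)\<in>set ts. 1 \<le> a \<and> a < b \<and> b \<le> L) \<and> sorted_wrt R (map snd ts)}"

definition word_perm :: "(nat \<times> nat) list \<Rightarrow> nat \<Rightarrow> nat" where
  "word_perm ts = foldr (\<lambda>(a, b) q. Transposition.transpose a b \<circ> q) ts id"

text \<open>In the group algebra, this is the coefficient of \<open>p\<close> in \<open>e_k\<close>
  (for \<open><\<close> and \<open>>\<close>) or \<open>h_k\<close> (for \<open>\<le>\<close>) of
  the Jucys-Murphy elements, the \<open>b\<close>-th of which is the sum of the transpositions of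
  \<open>a\<close> and \<open>b\<close> with \<open>a < b\<close>.\<close>

definition word_count :: "(nat \<Rightarrow> nat \<Rightarrow> bool) \<Rightarrow> nat \<Rightarrow> nat \<Rightarrow> (nat \<Rightarrow> nat) \<Rightarrow> nat" where
  "word_count R L k p = card {ts \<in> words R L k. word_perm ts = p}"

lemma foldr_transpose:
  "foldr (\<lambda>(a, b) q. Transposition.transpose a b \<circ> q) ts s = word_perm ts \<circ> s"
  by (induction ts) (auto simp: word_perm_def comp_assoc)

lemma word_perm_Nil [simp]: "word_perm [] = id"
  by (simp add: word_perm_def)

lemma word_perm_Cons: "word_perm (x # ts) = Transposition.transpose (fst x) (snd x) \<circ> word_perm ts"
  by (simp add: word_perm_def split_beta)

lemma word_perm_append: "word_perm (us @ ts) = word_perm us \<circ> word_perm ts"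
  by (induction us) (simp_all add: word_perm_Cons comp_assoc)

lemma word_perm_snoc: "word_perm (us @ [(a, b)]) = word_perm us \<circ> Transposition.transpose a b"
  by (simp add: word_perm_append word_perm_Cons)

lemma finite_words: "finite (words R L k)"
proof (rule finite_subset)
  show "words R L k \<subseteq> {ts. set ts \<subseteq> {1..L} \<times> {1..L} \<and> length ts = k}"
    by (fastforce simp: words_def)
  show "finite {ts. set ts \<subseteq> {1..L} \<times> {1..L} \<and> length ts = k}"
    by (rule finite_lists_length_eq) simp
qed

lemma word_perm_permutes:
  assumes "ts \<in> words R L k"
  shows "word_perm ts permutes {1..L}"
proof -
  have "\<forall>(a, b)\<in>set ts. 1 \<le> a \<and> a < b \<and> b \<le> L"
    using assms by (simp add: words_def)
  then show ?thesis
  proof (induction ts)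
    case Nil
    show ?case by (simp only: word_perm_Nil permutes_id)
  next
    case (Cons x ts)
    have "Transposition.transpose (fst x) (snd x) permutes {1..L}"
      using Cons.prems by (intro permutes_swap_id) (auto simp: split_beta)
    then show ?case
      unfolding word_perm_Cons using Cons by (intro permutes_compose) auto
  qed
qed

lemma bij_word_perm: "bij (word_perm ts)"
  by (induction ts) (simp_all only: word_perm_Cons word_perm_Nil bij_id bij_transpose bij_comp)

lemma word_perm_rev:
  "word_perm (rev ts) = inv (word_perm ts)"
proof (induction ts)
  case (Cons x ts)
  have "inv (word_perm (x # ts)) = inv (word_perm ts) \<circ> Transposition.transpose (fst x) (snd x)"
    unfolding word_perm_Cons by (subst o_inv_distrib) (auto simp: bij_word_perm)
  then show ?case
    using Cons word_perm_snoc[of "rev ts" "fst x" "snd x"] by simp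
qed (simp add: inv_id)

text \<open>Reversing a word inverts its product and turns decreasing maxima into increasing ones.
  The cancelling splittings involve decreasing words, the Hurwitz numbers increasing ones.\<close>

lemma word_count_greater:
  assumes "p permutes {1..L}"
  shows "word_count (>) L k p = word_count (<) L k (inv p)"
  unfolding word_count_def
proof (rule bij_betw_same_card[of rev], rule bij_betw_imageI)
  show "rev ` {ts \<in> words (>) L k. word_perm ts = p} = {ts \<in> words (<) L k. word_perm ts = inv p}"
  proof (intro equalityI subsetI)
    fix ts assume "ts \<in> rev ` {ts \<in> words (>) L k. word_perm ts = p}"
    then show "ts \<in> {ts \<in> words (<) L k. word_perm ts = inv p}"
      by (auto simp: words_def word_perm_rev rev_map[symmetric] sorted_wrt_rev)
  next
    fix ts assume ts: "ts \<in> {ts \<in> words (<) L k. word_perm ts = inv p}"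
    then have "rev ts \<in> {ts \<in> words (>) L k. word_perm ts = p}"
      using permutes_inv_inv[OF assms] by (auto simp: words_def word_perm_rev rev_map[symmetric] sorted_wrt_rev)
    then show "ts \<in> rev ` {ts \<in> words (>) L k. word_perm ts = p}"
      by (rule rev_image_eqI) simp
  qed
qed (simp add: inj_on_def)

lemma words_snoc:
  "us @ [(a, b)] \<in> words R L k \<longleftrightarrow>
    Suc (length us) = k \<and> us \<in> words R L (length us) \<and> 1 \<le> a \<and> a < b \<and> b \<le> L
    \<and> (\<forall>y\<in>set us. R (snd y) b)"
proof -
  have "sorted_wrt R (map snd (us @ [(a, b)])) \<longleftrightarrow> sorted_wrt R (map snd us) \<and> (\<forall>y\<in>set us. R (snd y) b)"
    by (simp add: sorted_wrt_append)
  moreover have "(\<forall>(a, b)\<in>set (us @ [(a, b)]). 1 \<le> a \<and> a < b \<and> b \<le> L) \<longleftrightarrow>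
      (\<forall>(a, b)\<in>set us. 1 \<le> a \<and> a < b \<and> b \<le> L) \<and> 1 \<le> a \<and> a < b \<and> b \<le> L"
    by (simp add: conj_commute)
  ultimately show ?thesis
    unfolding words_def mem_Collect_eq by (auto simp only: length_append list.size)
qed

lemma words_iff_bound:
  "us \<in> words R L k \<longleftrightarrow> us \<in> words R (Suc L) k \<and> (\<forall>y\<in>set us. snd y \<le> L)"
proof -
  have "(\<forall>(a, b)\<in>set us. 1 \<le> a \<and> a < b \<and> b \<le> L) \<longleftrightarrow>
      (\<forall>(a, b)\<in>set us. 1 \<le> a \<and> a < b \<and> b \<le> Suc L) \<and> (\<forall>y\<in>set us. snd y \<le> L)"
    by fastforce
  then show ?thesis
    unfolding words_def by blast
qed

lemma Nil_in_words [simp]: "[] \<in> words R L k \<longleftrightarrow> k = 0"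
  by (auto simp: words_def)

text \<open>Only the last letter can have maximum \<open>Suc L\<close>, and by strictness only once,
  so what precedes it is a word over \<open>{1..L}\<close>. This recursion drives
  \<open>unique_strict_word\<close>.\<close>

lemma words_less_Suc:
  "us \<in> words (<) (Suc L) k \<longleftrightarrow>
    us \<in> words (<) L k \<or>
    (\<exists>us' a. us = us' @ [(a, Suc L)] \<and> Suc (length us') = k \<and> 1 \<le> a \<and> a \<le> L
        \<and> us' \<in> words (<) L (length us'))"
proof (cases us rule: rev_cases)
  case (snoc us' x)
  obtain a b where x: "x = (a, b)" by force
  show ?thesis
  proof (cases "b = Suc L")
    case True
    then show ?thesis
      unfolding snoc x words_snoc by (auto simp: less_Suc_eq_le words_iff_bound[of us' _ L])
  next
    case False
    then show ?thesis
      unfolding snoc x words_snoc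
      by (auto simp: le_Suc_eq words_iff_bound[of us' _ L])
  qed
qed simp

text \<open>The maximum \<open>Suc L\<close> may repeat, so the prefix left after removing the last
  letter is again a word over \<open>{1..Suc L}\<close>; this self-reference produces the geometric
  series in \<open>summable_card_words\<close>.\<close>

lemma words_le_Suc:
  "us \<in> words (\<le>) (Suc L) k \<longleftrightarrow>
    us \<in> words (\<le>) L k \<or>
    (\<exists>us' a. us = us' @ [(a, Suc L)] \<and> Suc (length us') = k \<and> 1 \<le> a \<and> a \<le> L
        \<and> us' \<in> words (\<le>) (Suc L) (length us'))"
proof (cases us rule: rev_cases)
  case (snoc us' x)
  obtain a b where x: "x = (a, b)" by force
  have bound: "snd y \<le> Suc L" if "us' \<in> words (\<le>) (Suc L) (length us')" "y \<in> set us'" for y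
    using that by (auto simp: words_def)
  show ?thesis
  proof (cases "b = Suc L")
    case True
    then show ?thesis
      unfolding snoc x words_snoc using bound by (simp add: less_Suc_eq_le) blast
  next
    case False
    then show ?thesis
      unfolding snoc x words_snoc
      by (auto simp: le_Suc_eq words_iff_bound[of us' _ L])
  qed
qed simp

section \<open>The signed sum over the splittings of a word\<close>

text \<open>
  If \<open>v\<close> is not empty, then either no splitting position is admissible or exactly two neighbouring
  positions are: the maximal entry can be put at the end of the first part or at the start of the
  second one.
\<close>

lemma signed_splittings:
  fixes v :: "nat list"
  shows "(\<Sum>k\<le>length v. if sorted_wrt (\<le>) (take k v) \<and> sorted_wrt (>) (drop k v) then (-1) ^ k else 0)
      = (if v = [] then 1 else (0 :: real))"
proof (induction v)
  case (Cons x v)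
  let ?t = "\<lambda>v k. if sorted_wrt (\<le>) (take k v) \<and> sorted_wrt (>) (drop k v) then (-1) ^ k else (0::real)"
  have split: "(\<Sum>k\<le>length (x # v). ?t (x # v) k)
      = ?t (x # v) 0 + (\<Sum>k\<le>length v. ?t (x # v) (Suc k))"
    by (subst sum.atMost_Suc_shift[symmetric]) simp
  show ?case
  proof (cases v)
    case Nil
    then show ?thesis by simp
  next
    case v: (Cons y w)
    show ?thesis
    proof (cases "x \<le> y")
      case True
      \<comment> \<open>An \<open>x \<le> y\<close> in front can always join the first part, so
        every position moves by one and the sign flips; position 0 is excluded because
        \<open>x # v\<close> does not start with a descent.\<close>
      have "?t (x # v) (Suc k) = - ?t v k" for k
        using True by (cases k) (auto simp: v)
      then have "(\<Sum>k\<le>length v. ?t (x # v) (Suc k)) = - (\<Sum>k\<le>length v. ?t v k)"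
        by (simp add: sum_negf)
      with Cons True show ?thesis
        unfolding split by (simp add: v)
    next
      case False
      \<comment> \<open>After a descent \<open>x > y\<close> the first part has at most one entry;
        positions 0 and 1 both require \<open>v\<close> to be strictly decreasing and have opposite
        signs.\<close>
      have "?t (x # v) (Suc (Suc k)) = 0" for k
        using False by (auto simp: v)
      then have "(\<Sum>k\<le>Suc (length w). ?t (x # v) (Suc k)) = ?t (x # v) (Suc 0)"
        by (subst sum.atMost_Suc_shift) simp
      then have "(\<Sum>k\<le>length v. ?t (x # v) (Suc k)) = ?t (x # v) (Suc 0)"
        by (simp add: v)
      with False show ?thesis
        unfolding split using order.strict_trans by (fastforce simp: v)
    qed
  qed
qed simp

section \<open>Generating functions of monotone words\<close>

text \<open>The cardinality is \<open>card C\<close> to the number of cycles of \<open>p\<close>.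
  Counting colourings replaces counting cycles throughout, since this is the form in which sums over
  matrix indices produce it.\<close>

definition invariant_colourings :: "'c set \<Rightarrow> nat \<Rightarrow> (nat \<Rightarrow> nat) \<Rightarrow> (nat \<Rightarrow> 'c) set" where
  "invariant_colourings C L p = {i \<in> {1..L} \<rightarrow>\<^sub>E C. \<forall>j\<in>{1..L}. i (p j) = i j}"

text \<open>The fixed point \<open>Suc L\<close> is a cycle of its own and takes any colour.\<close>

lemma card_invariant_colourings_Suc:
  assumes "p permutes {1..L}"
  shows "card (invariant_colourings C (Suc L) p) = card C * card (invariant_colourings C L p)"
proof -
  have p: "p (Suc L) = Suc L"
    using assms by (intro permutes_not_in[OF assms]) simp
  have pj: "p j \<in> {1..L}" if "j \<in> {1..L}" for j
    using permutes_in_image[OF assms, of j] that by simp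
  have "bij_betw (\<lambda>(c, i). i(Suc L := c)) (C \<times> invariant_colourings C L p)
      (invariant_colourings C (Suc L) p)"
  proof (rule bij_betw_byWitness[where f' = "\<lambda>i. (i (Suc L), i(Suc L := undefined))"])
    show "\<forall>x\<in>C \<times> invariant_colourings C L p.
        (\<lambda>i. (i (Suc L), i(Suc L := undefined))) ((\<lambda>(c, i). i(Suc L := c)) x) = x"
      by (auto simp: invariant_colourings_def fun_eq_iff PiE_def extensional_def)
    show "(\<lambda>(c, i). i(Suc L := c)) ` (C \<times> invariant_colourings C L p)
        \<subseteq> invariant_colourings C (Suc L) p"
    proof (rule image_subsetI, clarify)
      fix c i assume c: "c \<in> C" and i: "i \<in> invariant_colourings C L p"
      have "(i(Suc L := c)) (p j) = (i(Suc L := c)) j" if "j \<in> {1..Suc L}" for j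
        using i p pj[of j] that by (cases "j = Suc L") (auto simp: invariant_colourings_def)
      moreover have "i(Suc L := c) \<in> {1..Suc L} \<rightarrow>\<^sub>E C"
        using c i by (auto simp: invariant_colourings_def PiE_def extensional_def Pi_def le_Suc_eq)
      ultimately show "i(Suc L := c) \<in> invariant_colourings C (Suc L) p"
        by (simp add: invariant_colourings_def)
    qed
    show "(\<lambda>i. (i (Suc L), i(Suc L := undefined))) ` invariant_colourings C (Suc L) p
        \<subseteq> C \<times> invariant_colourings C L p"
    proof (rule image_subsetI)
      fix i assume i: "i \<in> invariant_colourings C (Suc L) p"
      have "(i(Suc L := undefined)) (p j) = (i(Suc L := undefined)) j" if "j \<in> {1..L}" for j
        using i pj[of j] that by (auto simp: invariant_colourings_def)
      moreover have "i(Suc L := undefined) \<in> {1..L} \<rightarrow>\<^sub>E C"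
        using i by (auto simp: invariant_colourings_def PiE_def extensional_def Pi_def)
      moreover have "i (Suc L) \<in> C"
        using i by (auto simp: invariant_colourings_def)
      ultimately show "(i (Suc L), i(Suc L := undefined)) \<in> C \<times> invariant_colourings C L p"
        by (simp add: invariant_colourings_def)
    qed
  qed auto
  then show ?thesis
    by (simp add: bij_betw_same_card[symmetric] card_cartesian_product)
qed

text \<open>The transposition inserts \<open>Suc L\<close> into the cycle of \<open>a\<close>, so
  its colour is forced to be that of \<open>a\<close> and no factor \<open>card C\<close>
  arises.\<close>

lemma card_invariant_colourings_transpose:
  assumes "p permutes {1..L}" and a: "a \<in> {1..L}"
  shows "card (invariant_colourings C (Suc L) (p \<circ> Transposition.transpose a (Suc L)))
      = card (invariant_colourings C L p)"
proof -
  let ?q = "p \<circ> Transposition.transpose a (Suc L)"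
  have p: "p (Suc L) = Suc L"
    using assms by (intro permutes_not_in[OF assms(1)]) simp
  have pj: "p j \<in> {1..L}" if "j \<in> {1..L}" for j
    using permutes_in_image[OF assms(1), of j] that by simp
  have aL: "a \<noteq> Suc L" using a by simp
  have "bij_betw (\<lambda>i. i(Suc L := i a)) (invariant_colourings C L p) (invariant_colourings C (Suc L) ?q)"
  proof (rule bij_betw_byWitness[where f' = "\<lambda>i. i(Suc L := undefined)"])
    show "\<forall>i\<in>invariant_colourings C L p. (i(Suc L := i a))(Suc L := undefined) = i"
      by (auto simp: invariant_colourings_def fun_eq_iff PiE_def extensional_def)
    have qa: "i (Suc L) = i a" if "i \<in> invariant_colourings C (Suc L) ?q" for i
    proof -
      have "a \<in> {1..Suc L}" using a by simp
      then have "i (?q a) = i a" using that unfolding invariant_colourings_def by blast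
      then show ?thesis using p by simp
    qed
    show "\<forall>i\<in>invariant_colourings C (Suc L) ?q.
        (i(Suc L := undefined))(Suc L := (i(Suc L := undefined)) a) = i"
    proof (intro ballI ext)
      fix i x assume "i \<in> invariant_colourings C (Suc L) ?q"
      from qa[OF this] aL
      show "((i(Suc L := undefined))(Suc L := (i(Suc L := undefined)) a)) x = i x" by simp
    qed
    show "(\<lambda>i. i(Suc L := i a)) ` invariant_colourings C L p \<subseteq> invariant_colourings C (Suc L) ?q"
    proof (rule image_subsetI)
      fix i assume i: "i \<in> invariant_colourings C L p"
      have inv: "i (p j) = i j" if "j \<in> {1..L}" for j
        using i that by (simp add: invariant_colourings_def)
      have "(i(Suc L := i a)) (?q j) = (i(Suc L := i a)) j" if j: "j \<in> {1..Suc L}" for j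
      proof -
        consider "j = a" | "j = Suc L" | "j \<noteq> a" "j \<noteq> Suc L" by blast
        then show ?thesis
        proof cases
          case 1
          then show ?thesis using p aL by simp
        next
          case 2
          then show ?thesis using inv[OF a] pj[OF a] by auto
        next
          case 3
          then have "j \<in> {1..L}" using j by auto
          with 3 show ?thesis using inv[of j] pj[of j] by (auto simp: transpose_apply_other)
        qed
      qed
      moreover have "i(Suc L := i a) \<in> {1..Suc L} \<rightarrow>\<^sub>E C"
        using a i by (auto simp: invariant_colourings_def PiE_def extensional_def Pi_def le_Suc_eq)
      ultimately show "i(Suc L := i a) \<in> invariant_colourings C (Suc L) ?q"
        by (simp add: invariant_colourings_def)
    qed
    show "(\<lambda>i. i(Suc L := undefined)) ` invariant_colourings C (Suc L) ?q \<subseteq> invariant_colourings C L p"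
    proof (rule image_subsetI)
      fix i assume i: "i \<in> invariant_colourings C (Suc L) ?q"
      have inv: "i (?q j) = i j" if "j \<in> {1..Suc L}" for j
        using i that unfolding invariant_colourings_def by blast
      have "(i(Suc L := undefined)) (p j) = (i(Suc L := undefined)) j" if j: "j \<in> {1..L}" for j
      proof (cases "j = a")
        case True
        then show ?thesis using inv[of "Suc L"] qa[OF i] pj[OF a] aL by auto
      next
        case False
        then show ?thesis using inv[of j] j pj[OF j] by (auto simp: transpose_apply_other)
      qed
      moreover have "i(Suc L := undefined) \<in> {1..L} \<rightarrow>\<^sub>E C"
        using i by (auto simp: invariant_colourings_def PiE_def extensional_def Pi_def)
      ultimately show "i(Suc L := undefined) \<in> invariant_colourings C L p"
        by (simp add: invariant_colourings_def)
    qed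
  qed
  then show ?thesis
    by (simp add: bij_betw_same_card)
qed

text \<open>A word over \<open>{1..L}\<close> fixes \<open>Suc L\<close>, so a last letter
  \<open>(a, Suc L)\<close> occurs exactly when \<open>p\<close> moves \<open>Suc L\<close>, and
  then \<open>a\<close> is the preimage of \<open>Suc L\<close>; removing it leaves a permutation of
  \<open>{1..L}\<close>. The second conjunct carries the relation between length and number of
  cycles through powers of \<open>card C\<close>.\<close>

lemma unique_strict_word:
  assumes "p permutes {1..L}"
  shows "\<exists>ts. (\<forall>k us. us \<in> words (<) L k \<and> word_perm us = p \<longleftrightarrow> k = length ts \<and> us = ts)
      \<and> card (invariant_colourings C L p) * card C ^ length ts = card C ^ L"
  using assms
proof (induction L arbitrary: p)
  case 0
  then have "p = id" by simp
  then have "us \<in> words (<) 0 k \<and> word_perm us = p \<longleftrightarrow> k = length [] \<and> us = []" for k us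
    by (cases us) (auto simp: words_def)
  moreover have "invariant_colourings C 0 p = {\<lambda>_. undefined}"
    by (auto simp: invariant_colourings_def)
  ultimately show ?case by (intro exI[of _ "[]"]) simp
next
  case (Suc L)
  have fixes_Suc: "word_perm us (Suc L) = Suc L" if "us \<in> words (<) L k" for us k
    by (rule permutes_not_in[OF word_perm_permutes[OF that]]) simp
  show ?case
  proof (cases "p (Suc L) = Suc L")
    case True
    have p: "p permutes {1..L}"
      by (rule permutes_superset[OF Suc.prems]) (use True in \<open>auto simp: le_Suc_eq\<close>)
    obtain ts where ts: "\<And>k us. us \<in> words (<) L k \<and> word_perm us = p \<longleftrightarrow> k = length ts \<and> us = ts"
        and card: "card (invariant_colourings C L p) * card C ^ length ts = card C ^ L"
      using Suc.IH[OF p] by blast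
    have "word_perm (us @ [(a, Suc L)]) \<noteq> p" if "us \<in> words (<) L k" "a \<le> L" for us k a
    proof
      assume *: "word_perm (us @ [(a, Suc L)]) = p"
      have "p a = Suc L"
        using fixes_Suc[OF that(1)] by (simp add: word_perm_snoc flip: *)
      with True have "p a = p (Suc L)" by simp
      then have "a = Suc L" using permutes_inj[OF Suc.prems] by (simp add: inj_def)
      with that show False by simp
    qed
    then have "us \<in> words (<) (Suc L) k \<and> word_perm us = p \<longleftrightarrow> k = length ts \<and> us = ts" for k us
      unfolding words_less_Suc using ts by blast
    moreover have "card (invariant_colourings C (Suc L) p) * card C ^ length ts = card C ^ Suc L"
      unfolding card_invariant_colourings_Suc[OF p] using card by simp
    ultimately show ?thesis by blast
  next
    case False
    define a where "a = inv p (Suc L)"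
    have pa: "p a = Suc L"
      unfolding a_def using permutes_inverses(1)[OF Suc.prems] .
    have "a \<in> {1..Suc L}"
      using permutes_in_image[OF Suc.prems, of a] pa by simp
    moreover have "a \<noteq> Suc L" using pa False by auto
    ultimately have a: "a \<in> {1..L}" by auto
    define q where "q = p \<circ> Transposition.transpose a (Suc L)"
    have pq: "p = q \<circ> Transposition.transpose a (Suc L)"
      unfolding q_def by (simp add: comp_assoc)
    have "q permutes {1..Suc L}"
      unfolding q_def using a by (intro permutes_compose Suc.prems permutes_swap_id) auto
    then have q: "q permutes {1..L}"
      by (rule permutes_superset) (use pa in \<open>auto simp: q_def le_Suc_eq\<close>)
    obtain ts where ts: "\<And>k us. us \<in> words (<) L k \<and> word_perm us = q \<longleftrightarrow> k = length ts \<and> us = ts"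
        and card: "card (invariant_colourings C L q) * card C ^ length ts = card C ^ L"
      using Suc.IH[OF q] by blast
    have snoc: "word_perm (us @ [(a', Suc L)]) = p \<longleftrightarrow> a' = a \<and> word_perm us = q"
      if "us \<in> words (<) L k" for us k a'
    proof
      assume *: "word_perm (us @ [(a', Suc L)]) = p"
      have "p a' = Suc L"
        using fixes_Suc[OF that] by (simp add: word_perm_snoc flip: *)
      with pa have "a' = a" using permutes_inj[OF Suc.prems] by (simp add: inj_def)
      with * show "a' = a \<and> word_perm us = q"
        by (auto simp: q_def word_perm_snoc comp_assoc)
    next
      assume "a' = a \<and> word_perm us = q"
      then show "word_perm (us @ [(a', Suc L)]) = p" by (simp add: word_perm_snoc pq)
    qed
    have "us \<in> words (<) (Suc L) k \<and> word_perm us = p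
        \<longleftrightarrow> k = length (ts @ [(a, Suc L)]) \<and> us = ts @ [(a, Suc L)]" (is "?l \<longleftrightarrow> ?r") for k us
    proof
      assume l: ?l
      then have "us \<notin> words (<) L k" using fixes_Suc False by blast
      with l obtain us' a' where us': "us = us' @ [(a', Suc L)]" "Suc (length us') = k"
          "us' \<in> words (<) L (length us')"
        using words_less_Suc[of us L k] by blast
      have "word_perm (us' @ [(a', Suc L)]) = p" using l us'(1) by simp
      then have "a' = a \<and> word_perm us' = q" unfolding snoc[OF us'(3)] .
      with us' ts[of us' "length us'"] show ?r by simp
    next
      assume r: ?r
      have "ts \<in> words (<) L (length ts) \<and> word_perm ts = q" using ts by blast
      with r a snoc[of ts "length ts" a] show ?l
        by (simp add: words_less_Suc)
    qed
    moreover have "card (invariant_colourings C (Suc L) p) * card C ^ length (ts @ [(a, Suc L)])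
        = card C ^ Suc L"
      unfolding pq card_invariant_colourings_transpose[OF q a] using card by simp
    ultimately show ?thesis by blast
  qed
qed

text \<open>By uniqueness the series has a single non-zero term, at the length of the only word for
  \<open>p\<close>.\<close>

lemma strict_words_sums:
  assumes p: "p permutes {1..L}" and C: "finite C" "C \<noteq> {}"
  shows "(\<lambda>k. real (word_count (<) L k p) / real (card C) ^ k)
      sums (real (card (invariant_colourings C L p)) / real (card C) ^ L)"
proof -
  obtain ts where ts: "\<And>k us. us \<in> words (<) L k \<and> word_perm us = p \<longleftrightarrow> k = length ts \<and> us = ts"
      and card: "card (invariant_colourings C L p) * card C ^ length ts = card C ^ L"
    using unique_strict_word[OF p] by blast
  have "{us \<in> words (<) L k. word_perm us = p} = (if k = length ts then {ts} else {})" for k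
    using ts by auto
  then have "real (word_count (<) L k p) / real (card C) ^ k
      = (if k = length ts then 1 / real (card C) ^ length ts else 0)" for k
    by (simp add: word_count_def)
  moreover have "real (card (invariant_colourings C L p)) / real (card C) ^ L
      = 1 / real (card C) ^ length ts"
  proof -
    have N: "real (card C) \<noteq> 0" using C by simp
    have "real (card (invariant_colourings C L p)) * real (card C) ^ length ts = real (card C) ^ L"
      using arg_cong[OF card, of real] by simp
    then show ?thesis using N by (simp add: field_simps)
  qed
  ultimately show ?thesis
    using sums_If_finite_set[of "{length ts}" "\<lambda>_. 1 / real (card C) ^ length ts"] by simp
qed

section \<open>Invariance of the colouring count under inversion and conjugation\<close>

lemma invariant_colourings_inv:
  assumes p: "p permutes {1..L}"
  shows "invariant_colourings C L (inv p) = invariant_colourings C L p"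
proof -
  have *: "invariant_colourings C L p \<subseteq> invariant_colourings C L (inv p)" if p: "p permutes {1..L}" for p
  proof
    fix i assume i: "i \<in> invariant_colourings C L p"
    have "i (inv p j) = i j" if "j \<in> {1..L}" for j
    proof -
      have "inv p j \<in> {1..L}"
        using permutes_in_image[OF permutes_inv[OF p]] that by blast
      then have "i (p (inv p j)) = i (inv p j)"
        using i by (simp add: invariant_colourings_def)
      then show ?thesis using permutes_inverses(1)[OF p] by simp
    qed
    with i show "i \<in> invariant_colourings C L (inv p)" by (simp add: invariant_colourings_def)
  qed
  show ?thesis
    using *[OF p] *[OF permutes_inv[OF p]] permutes_inv_inv[OF p] by auto
qed

lemma card_invariant_colourings_conj:
  assumes p: "p permutes {1..L}" and q: "q permutes {1..L}"
  shows "card (invariant_colourings C L (q \<circ> p \<circ> inv q)) = card (invariant_colourings C L p)"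
proof -
  have qj: "q j \<in> {1..L} \<longleftrightarrow> j \<in> {1..L}" "inv q j \<in> {1..L} \<longleftrightarrow> j \<in> {1..L}"
      "p j \<in> {1..L} \<longleftrightarrow> j \<in> {1..L}" for j
    using permutes_in_image[OF q] permutes_in_image[OF permutes_inv[OF q]] permutes_in_image[OF p]
    by blast+
  have qi [simp]: "q (inv q j) = j" "inv q (q j) = j" for j
    using permutes_inverses[OF q] by auto
  have "bij_betw (\<lambda>i. restrict (i \<circ> q) {1..L}) (invariant_colourings C L (q \<circ> p \<circ> inv q))
      (invariant_colourings C L p)"
  proof (rule bij_betw_byWitness[where f' = "\<lambda>i. restrict (i \<circ> inv q) {1..L}"])
    show "\<forall>i\<in>invariant_colourings C L (q \<circ> p \<circ> inv q).
        restrict (restrict (i \<circ> q) {1..L} \<circ> inv q) {1..L} = i"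
      using qj by (auto simp: invariant_colourings_def fun_eq_iff restrict_def PiE_def extensional_def)
    show "\<forall>i\<in>invariant_colourings C L p. restrict (restrict (i \<circ> inv q) {1..L} \<circ> q) {1..L} = i"
      using qj by (auto simp: invariant_colourings_def fun_eq_iff restrict_def PiE_def extensional_def)
    show "(\<lambda>i. restrict (i \<circ> q) {1..L}) ` invariant_colourings C L (q \<circ> p \<circ> inv q)
        \<subseteq> invariant_colourings C L p"
    proof (rule image_subsetI)
      fix i assume i: "i \<in> invariant_colourings C L (q \<circ> p \<circ> inv q)"
      have "i (q (p j)) = i (q j)" if "j \<in> {1..L}" for j
      proof -
        have "i ((q \<circ> p \<circ> inv q) (q j)) = i (q j)"
          using i qj(1)[of j] that unfolding invariant_colourings_def by blast
        then show ?thesis by simp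
      qed
      moreover have "i (q j) \<in> C" if "j \<in> {1..L}" for j
        using i qj(1)[of j] that by (auto simp: invariant_colourings_def PiE_def Pi_def)
      ultimately show "restrict (i \<circ> q) {1..L} \<in> invariant_colourings C L p"
        using qj(3) by (auto simp: invariant_colourings_def)
    qed
    show "(\<lambda>i. restrict (i \<circ> inv q) {1..L}) ` invariant_colourings C L p
        \<subseteq> invariant_colourings C L (q \<circ> p \<circ> inv q)"
    proof (rule image_subsetI)
      fix i assume i: "i \<in> invariant_colourings C L p"
      have "i (p (inv q j)) = i (inv q j)" if "j \<in> {1..L}" for j
        using i qj(2)[of j] that unfolding invariant_colourings_def by blast
      moreover have "i (inv q j) \<in> C" if "j \<in> {1..L}" for j
        using i qj(2)[of j] that by (auto simp: invariant_colourings_def PiE_def Pi_def)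
      ultimately show "restrict (i \<circ> inv q) {1..L} \<in> invariant_colourings C L (q \<circ> p \<circ> inv q)"
        using qj by (auto simp: invariant_colourings_def)
    qed
  qed
  then show ?thesis by (rule bij_betw_same_card)
qed

text \<open>Passing from \<open>L\<close> to \<open>Suc L\<close> multiplies the generating function
  by a geometric series of ratio \<open>L / N\<close>, which is below 1 as long as
  \<open>Suc L \<le> N\<close>; the count is \<open>h_k(1, ..., L - 1)\<close>. Counting all words
  bounds the series of every \<open>p\<close> at once.\<close>

lemma summable_card_words:
  assumes "L \<le> N" "0 < N"
  shows "summable (\<lambda>k. real (card (words (\<le>) L k)) / real N ^ k)"
  using assms(1)
proof (induction L)
  case 0
  have Nil0: "ts = [] \<and> k = 0" if "ts \<in> words (\<le>) 0 k" for ts k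
    using that by (cases ts) (auto simp: words_def)
  have "words (\<le>) 0 k = (if k = 0 then {[]} else {})" for k
    by (auto dest: Nil0)
  then have "(\<lambda>k. real (card (words (\<le>) 0 k)) / real N ^ k) = (\<lambda>k. if k = 0 then 1 else 0)"
    by (auto simp: fun_eq_iff)
  then show ?case by simp
next
  case (Suc L)
  let ?c = "\<lambda>k. real (card (words (\<le>) L k)) / real N ^ k"
  let ?s = "\<lambda>k. real (card (words (\<le>) (Suc L) k)) / real N ^ k"
  have sm: "summable ?c" using Suc by simp
  have LN: "real L < real N" using Suc by simp
  have nonneg: "0 \<le> ?c k" "0 \<le> ?s k" for k by auto
  have step: "?s (Suc k) \<le> ?c (Suc k) + real L / real N * ?s k" for k
  proof -
    have "words (\<le>) (Suc L) (Suc k) \<subseteq> words (\<le>) L (Suc k) \<union>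
        (\<lambda>(us, a). us @ [(a, Suc L)]) ` (words (\<le>) (Suc L) k \<times> {1..L})"
    proof
      fix ts assume "ts \<in> words (\<le>) (Suc L) (Suc k)"
      then consider "ts \<in> words (\<le>) L (Suc k)"
        | us a where "ts = us @ [(a, Suc L)]" "us \<in> words (\<le>) (Suc L) k" "a \<in> {1..L}"
        unfolding words_le_Suc[of _ L "Suc k"] by fastforce
      then show "ts \<in> words (\<le>) L (Suc k) \<union>
          (\<lambda>(us, a). us @ [(a, Suc L)]) ` (words (\<le>) (Suc L) k \<times> {1..L})"
      proof cases
        case 1
        then show ?thesis ..
      next
        case (2 us a)
        then have "(us, a) \<in> words (\<le>) (Suc L) k \<times> {1..L}" by simp
        then show ?thesis using 2(1) by (auto intro: rev_image_eqI)
      qed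
    qed
    then have "card (words (\<le>) (Suc L) (Suc k)) \<le> card (words (\<le>) L (Suc k) \<union>
        (\<lambda>(us, a). us @ [(a, Suc L)]) ` (words (\<le>) (Suc L) k \<times> {1..L}))"
      by (intro card_mono) (auto simp: finite_words)
    also have "\<dots> \<le> card (words (\<le>) L (Suc k)) + card (words (\<le>) (Suc L) k \<times> {1..L})"
      by (intro order.trans[OF card_Un_le] add_left_mono card_image_le) (auto simp: finite_words)
    also have "\<dots> = card (words (\<le>) L (Suc k)) + card (words (\<le>) (Suc L) k) * L"
      by (simp add: card_cartesian_product)
    finally have "real (card (words (\<le>) (Suc L) (Suc k)))
        \<le> real (card (words (\<le>) L (Suc k))) + real (card (words (\<le>) (Suc L) k)) * real L"
      by (metis of_nat_add of_nat_le_iff of_nat_mult)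
    from divide_right_mono[OF this, of "real N ^ Suc k"] show ?thesis
      by (simp add: add_divide_distrib mult.commute)
  qed
  have "?s 0 \<le> 1"
    using card_mono[of "{[]}" "words (\<le>) (Suc L) 0"] by (auto simp: words_def)
  \<comment> \<open>\<open>K\<close> solves \<open>S = 1 + suminf ?c + L / N * S\<close>, the
    recursion \<open>step\<close> summed over \<open>k\<close>.\<close>
  define K where "K = (1 + suminf ?c) / (1 - real L / real N)"
  have pos: "0 < 1 - real L / real N" using LN by (simp add: field_simps)
  have "(\<Sum>k<n. ?s k) \<le> K" for n
  proof -
    have "(\<Sum>k<n. ?s k) \<le> (\<Sum>k<Suc n. ?s k)" by (simp add: nonneg)
    also have "\<dots> = ?s 0 + (\<Sum>k<n. ?s (Suc k))" by (rule sum.lessThan_Suc_shift)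
    also have "\<dots> \<le> 1 + ((\<Sum>k<n. ?c (Suc k)) + real L / real N * (\<Sum>k<n. ?s k))"
      unfolding sum_distrib_left sum.distrib[symmetric]
      by (intro add_mono \<open>?s 0 \<le> 1\<close> sum_mono step)
    also have "(\<Sum>k<n. ?c (Suc k)) \<le> (\<Sum>k<Suc n. ?c k)"
      unfolding sum.lessThan_Suc_shift using nonneg(1)[of 0] by simp
    also have "\<dots> \<le> suminf ?c"
      by (rule sum_le_suminf[OF sm]) (use nonneg in auto)
    finally have "(\<Sum>k<n. ?s k) * (1 - real L / real N) \<le> 1 + suminf ?c"
      by (simp add: algebra_simps)
    then show ?thesis unfolding K_def using pos by (simp only: pos_le_divide_eq)
  qed
  then show ?case by (intro summableI_nonneg_bounded nonneg)
qed

lemma word_count_le_card: "word_count R L k p \<le> card (words R L k)"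
  unfolding word_count_def by (intro card_mono finite_words) auto

text \<open>Absolute convergence is what the Cauchy product in \<open>weak_gf_convolution\<close>
  requires.\<close>

lemma summable_weak_words:
  assumes "L \<le> N" "0 < N"
  shows "summable (\<lambda>k. norm (real (word_count (\<le>) L k p) / (- real N) ^ k))"
  by (rule summable_comparison_test[OF _ summable_card_words[OF assms]])
    (auto simp: power_abs word_count_le_card intro!: exI[of _ 0] divide_right_mono)

text \<open>For \<open>0 < N\<close> and \<open>L \<le> N\<close> this is \<open>N ^ L\<close> times
  the unitary Weingarten function.\<close>

definition weak_gf :: "nat \<Rightarrow> nat \<Rightarrow> (nat \<Rightarrow> nat) \<Rightarrow> real" where
  "weak_gf N L p = (\<Sum>k. real (word_count (\<le>) L k p) / (- real N) ^ k)"

text \<open>A pair of a weakly increasing and a strictly decreasing word is a splitting of their concatenation.\<close>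

lemma sum_word_counts:
  assumes p: "p permutes {1..L}" and k: "k \<le> n"
  shows "(\<Sum>s | s permutes {1..L}. word_count (\<le>) L k (p \<circ> inv s) * word_count (>) L (n - k) s)
    = card {v \<in> words (\<lambda>_ _. True) L n. word_perm v = p
        \<and> sorted_wrt (\<le>) (take k (map snd v)) \<and> sorted_wrt (>) (drop k (map snd v))}"
    (is "_ = card ?V")
proof -
  let ?A = "\<lambda>s. {ts \<in> words (\<le>) L k. word_perm ts = p \<circ> inv s} \<times> {ts \<in> words (>) L (n - k). word_perm ts = s}"
  have "bij_betw (\<lambda>(s, us, ts). us @ ts) (Sigma {s. s permutes {1..L}} ?A) ?V"
  proof (rule bij_betw_byWitness[where f' = "\<lambda>v. (word_perm (drop k v), take k v, drop k v)"])
    show "\<forall>x\<in>Sigma {s. s permutes {1..L}} ?A.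
        (\<lambda>v. (word_perm (drop k v), take k v, drop k v)) ((\<lambda>(s, us, ts). us @ ts) x) = x"
      by (auto simp: words_def)
    show "\<forall>v\<in>?V. (\<lambda>(s, us, ts). us @ ts) (word_perm (drop k v), take k v, drop k v) = v"
      by simp
    show "(\<lambda>(s, us, ts). us @ ts) ` Sigma {s. s permutes {1..L}} ?A \<subseteq> ?V"
    proof (rule image_subsetI, clarify)
      fix us ts
      assume s: "word_perm ts permutes {1..L}" and us: "us \<in> words (\<le>) L k"
        "word_perm us = p \<circ> inv (word_perm ts)"
        and ts: "ts \<in> words (>) L (n - k)"
      have "word_perm (us @ ts) = p"
        unfolding word_perm_append us(2) by (simp add: comp_assoc permutes_inv_o[OF s])
      then show "us @ ts \<in> words (\<lambda>_ _. True) L n \<and> word_perm (us @ ts) = p \<and>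
          sorted_wrt (\<le>) (take k (map snd (us @ ts))) \<and> sorted_wrt (>) (drop k (map snd (us @ ts)))"
        using us(1) ts k by (auto simp: words_def sorted_wrt_append)
    qed
    show "(\<lambda>v. (word_perm (drop k v), take k v, drop k v)) ` ?V \<subseteq> Sigma {s. s permutes {1..L}} ?A"
    proof (rule image_subsetI)
      fix v assume v: "v \<in> ?V"
      have ts: "drop k v \<in> words (>) L (n - k)" and us: "take k v \<in> words (\<le>) L k"
        using v k unfolding words_def
        by (auto simp: drop_map take_map dest!: in_set_dropD in_set_takeD)
      have s: "word_perm (drop k v) permutes {1..L}"
        by (rule word_perm_permutes[OF ts])
      have "p = word_perm (take k v) \<circ> word_perm (drop k v)"
        using v by (simp flip: word_perm_append)
      then have "word_perm (take k v) = p \<circ> inv (word_perm (drop k v))"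
        by (simp add: comp_assoc permutes_inv_o[OF s])
      with s ts us show "(word_perm (drop k v), take k v, drop k v) \<in> Sigma {s. s permutes {1..L}} ?A"
        by simp
    qed
  qed
  then have "card ?V = card (Sigma {s. s permutes {1..L}} ?A)"
    by (simp add: bij_betw_same_card)
  also have "\<dots> = (\<Sum>s | s permutes {1..L}. card (?A s))"
    by (rule card_SigmaI) (auto simp: finite_permutations finite_words)
  finally show ?thesis
    by (simp add: card_cartesian_product word_count_def)
qed

text \<open>The degree \<open>n\<close> part of \<open>H(-t) E(t) = 1\<close>. Exchanging the sums
  fixes a word and lets the splitting position vary, so \<open>signed_splittings\<close> leaves only
  the empty word, whose product is \<open>id\<close>.\<close>

lemma signed_sum_word_counts:
  assumes p: "p permutes {1..L}"
  shows "(\<Sum>k\<le>n. (-1) ^ k * real (\<Sum>s | s permutes {1..L}.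
      word_count (\<le>) L k (p \<circ> inv s) * word_count (>) L (n - k) s))
    = (if n = 0 \<and> p = id then 1 else 0)"
proof -
  let ?W = "{v \<in> words (\<lambda>_ _. True) L n. word_perm v = p}"
  let ?c = "\<lambda>k v. sorted_wrt (\<le>) (take k (map snd v)) \<and> sorted_wrt (>) (drop k (map snd v))"
  have fin: "finite ?W" by (simp add: finite_words)
  have len: "length (map snd v) = n" if "v \<in> ?W" for v using that by (simp add: words_def)
  have "(\<Sum>k\<le>n. (-1) ^ k * real (\<Sum>s | s permutes {1..L}.
      word_count (\<le>) L k (p \<circ> inv s) * word_count (>) L (n - k) s))
      = (\<Sum>k\<le>n. \<Sum>v\<in>?W. if ?c k v then (-1) ^ k else 0)"
  proof (rule sum.cong[OF refl])
    fix k assume "k \<in> {..n}"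
    then have eq: "real (\<Sum>s | s permutes {1..L}. word_count (\<le>) L k (p \<circ> inv s) * word_count (>) L (n - k) s)
        = real (card (?W \<inter> {v. ?c k v}))"
      by (subst sum_word_counts[OF p]) (auto intro!: arg_cong[where f = card])
    have "(-1) ^ k * real (card (?W \<inter> {v. ?c k v})) = (\<Sum>v\<in>?W. if ?c k v then (-1) ^ k else 0)"
      using fin by (simp add: sum.If_cases)
    then show "(-1) ^ k * real (\<Sum>s | s permutes {1..L}.
        word_count (\<le>) L k (p \<circ> inv s) * word_count (>) L (n - k) s)
        = (\<Sum>v\<in>?W. if ?c k v then (-1) ^ k else 0)"
      unfolding eq .
  qed
  also have "\<dots> = (\<Sum>v\<in>?W. \<Sum>k\<le>length (map snd v). if ?c k v then (-1) ^ k else 0)"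
    by (subst sum.swap, rule sum.cong[OF refl], simp only: len)
  also have "\<dots> = (\<Sum>v\<in>?W. if v = [] then 1 else 0)"
    unfolding signed_splittings by simp
  also have "\<dots> = (if n = 0 \<and> p = id then 1 else 0)"
  proof (cases "n = 0 \<and> p = id")
    case True
    then have "?W = {[]}" by (auto simp: words_def)
    then show ?thesis using True by simp
  next
    case False
    then have "v \<noteq> []" if "v \<in> ?W" for v
      using that by (auto simp: words_def)
    then show ?thesis using False by simp
  qed
  finally show ?thesis .
qed

lemma weak_gf_convolution:
  assumes p: "p permutes {1..L}" and C: "finite C" "C \<noteq> {}" and L: "L \<le> card C"
  shows "(\<Sum>s | s permutes {1..L}. weak_gf (card C) L (p \<circ> inv s) * real (card (invariant_colourings C L s)))
    = (if p = id then real (card C) ^ L else 0)"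
proof -
  let ?N = "real (card C)"
  let ?P = "{s. s permutes {1..L}}"
  have N: "0 < card C" using C by (simp add: card_gt_0_iff)
  let ?h = "\<lambda>s k. real (word_count (\<le>) L k (p \<circ> inv s)) / (- ?N) ^ k"
  let ?d = "\<lambda>s k. real (word_count (>) L k s) / ?N ^ k"
  \<comment> \<open>Decreasing words for \<open>s\<close> are reversed increasing words for
    \<open>inv s\<close>, and \<open>s\<close> and \<open>inv s\<close> have the same invariant
    colourings.\<close>
  have d: "?d s sums (real (card (invariant_colourings C L s)) / ?N ^ L)" if "s \<in> ?P" for s
    using strict_words_sums[of "inv s" L C] that C
    by (simp add: word_count_greater invariant_colourings_inv permutes_inv)
  have "(\<lambda>n. \<Sum>k\<le>n. ?h s k * ?d s (n - k))
      sums (weak_gf (card C) L (p \<circ> inv s) * (real (card (invariant_colourings C L s)) / ?N ^ L))"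
    if s: "s \<in> ?P" for s
  proof -
    have "summable (\<lambda>k. norm (?h s k))" using summable_weak_words[OF L N] by simp
    moreover have "summable (\<lambda>k. norm (?d s k))"
      using sums_summable[OF d[OF s]] by simp
    ultimately show ?thesis
      using Cauchy_product_sums[of "?h s" "?d s"] d[OF s, THEN sums_unique] by (simp add: weak_gf_def)
  qed
  then have "(\<lambda>n. \<Sum>s\<in>?P. \<Sum>k\<le>n. ?h s k * ?d s (n - k))
      sums (\<Sum>s\<in>?P. weak_gf (card C) L (p \<circ> inv s) * (real (card (invariant_colourings C L s)) / ?N ^ L))"
    by (rule sums_sum)
  moreover have "(\<Sum>s\<in>?P. \<Sum>k\<le>n. ?h s k * ?d s (n - k)) = (if n = 0 then if p = id then 1 else 0 else 0)" for n
  proof -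
    have hd: "?h s k * ?d s (n - k) = (-1) ^ k *
        real (word_count (\<le>) L k (p \<circ> inv s) * word_count (>) L (n - k) s) / ?N ^ n" if "k \<le> n" for k s
    proof -
      have "(- ?N) ^ k * ?N ^ (n - k) = (-1) ^ k * ?N ^ n"
        using that by (simp add: power_minus[of ?N k] flip: power_add)
      then show ?thesis
        by (cases "even k") (simp_all add: divide_simps)
    qed
    have "(\<Sum>s\<in>?P. \<Sum>k\<le>n. ?h s k * ?d s (n - k)) = (\<Sum>k\<le>n. \<Sum>s\<in>?P. (-1) ^ k *
        real (word_count (\<le>) L k (p \<circ> inv s) * word_count (>) L (n - k) s) / ?N ^ n)"
      by (subst sum.swap) (intro sum.cong refl hd, simp)
    also have "\<dots> = (\<Sum>k\<le>n. (-1) ^ k * real (\<Sum>s\<in>?P.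
        word_count (\<le>) L k (p \<circ> inv s) * word_count (>) L (n - k) s)) / ?N ^ n"
      by (simp add: sum_distrib_left sum_divide_distrib)
    also have "\<dots> = (if n = 0 then if p = id then 1 else 0 else 0)"
      unfolding signed_sum_word_counts[OF p] by simp
    finally show ?thesis .
  qed
  ultimately have "(\<lambda>n. if n = 0 then if p = id then 1 else 0 else 0)
      sums (\<Sum>s\<in>?P. weak_gf (card C) L (p \<circ> inv s) * (real (card (invariant_colourings C L s)) / ?N ^ L))"
    by simp
  from sums_unique2[OF this sums_single[of 0 "\<lambda>_. if p = id then 1 else 0"]]
  have "(\<Sum>s\<in>?P. weak_gf (card C) L (p \<circ> inv s) * real (card (invariant_colourings C L s))) / ?N ^ L
      = (if p = id then 1 else 0)"
    by (simp add: sum_divide_distrib)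
  then show ?thesis using N by (simp add: field_simps split: if_splits)
qed

section \<open>Cycle types\<close>

lemma permutes_permutation: "p permutes {1..L::nat} \<Longrightarrow> permutation p"
  by (auto simp: permutation_permutes)

lemma orbit_bij_betw:
  fixes p :: "nat \<Rightarrow> nat"
  assumes "permutation p"
  shows "bij_betw (\<lambda>k. (p ^^ k) x) {..<card (orbit p x)} (orbit p x)"
    and "(p ^^ card (orbit p x)) x = x" and "0 < card (orbit p x)"
proof -
  have x: "x \<in> orbit p x" by (rule permutation_self_in_orbit[OF assms])
  have inj: "inj_on (\<lambda>k. (p ^^ k) x) {0..<funpow_dist1 p x x}"
    by (rule inj_on_funpow_dist1[OF x])
  have card: "card (orbit p x) = funpow_dist1 p x x"
    unfolding orbit_conv_funpow_dist1[OF x] card_image[OF inj] by simp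
  show "bij_betw (\<lambda>k. (p ^^ k) x) {..<card (orbit p x)} (orbit p x)"
    unfolding card using inj orbit_conv_funpow_dist1[OF x]
    by (intro bij_betw_imageI) (simp_all only: atLeast0LessThan)
  show "(p ^^ card (orbit p x)) x = x"
    unfolding card by (rule funpow_dist1_prop[OF x])
  show "0 < card (orbit p x)" unfolding card by simp
qed

lemma pairwise_disjnt_orbits:
  assumes "permutation p"
  shows "pairwise disjnt (orbit p ` S)"
proof (intro pairwiseI)
  fix X Y assume XY: "X \<in> orbit p ` S" "Y \<in> orbit p ` S" "X \<noteq> Y"
  have "orbit p z = X" "orbit p z = Y" if "z \<in> X" "z \<in> Y" for z
    using XY that orbit_cyclic_eq3[OF cyclic_on_orbit'[OF assms]] by auto
  with XY(3) show "disjnt X Y" unfolding disjnt_iff by metis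
qed

lemma Union_orbits:
  assumes p: "p permutes {1..L::nat}"
  shows "\<Union> (orbit p ` {1..L}) = {1..L}"
proof
  show "\<Union> (orbit p ` {1..L}) \<subseteq> {1..L}"
    using permutes_orbit_subset[OF p] by (intro UN_least) simp
  show "{1..L} \<subseteq> \<Union> (orbit p ` {1..L})"
    using permutation_self_in_orbit[OF permutes_permutation[OF p]] by auto
qed

lemma orbit_conjugate:
  assumes p: "p permutes {1..L::nat}" and q: "q permutes {1..L}"
  shows "orbit (q \<circ> p \<circ> inv q) (q x) = q ` orbit p x"
  by (rule orbit_inverse[symmetric])
    (simp_all add: permutation_self_in_orbit[OF permutes_permutation[OF p]] permutes_inverses[OF q])

lemma cycle_type_conjugate:
  assumes p: "p permutes {1..L}" and q: "q permutes {1..L}"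
  shows "cycle_type L (q \<circ> p \<circ> inv q) = cycle_type L p"
proof -
  have inj: "inj q" using permutes_inj[OF q] .
  have "orbit (q \<circ> p \<circ> inv q) ` {1..L} = orbit (q \<circ> p \<circ> inv q) ` q ` {1..L}"
    using permutes_image[OF q] by simp
  also have "\<dots> = image q ` orbit p ` {1..L}"
    by (auto simp: image_image orbit_conjugate[OF p q])
  finally have "cycle_type L (q \<circ> p \<circ> inv q) = image_mset card (mset_set (image q ` orbit p ` {1..L}))"
    by (simp add: cycle_type_def)
  also have "mset_set (image q ` orbit p ` {1..L}) = image_mset (image q) (mset_set (orbit p ` {1..L}))"
    by (rule image_mset_mset_set[symmetric]) (use inj in \<open>auto simp: inj_on_def inj_image_eq_iff\<close>)
  also have "image_mset card \<dots> = image_mset card (mset_set (orbit p ` {1..L}))"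
    using inj by (simp add: multiset.map_comp comp_def card_image inj_on_subset)
  finally show ?thesis by (simp only: cycle_type_def)
qed

text \<open>An arbitrary bijection \<open>h\<close> first moves both functions to the index set
  \<open>A\<close>; a permutation of \<open>A\<close> then corrects it. This serves to match the
  cycles of two permutations by length.\<close>

lemma image_mset_eq_imp_bij_betw:
  assumes "finite A" "finite B" "image_mset f (mset_set A) = image_mset g (mset_set B)"
  obtains b where "bij_betw b A B" "\<And>x. x \<in> A \<Longrightarrow> g (b x) = f x"
proof -
  have "card A = card B"
    using arg_cong[OF assms(3), of size] by simp
  then obtain h where h: "bij_betw h A B"
    using assms finite_same_card_bij by blast
  have "mset_set B = image_mset h (mset_set A)"
    using h by (simp add: image_mset_mset_set bij_betw_def)
  then have "image_mset f (mset_set A) = image_mset (g \<circ> h) (mset_set A)"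
    using assms(3) by (simp add: multiset.map_comp)
  from image_mset_eq_implies_permutes[OF assms(1) this]
  obtain p where p: "p permutes A" "\<forall>x\<in>A. f x = (g \<circ> h) (p x)" .
  show thesis
  proof (rule that[of "h \<circ> p"])
    show "bij_betw (h \<circ> p) A B"
      using bij_betw_trans[OF permutes_imp_bij[OF p(1)] h] .
    show "g ((h \<circ> p) x) = f x" if "x \<in> A" for x using p(2) that by simp
  qed
qed

text \<open>The isomorphism sends the \<open>k\<close>-th iterate of \<open>x\<close> under
  \<open>p\<close> to the \<open>k\<close>-th iterate of \<open>y\<close> under
  \<open>q\<close>.\<close>

lemma orbit_isomorphism:
  fixes p q :: "nat \<Rightarrow> nat"
  assumes p: "permutation p" and q: "permutation q" and card: "card (orbit p x) = card (orbit q y)"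
  obtains h where "bij_betw h (orbit p x) (orbit q y)" "\<And>z. z \<in> orbit p x \<Longrightarrow> h (p z) = q (h z)"
proof -
  let ?m = "card (orbit p x)"
  let ?f = "\<lambda>k. (p ^^ k) x" and ?g = "\<lambda>k. (q ^^ k) y"
  note f = orbit_bij_betw[OF p, of x] and g = orbit_bij_betw[OF q, of y, folded card]
  define h where "h = ?g \<circ> the_inv_into {..<?m} ?f"
  have hf: "h (?f k) = ?g k" if "k < ?m" for k
    unfolding h_def using the_inv_into_f_f[of ?f "{..<?m}" k] f(1) that by (simp add: bij_betw_def)
  show thesis
  proof (rule that[of h])
    show "bij_betw h (orbit p x) (orbit q y)"
      unfolding h_def by (rule bij_betw_trans[OF bij_betw_the_inv_into[OF f(1)] g(1)])
    fix z assume "z \<in> orbit p x"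
    then obtain k where k: "k < ?m" "z = ?f k"
      using f(1) by (auto simp: bij_betw_def)
    show "h (p z) = q (h z)"
    \<comment> \<open>\<open>hf\<close> covers only exponents below the cycle length, so the step
      that closes the cycle is treated apart: there both sides return to \<open>y\<close>.\<close>
    proof (cases "Suc k = ?m")
      case True
      have "p z = ?f (Suc k)" by (simp add: k)
      also have "\<dots> = ?f 0" unfolding True using f(2) by simp
      finally have "h (p z) = y" using hf[of 0] f(3) by simp
      moreover have "q (h z) = ?g (Suc k)" using hf[OF k(1)] by (simp add: k)
      moreover have "\<dots> = y" unfolding True using g(2) .
      ultimately show ?thesis by simp
    next
      case False
      then have "h (?f (Suc k)) = ?g (Suc k)" using k by (intro hf) simp
      then show ?thesis using hf[OF k(1)] by (simp add: k)
    qed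
  qed
qed

text \<open>Cycles of equal length are matched by a bijection \<open>b\<close>, and the isomorphisms
  between matched cycles are glued to \<open>c\<close>.\<close>

lemma cycle_type_eq_imp_conjugate:
  assumes p: "p permutes {1..L}" and q: "q permutes {1..L}" and eq: "cycle_type L p = cycle_type L q"
  obtains c where "c permutes {1..L}" "q = c \<circ> p \<circ> inv c"
proof -
  note pp = permutes_permutation[OF p] and pq = permutes_permutation[OF q]
  obtain b where b: "bij_betw b (orbit p ` {1..L}) (orbit q ` {1..L})"
      "\<And>X. X \<in> orbit p ` {1..L} \<Longrightarrow> card (b X) = card X"
    using eq unfolding cycle_type_def
    by (elim image_mset_eq_imp_bij_betw[rotated 2]) auto
  have "\<exists>h. bij_betw h X (b X) \<and> (\<forall>z\<in>X. h (p z) = q (h z))" if X: "X \<in> orbit p ` {1..L}" for X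
  proof -
    obtain x where x: "X = orbit p x" using X by blast
    have "b X \<in> orbit q ` {1..L}" using b(1) X by (auto simp: bij_betw_def)
    then obtain y where y: "b X = orbit q y" by blast
    show ?thesis
      using orbit_isomorphism[OF pp pq, of x y] b(2)[OF X] x y by metis
  qed
  then obtain h where h: "\<And>X. X \<in> orbit p ` {1..L} \<Longrightarrow> bij_betw (h X) X (b X)"
      "\<And>X z. X \<in> orbit p ` {1..L} \<Longrightarrow> z \<in> X \<Longrightarrow> h X (p z) = q (h X z)"
    by metis
  define c where "c z = (if z \<in> {1..L} then h (orbit p z) z else z)" for z
  have self: "z \<in> orbit p z" for z by (rule permutation_self_in_orbit[OF pp])
  have cb: "c z \<in> b (orbit p z)" if "z \<in> {1..L}" for z
    using h(1)[of "orbit p z"] that self[of z] by (auto simp: c_def bij_betw_def)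
  have q_orbit: "orbit q z = X" if "X \<in> orbit q ` {1..L}" "z \<in> X" for X z
    using that orbit_cyclic_eq3[OF cyclic_on_orbit'[OF pq]] by auto
  have b_range: "b X \<in> orbit q ` {1..L}" if "X \<in> orbit p ` {1..L}" for X
    using b(1) that by (auto simp: bij_betw_def)
  have c_in: "c z \<in> {1..L}" if z: "z \<in> {1..L}" for z
  proof -
    obtain y where "y \<in> {1..L}" "b (orbit p z) = orbit q y" using b_range[of "orbit p z"] z by blast
    then show ?thesis using cb[OF z] permutes_orbit_subset[OF q] by blast
  qed
  \<comment> \<open>\<open>c z\<close> lies in \<open>b (orbit p z)\<close>, so it determines the
    cycle of \<open>z\<close> because \<open>b\<close> is injective on cycles, and then
    \<open>z\<close> itself because \<open>h\<close> is injective on that cycle.\<close>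
  have c_inj: "inj_on c {1..L}"
  proof (rule inj_onI)
    fix z w assume zw: "z \<in> {1..L}" "w \<in> {1..L}" "c z = c w"
    have "b (orbit p z) = orbit q (c z)"
      using q_orbit[OF b_range cb] zw(1) by simp
    also have "\<dots> = b (orbit p w)"
      using q_orbit[OF b_range cb] zw(2,3) by simp
    finally have o: "orbit p z = orbit p w"
      using b(1) zw by (auto simp: bij_betw_def inj_on_def)
    have eq: "h (orbit p z) z = h (orbit p z) w" using zw o by (simp add: c_def)
    have w: "w \<in> orbit p z" using self[of w] by (simp only: o)
    show "z = w"
      by (rule inj_onD[OF bij_betw_imp_inj_on[OF h(1)[OF imageI[OF zw(1)]]] eq self w])
  qed
  have c: "c permutes {1..L}"
  proof (rule bij_imp_permutes)
    have "c ` {1..L} = {1..L}"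
      by (rule endo_inj_surj) (use c_in c_inj in auto)
    then show "bij_betw c {1..L} {1..L}" using c_inj by (simp add: bij_betw_def)
  qed (auto simp: c_def)
  have "c (p z) = q (c z)" for z
  proof (cases "z \<in> {1..L}")
    case True
    then show ?thesis
      using h(2)[of "orbit p z" z] self[of z] permutation_orbit_step[OF pp, of z] permutes_in_image[OF p, of z]
      by (simp add: c_def)
  next
    case False
    then show ?thesis
      unfolding c_def using permutes_not_in[OF p, of z] permutes_not_in[OF q, of z] by auto
  qed
  then have "q = c \<circ> p \<circ> inv c"
    by (auto simp: fun_eq_iff permutes_inverses[OF c])
  with c show thesis by (rule that)
qed

lemma cycle_type_in_partitions:
  assumes p: "p permutes {1..L}"
  shows "cycle_type L p \<in> partitions L"
proof -
  note pp = permutes_permutation[OF p]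
  have "sum_mset (cycle_type L p) = (\<Sum>X\<in>orbit p ` {1..L}. card X)"
    by (simp add: cycle_type_def sum_unfold_sum_mset)
  also have "\<dots> = card (\<Union> (orbit p ` {1..L}))"
  proof (rule card_Union_disjoint[symmetric])
    show "pairwise disjnt (orbit p ` {1..L})" by (rule pairwise_disjnt_orbits[OF pp])
    show "finite X" if "X \<in> orbit p ` {1..L}" for X
      using that finite_orbit[OF permutation_self_in_orbit[OF pp]] by auto
  qed
  also have "\<Union> (orbit p ` {1..L}) = {1..L}" by (rule Union_orbits[OF p])
  finally have sum: "sum_mset (cycle_type L p) = L" by simp
  have "card X \<noteq> 0" if "X \<in> orbit p ` {1..L}" for X
    using that orbit_bij_betw(3)[OF pp] by (metis imageE less_irrefl)
  then have "0 \<notin># cycle_type L p"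
    unfolding cycle_type_def by (metis finite_atLeastAtMost finite_imageI finite_set_mset_mset_set imageE set_image_mset)
  with sum show ?thesis by (simp add: partitions_def)
qed

lemma conj_class_partition:
  "lam \<in> partitions L \<Longrightarrow> conj_class lam = {p. p permutes {1..L} \<and> cycle_type L p = lam}"
  by (auto simp: partitions_def conj_class_def)

section \<open>Power sums as sums over colourings\<close>

lemma sum_PiE_insert:
  fixes f :: "('a \<Rightarrow> 'b::finite) \<Rightarrow> 'c::comm_monoid_add"
  assumes "finite S" "x \<notin> S"
  shows "(\<Sum>i\<in>insert x S \<rightarrow>\<^sub>E UNIV. f i) = (\<Sum>i\<in>S \<rightarrow>\<^sub>E UNIV. \<Sum>y\<in>UNIV. f (i(x := y)))"
proof -
  have "(\<Sum>i\<in>insert x S \<rightarrow>\<^sub>E UNIV. f i) = (\<Sum>(y, i)\<in>UNIV \<times> (S \<rightarrow>\<^sub>E UNIV). f (i(x := y)))"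
    unfolding PiE_insert_eq
    by (subst sum.reindex[OF inj_combinator[OF assms(2)]]) (auto simp: comp_def split_beta intro!: sum.cong)
  then show ?thesis
    by (simp add: sum.cartesian_product[symmetric] sum.swap[of _ UNIV])
qed

lemma funpow_matrix_commute:
  fixes A :: "'n::finite cmat"
  shows "((**) A ^^ Suc m) (mat 1) = ((**) A ^^ m) (mat 1) ** A"
  by (induction m) (simp_all add: matrix_mul_assoc)

text \<open>The endpoint conditions stay inside the summand, so that the induction can add the
  vertex \<open>Suc m\<close> with \<open>sum_PiE_insert\<close>.\<close>

lemma matrix_power_paths:
  fixes A :: "'n::finite cmat"
  shows "(((**) A ^^ m) (mat 1)) $ a $ b =
    (\<Sum>i\<in>{..m} \<rightarrow>\<^sub>E UNIV. if i 0 = a \<and> i m = b then \<Prod>k<m. A $ i k $ i (Suc k) else 0)"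
proof (induction m arbitrary: b)
  case 0
  have "{..0::nat} = insert 0 {}" by auto
  then show ?case
    by (simp only:, subst sum_PiE_insert)
      (cases "a = b", auto simp: mat_def if_distrib conj_commute cong: if_cong intro!: sum.neutral)
next
  case (Suc m)
  have "(((**) A ^^ Suc m) (mat 1)) $ a $ b = (\<Sum>c\<in>UNIV. (((**) A ^^ m) (mat 1)) $ a $ c * A $ c $ b)"
    unfolding funpow_matrix_commute by (simp add: matrix_matrix_mult_def)
  also have "\<dots> = (\<Sum>c\<in>UNIV. \<Sum>i\<in>{..m} \<rightarrow>\<^sub>E UNIV.
      if i m = c then if i 0 = a then (\<Prod>k<m. A $ i k $ i (Suc k)) * A $ c $ b else 0 else 0)"
    unfolding Suc sum_distrib_right by (intro sum.cong) auto
  also have "\<dots> = (\<Sum>i\<in>{..m} \<rightarrow>\<^sub>E UNIV. if i 0 = a then (\<Prod>k<m. A $ i k $ i (Suc k)) * A $ i m $ b else 0)"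
    by (subst sum.swap) simp
  also have "\<dots> = (\<Sum>i\<in>{..m} \<rightarrow>\<^sub>E UNIV. \<Sum>y\<in>UNIV. if y = b then if i 0 = a then
      (\<Prod>k<m. A $ i k $ i (Suc k)) * A $ i m $ y else 0 else 0)"
    by simp
  also have "\<dots> = (\<Sum>i\<in>insert (Suc m) {..m} \<rightarrow>\<^sub>E UNIV. if i 0 = a \<and> i (Suc m) = b then
      \<Prod>k<Suc m. A $ i k $ i (Suc k) else 0)"
    by (subst sum_PiE_insert) (auto intro!: sum.cong prod.cong)
  also have "insert (Suc m) {..m} = {..Suc m}" by auto
  finally show ?case .
qed

text \<open>The trace closes the walks: the vertex \<open>m\<close> is summed out against
  \<open>i 0 = i m\<close>. For \<open>m = 0\<close> the left side is the dimension while the right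
  side is 1.\<close>

lemma tr_pow_cyclic:
  fixes A :: "'n::finite cmat"
  assumes "0 < m"
  shows "tr_pow m A = (\<Sum>i\<in>{..<m} \<rightarrow>\<^sub>E UNIV. \<Prod>k<m. A $ i k $ i (Suc k mod m))"
proof -
  have "tr_pow m A = (\<Sum>a\<in>UNIV. \<Sum>i\<in>{..m} \<rightarrow>\<^sub>E UNIV.
      if i 0 = a \<and> i m = a then \<Prod>k<m. A $ i k $ i (Suc k) else 0)"
    by (simp add: tr_pow_def trace_def matrix_power_paths)
  also have "\<dots> = (\<Sum>i\<in>{..m} \<rightarrow>\<^sub>E UNIV. \<Sum>a\<in>UNIV. if i m = a then if i 0 = i m then
      \<Prod>k<m. A $ i k $ i (Suc k) else 0 else 0)"
    by (subst sum.swap) (intro sum.cong, auto)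
  also have "\<dots> = (\<Sum>i\<in>{..m} \<rightarrow>\<^sub>E UNIV. if i 0 = i m then \<Prod>k<m. A $ i k $ i (Suc k) else 0)"
    by simp
  also have "{..m} = insert m {..<m}" by auto
  also have "(\<Sum>i\<in>insert m {..<m} \<rightarrow>\<^sub>E UNIV. if i 0 = i m then \<Prod>k<m. A $ i k $ i (Suc k) else 0)
      = (\<Sum>i\<in>{..<m} \<rightarrow>\<^sub>E UNIV. \<Sum>y\<in>UNIV. if i 0 = y then
          \<Prod>k<m. A $ i k $ (if Suc k = m then y else i (Suc k)) else 0)"
    using assms by (subst sum_PiE_insert) (auto intro!: sum.cong prod.cong)
  also have "\<dots> = (\<Sum>i\<in>{..<m} \<rightarrow>\<^sub>E UNIV. \<Prod>k<m. A $ i k $ (if Suc k = m then i 0 else i (Suc k)))"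
    by simp
  also have "\<dots> = (\<Sum>i\<in>{..<m} \<rightarrow>\<^sub>E UNIV. \<Prod>k<m. A $ i k $ i (Suc k mod m))"
    by (intro sum.cong prod.cong) auto
  finally show ?thesis .
qed

text \<open>Splitting the positions into \<open>p\<close>-stable pieces factors this index sum; a
  single cycle gives one trace.\<close>

definition cycle_sum :: "'n::finite cmat \<Rightarrow> (nat \<Rightarrow> nat) \<Rightarrow> nat set \<Rightarrow> complex" where
  "cycle_sum A p S = (\<Sum>i\<in>S \<rightarrow>\<^sub>E UNIV. \<Prod>j\<in>S. A $ i j $ i (p j))"

text \<open>Numbering the orbit by the iterates of \<open>x\<close> turns \<open>p\<close> into the
  cyclic shift of exponents.\<close>

lemma cycle_sum_orbit:
  assumes p: "permutation p"
  shows "cycle_sum A p (orbit p x) = tr_pow (card (orbit p x)) A"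
proof -
  let ?m = "card (orbit p x)" and ?f = "\<lambda>k. (p ^^ k) x"
  note f = orbit_bij_betw[OF p, of x]
  define g where "g = the_inv_into {..<?m} ?f"
  have gf: "g (?f k) = k" if "k < ?m" for k
    unfolding g_def using the_inv_into_f_f[of ?f "{..<?m}" k] f(1) that by (simp add: bij_betw_def)
  have fg: "?f (g z) = z" "g z < ?m" if z: "z \<in> orbit p x" for z
  proof -
    obtain k where "k < ?m" "z = ?f k"
      using z f(1) unfolding bij_betw_def by (metis (no_types, lifting) imageE lessThan_iff)
    then show "?f (g z) = z" "g z < ?m" using gf[of k] by simp_all
  qed
  have f_in: "?f k \<in> orbit p x" if "k < ?m" for k
    using f(1) that by (auto simp: bij_betw_def)
  have f_mod: "?f (Suc k mod ?m) = p (?f k)" if "k < ?m" for k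
  proof (cases "Suc k = ?m")
    case True
    then have "p (?f k) = ?f ?m" by (metis comp_apply funpow.simps(2))
    then show ?thesis using True f(2) by simp
  next
    case False
    then have "Suc k < ?m" using that by simp
    then show ?thesis by simp
  qed
  have p_in: "p z \<in> orbit p x" if "z \<in> orbit p x" for z
    using that by (rule orbit.step)
  have "tr_pow ?m A = (\<Sum>i\<in>{..<?m} \<rightarrow>\<^sub>E UNIV. \<Prod>k<?m. A $ i k $ i (Suc k mod ?m))"
    by (rule tr_pow_cyclic[OF f(3)])
  also have "\<dots> = cycle_sum A p (orbit p x)"
    unfolding cycle_sum_def
  proof (rule sum.reindex_bij_witness[of _ "\<lambda>i. restrict (i \<circ> ?f) {..<?m}"
        "\<lambda>i. restrict (i \<circ> g) (orbit p x)"])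
    fix i :: "nat \<Rightarrow> 'a" assume i: "i \<in> {..<?m} \<rightarrow>\<^sub>E UNIV"
    show "restrict (restrict (i \<circ> g) (orbit p x) \<circ> ?f) {..<?m} = i"
      using i f_in gf by (auto simp: fun_eq_iff PiE_def extensional_def restrict_def)
    have "(\<Prod>j\<in>orbit p x. A $ restrict (i \<circ> g) (orbit p x) j $ restrict (i \<circ> g) (orbit p x) (p j))
        = (\<Prod>j\<in>orbit p x. A $ i (g j) $ i (g (p j)))"
      by (intro prod.cong) (auto simp: p_in)
    also have "\<dots> = (\<Prod>k<?m. A $ i (g (?f k)) $ i (g (p (?f k))))"
      by (rule prod.reindex_bij_betw[OF f(1), symmetric])
    also have "\<dots> = (\<Prod>k<?m. A $ i k $ i (Suc k mod ?m))"
    proof (rule prod.cong[OF refl])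
      fix k assume "k \<in> {..<?m}"
      then have k: "k < ?m" by simp
      have "g (p (?f k)) = Suc k mod ?m"
        unfolding f_mod[OF k, symmetric] using f(3) by (intro gf) simp
      then show "A $ i (g (?f k)) $ i (g (p (?f k))) = A $ i k $ i (Suc k mod ?m)"
        using gf[OF k] by simp
    qed
    finally show "(\<Prod>j\<in>orbit p x. A $ restrict (i \<circ> g) (orbit p x) j $ restrict (i \<circ> g) (orbit p x) (p j))
        = (\<Prod>k<?m. A $ i k $ i (Suc k mod ?m))" .
  next
    fix i :: "nat \<Rightarrow> 'a" assume i: "i \<in> orbit p x \<rightarrow>\<^sub>E UNIV"
    show "restrict (restrict (i \<circ> ?f) {..<?m} \<circ> g) (orbit p x) = i"
      using i fg by (auto simp: fun_eq_iff PiE_def extensional_def restrict_def)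
  qed auto
  finally show ?thesis ..
qed

text \<open>For \<open>j\<close> in a \<open>p\<close>-stable set, both indices of the factor come
  from the restriction of the colouring to that set.\<close>

lemma cycle_sum_Un:
  assumes "finite S" "finite T" "S \<inter> T = {}" "p ` S \<subseteq> S" "p ` T \<subseteq> T"
  shows "cycle_sum A p (S \<union> T) = cycle_sum A p S * cycle_sum A p T"
proof -
  let ?w = "\<lambda>i S. \<Prod>j\<in>S. A $ i j $ i (p j)"
  have "cycle_sum A p S * cycle_sum A p T
      = (\<Sum>(i, i')\<in>(S \<rightarrow>\<^sub>E UNIV) \<times> (T \<rightarrow>\<^sub>E UNIV). ?w i S * ?w i' T)"
    by (simp add: cycle_sum_def sum_product sum.cartesian_product)
  also have "\<dots> = cycle_sum A p (S \<union> T)"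
    unfolding cycle_sum_def
  proof (rule sum.reindex_bij_witness[of _ "\<lambda>k. (restrict k S, restrict k T)"
        "\<lambda>(i, i') j. if j \<in> S then i j else i' j"])
    fix x :: "(nat \<Rightarrow> 'a) \<times> (nat \<Rightarrow> 'a)"
    assume x: "x \<in> (S \<rightarrow>\<^sub>E UNIV) \<times> (T \<rightarrow>\<^sub>E UNIV)"
    obtain i i' where x': "x = (i, i')" by force
    show "(restrict ((\<lambda>(i, i') j. if j \<in> S then i j else i' j) x) S,
        restrict ((\<lambda>(i, i') j. if j \<in> S then i j else i' j) x) T) = x"
      using x assms(3) by (auto simp: x' fun_eq_iff PiE_def extensional_def restrict_def)
    show "(\<lambda>(i, i') j. if j \<in> S then i j else i' j) x \<in> S \<union> T \<rightarrow>\<^sub>E UNIV"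
      using x by (auto simp: x' PiE_def extensional_def)
    let ?k = "\<lambda>j. if j \<in> S then i j else i' j"
    have "?w ?k (S \<union> T) = ?w ?k S * ?w ?k T"
      using assms by (intro prod.union_disjoint) auto
    also have "?w ?k S = ?w i S"
      using assms(4) by (intro prod.cong) auto
    also have "?w ?k T = ?w i' T"
      using assms(3,5) by (intro prod.cong) (auto simp: disjoint_iff image_subset_iff)
    finally show "?w ((\<lambda>(i, i') j. if j \<in> S then i j else i' j) x) (S \<union> T)
        = (case x of (i, i') \<Rightarrow> ?w i S * ?w i' T)"
      by (simp add: x')
  next
    fix k :: "nat \<Rightarrow> 'a" assume k: "k \<in> S \<union> T \<rightarrow>\<^sub>E UNIV"
    show "(\<lambda>(i, i') j. if j \<in> S then i j else i' j) (restrict k S, restrict k T) = k"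
      using k by (auto simp: fun_eq_iff PiE_def extensional_def restrict_def)
  qed auto
  finally show ?thesis ..
qed

lemma cycle_sum_Union:
  assumes "finite F" "\<And>X. X \<in> F \<Longrightarrow> finite X \<and> p ` X \<subseteq> X" "pairwise disjnt F"
  shows "cycle_sum A p (\<Union>F) = (\<Prod>X\<in>F. cycle_sum A p X)"
  using assms
proof (induction F)
  case empty
  then show ?case by (simp add: cycle_sum_def)
next
  case (insert X F)
  have "cycle_sum A p (X \<union> \<Union>F) = cycle_sum A p X * cycle_sum A p (\<Union>F)"
  proof (rule cycle_sum_Un)
    show "finite X" "p ` X \<subseteq> X" using insert.prems(1)[of X] by simp_all
    show "finite (\<Union>F)" using insert.hyps(1) insert.prems(1) by auto
    show "p ` \<Union>F \<subseteq> \<Union>F"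
    proof (rule image_subsetI)
      fix z assume "z \<in> \<Union>F"
      then obtain Y where Y: "Y \<in> F" "z \<in> Y" by blast
      then have "p z \<in> Y" using insert.prems(1)[of Y] by auto
      with Y show "p z \<in> \<Union>F" by blast
    qed
    have "disjnt X Y" if "Y \<in> F" for Y
      using insert.prems(2) insert.hyps(2) that unfolding pairwise_insert by metis
    then show "X \<inter> \<Union>F = {}" by (auto simp: disjnt_iff)
  qed
  then show ?case
    using insert by (simp add: pairwise_insert)
qed

lemma power_sum_cycle_type:
  assumes p: "p permutes {1..L}"
  shows "power_sum (cycle_type L p) A = (\<Sum>i\<in>{1..L} \<rightarrow>\<^sub>E UNIV. \<Prod>j\<in>{1..L}. A $ i j $ i (p j))"
proof -
  note pp = permutes_permutation[OF p]
  have "power_sum (cycle_type L p) A = (\<Prod>X\<in>orbit p ` {1..L}. tr_pow (card X) A)"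
    by (simp add: power_sum_def cycle_type_def prod_unfold_prod_mset multiset.map_comp comp_def)
  also have "\<dots> = (\<Prod>X\<in>orbit p ` {1..L}. cycle_sum A p X)"
    by (intro prod.cong) (auto simp: cycle_sum_orbit[OF pp])
  also have "\<dots> = cycle_sum A p (\<Union> (orbit p ` {1..L}))"
  proof (rule cycle_sum_Union[symmetric])
    show "pairwise disjnt (orbit p ` {1..L})" by (rule pairwise_disjnt_orbits[OF pp])
    show "finite X \<and> p ` X \<subseteq> X" if "X \<in> orbit p ` {1..L}" for X
      using that finite_orbit[OF permutation_self_in_orbit[OF pp]] by (auto intro: orbit.step)
  qed simp
  also have "\<Union> (orbit p ` {1..L}) = {1..L}" by (rule Union_orbits[OF p])
  finally show ?thesis by (simp add: cycle_sum_def)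
qed

section \<open>Moments of a unitarily invariant expectation\<close>

text \<open>These are the properties common to genuine and formal measures. Linearity is stated for
  sums of monomials because the integral is additive only on integrable functions, and monomials are
  integrable in both cases. The pair \<open>s\<close> holds the row and column indices.\<close>

locale invariant_expectation =
  fixes E :: "('n::finite cmat \<Rightarrow> complex) \<Rightarrow> complex"
  assumes E_linear: "finite S \<Longrightarrow>
      E (\<lambda>A. \<Sum>s\<in>S. c s * (\<Prod>j\<in>{1..L::nat}. A $ fst s j $ snd s j))
        = (\<Sum>s\<in>S. c s * E (\<lambda>A. \<Prod>j\<in>{1..L}. A $ fst s j $ snd s j))"
    and E_unitary: "U \<in> unitary_mats \<Longrightarrow>
      E (\<lambda>A. \<Prod>j\<in>{1..L::nat}. (U ** A ** adj U) $ i j $ k j)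
        = E (\<lambda>A. \<Prod>j\<in>{1..L}. A $ i j $ k j)"

definition entry_moment ::
  "(('n::finite cmat \<Rightarrow> complex) \<Rightarrow> complex) \<Rightarrow> nat \<Rightarrow> (nat \<Rightarrow> 'n) \<Rightarrow> (nat \<Rightarrow> 'n) \<Rightarrow> complex" where
  "entry_moment E L i k = E (\<lambda>A. \<Prod>j\<in>{1..L}. A $ i j $ k j)"

lemma entry_moment_cong:
  assumes "\<And>j. j \<in> {1..L} \<Longrightarrow> i j = i' j" "\<And>j. j \<in> {1..L} \<Longrightarrow> k j = k' j"
  shows "entry_moment E L i k = entry_moment E L i' k'"
  unfolding entry_moment_def using assms by simp

lemma unitary_matsD:
  assumes "U \<in> unitary_mats"
  shows "(\<Sum>x\<in>UNIV. cnj (U $ x $ b) * U $ x $ c) = (if b = c then 1 else 0)"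
proof -
  have "(adj U ** U) $ b $ c = mat 1 $ b $ c"
    using assms by (simp add: unitary_mats_def)
  then show ?thesis by (simp add: matrix_matrix_mult_def adj_def mat_def)
qed

lemma prod_conjugated_entries:
  fixes A U :: "'n::finite cmat"
  shows "(\<Prod>j\<in>{1..L::nat}. (U ** A ** adj U) $ i j $ k j) =
    (\<Sum>s\<in>({1..L} \<rightarrow>\<^sub>E UNIV) \<times> ({1..L} \<rightarrow>\<^sub>E UNIV).
      ((\<Prod>j\<in>{1..L}. U $ i j $ fst s j) * (\<Prod>j\<in>{1..L}. cnj (U $ k j $ snd s j)))
        * (\<Prod>j\<in>{1..L}. A $ fst s j $ snd s j))"
proof -
  have entry: "(U ** A ** adj U) $ x $ y
      = (\<Sum>b\<in>UNIV. (\<Sum>a\<in>UNIV. U $ x $ a * A $ a $ b) * cnj (U $ y $ b))" for x y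
    by (simp add: matrix_matrix_mult_def adj_def)
  have "(\<Prod>j\<in>{1..L}. (U ** A ** adj U) $ i j $ k j)
      = (\<Sum>b\<in>{1..L} \<rightarrow>\<^sub>E UNIV. \<Prod>j\<in>{1..L}. (\<Sum>a\<in>UNIV. U $ i j $ a * A $ a $ b j) * cnj (U $ k j $ b j))"
    unfolding entry by (subst prod_sum_PiE) simp_all
  also have "\<dots> = (\<Sum>b\<in>{1..L} \<rightarrow>\<^sub>E UNIV. \<Sum>a\<in>{1..L} \<rightarrow>\<^sub>E UNIV.
      (\<Prod>j\<in>{1..L}. U $ i j $ a j * A $ a j $ b j) * (\<Prod>j\<in>{1..L}. cnj (U $ k j $ b j)))"
    unfolding prod.distrib[of _ _ "{1..L}"] sum_distrib_right[symmetric]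
    by (subst prod_sum_PiE) (simp_all add: prod.distrib)
  also have "\<dots> = (\<Sum>a\<in>{1..L} \<rightarrow>\<^sub>E UNIV. \<Sum>b\<in>{1..L} \<rightarrow>\<^sub>E UNIV.
      (\<Prod>j\<in>{1..L}. U $ i j $ a j) * (\<Prod>j\<in>{1..L}. cnj (U $ k j $ b j)) * (\<Prod>j\<in>{1..L}. A $ a j $ b j))"
    by (subst sum.swap) (simp add: prod.distrib mult_ac)
  finally show ?thesis
    by (simp add: sum.cartesian_product split_beta)
qed

context invariant_expectation
begin

abbreviation "T \<equiv> entry_moment E"

lemma entry_moment_unitary:
  assumes U: "U \<in> unitary_mats"
  shows "T L i k = (\<Sum>a\<in>{1..L} \<rightarrow>\<^sub>E UNIV. \<Sum>b\<in>{1..L} \<rightarrow>\<^sub>E UNIV.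
      (\<Prod>j\<in>{1..L}. U $ i j $ a j) * (\<Prod>j\<in>{1..L}. cnj (U $ k j $ b j)) * T L a b)"
proof -
  have "T L i k = E (\<lambda>A. \<Prod>j\<in>{1..L}. (U ** A ** adj U) $ i j $ k j)"
    by (simp only: entry_moment_def E_unitary[OF U])
  also have "\<dots> = (\<Sum>s\<in>({1..L} \<rightarrow>\<^sub>E UNIV) \<times> ({1..L} \<rightarrow>\<^sub>E UNIV).
      ((\<Prod>j\<in>{1..L}. U $ i j $ fst s j) * (\<Prod>j\<in>{1..L}. cnj (U $ k j $ snd s j))) * T L (fst s) (snd s))"
    unfolding prod_conjugated_entries by (subst E_linear) (simp_all add: entry_moment_def finite_PiE)
  finally show ?thesis
    by (simp add: sum.cartesian_product split_beta)
qed

text \<open>As an operator on the \<open>L\<close>-fold tensor power, the tensor of moments commutes with \<open>U\<close>.\<close>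

lemma entry_moment_commute:
  assumes U: "U \<in> unitary_mats" and c: "c \<in> {1..L} \<rightarrow>\<^sub>E UNIV"
  shows "(\<Sum>k\<in>{1..L} \<rightarrow>\<^sub>E UNIV. T L i k * (\<Prod>j\<in>{1..L}. U $ k j $ c j))
    = (\<Sum>a\<in>{1..L} \<rightarrow>\<^sub>E UNIV. (\<Prod>j\<in>{1..L}. U $ i j $ a j) * T L a c)"
proof -
  let ?P = "{1..L} \<rightarrow>\<^sub>E (UNIV :: 'n set)"
  have fin: "finite ?P" by (simp add: finite_PiE)
  have delta: "(\<Sum>k\<in>?P. (\<Prod>j\<in>{1..L}. cnj (U $ k j $ b j)) * (\<Prod>j\<in>{1..L}. U $ k j $ c j))
      = (if b = c then 1 else 0)" if b: "b \<in> ?P" for b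
  proof -
    have "(\<Sum>k\<in>?P. (\<Prod>j\<in>{1..L}. cnj (U $ k j $ b j)) * (\<Prod>j\<in>{1..L}. U $ k j $ c j))
        = (\<Prod>j\<in>{1..L}. \<Sum>x\<in>UNIV. cnj (U $ x $ b j) * U $ x $ c j)"
      by (subst prod_sum_PiE) (simp_all add: prod.distrib)
    also have "\<dots> = (\<Prod>j\<in>{1..L}. if b j = c j then 1 else 0)"
      by (simp add: unitary_matsD[OF U])
    also have "\<dots> = (if b = c then 1 else 0)"
    proof (cases "b = c")
      case False
      then obtain j where "j \<in> {1..L}" "b j \<noteq> c j" using PiE_ext[OF b c] by blast
      then show ?thesis using False by (auto intro!: prod_zero)
    qed simp
    finally show ?thesis .
  qed
  have "(\<Sum>k\<in>?P. T L i k * (\<Prod>j\<in>{1..L}. U $ k j $ c j))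
      = (\<Sum>k\<in>?P. \<Sum>a\<in>?P. \<Sum>b\<in>?P. (\<Prod>j\<in>{1..L}. U $ i j $ a j) * T L a b
          * ((\<Prod>j\<in>{1..L}. cnj (U $ k j $ b j)) * (\<Prod>j\<in>{1..L}. U $ k j $ c j)))"
    by (subst entry_moment_unitary[OF U, of L i]) (simp add: sum_distrib_left sum_distrib_right mult_ac)
  also have "\<dots> = (\<Sum>a\<in>?P. \<Sum>b\<in>?P. (\<Prod>j\<in>{1..L}. U $ i j $ a j) * T L a b
      * (\<Sum>k\<in>?P. (\<Prod>j\<in>{1..L}. cnj (U $ k j $ b j)) * (\<Prod>j\<in>{1..L}. U $ k j $ c j)))"
    by (subst sum.swap, subst sum.swap[of _ ?P ?P], simp add: sum_distrib_left)
  also have "\<dots> = (\<Sum>a\<in>?P. \<Sum>b\<in>?P. if b = c then (\<Prod>j\<in>{1..L}. U $ i j $ a j) * T L a b else 0)"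
    by (intro sum.cong refl, simp only: delta, simp)
  also have "\<dots> = (\<Sum>a\<in>?P. (\<Prod>j\<in>{1..L}. U $ i j $ a j) * T L a c)"
    using fin c by simp
  finally show ?thesis .
qed

end

text \<open>The kernel of the linear combination, with coefficients \<open>P\<close>, of the
  permutation operators on the \<open>L\<close>-fold tensor power.\<close>

definition permuted_sum ::
  "((nat \<Rightarrow> nat) \<Rightarrow> complex) \<Rightarrow> nat \<Rightarrow> (nat \<Rightarrow> 'n) \<Rightarrow> (nat \<Rightarrow> 'n) \<Rightarrow> complex" where
  "permuted_sum P L i k = (\<Sum>p | p permutes {1..L}. if \<forall>j\<in>{1..L}. k j = i (p j) then P p else 0)"

text \<open>Permuting tensor factors commutes with applying \<open>U\<close> to each of them, the
  elementary direction of Schur-Weyl duality; in coordinates, the product is reindexed by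
  \<open>p\<close>.\<close>

lemma permuted_sum_commute:
  fixes U :: "'n::finite cmat"
  assumes c: "c \<in> {1..L} \<rightarrow>\<^sub>E UNIV"
  shows "(\<Sum>k\<in>{1..L} \<rightarrow>\<^sub>E UNIV. permuted_sum P L i k * (\<Prod>j\<in>{1..L}. U $ k j $ c j))
    = (\<Sum>a\<in>{1..L} \<rightarrow>\<^sub>E UNIV. (\<Prod>j\<in>{1..L}. U $ i j $ a j) * permuted_sum P L a c)"
proof -
  let ?P = "{1..L} \<rightarrow>\<^sub>E (UNIV :: 'n set)"
  let ?S = "{p. p permutes {1..L}}"
  have fin: "finite ?P" by (simp add: finite_PiE)
  have "(\<Sum>k\<in>?P. permuted_sum P L i k * (\<Prod>j\<in>{1..L}. U $ k j $ c j))
      = (\<Sum>p\<in>?S. \<Sum>k\<in>?P. if k = restrict (i \<circ> p) {1..L} then P p * (\<Prod>j\<in>{1..L}. U $ k j $ c j) else 0)"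
    unfolding permuted_sum_def sum_distrib_right
    by (subst sum.swap, intro sum.cong refl)
      (auto simp: fun_eq_iff PiE_def extensional_def restrict_def)
  also have "\<dots> = (\<Sum>p\<in>?S. P p * (\<Prod>j\<in>{1..L}. U $ i (p j) $ c j))"
    using fin by (intro sum.cong refl) (simp del: restrict_apply, simp)
  also have "\<dots> = (\<Sum>p\<in>?S. P p * (\<Prod>j\<in>{1..L}. U $ i j $ c (inv p j)))"
  proof (intro sum.cong refl arg_cong2[where f = "(*)"])
    fix p assume "p \<in> ?S"
    then have p: "p permutes {1..L}" by simp
    have "(\<Prod>j\<in>{1..L}. U $ i (p j) $ c (inv p (p j))) = (\<Prod>j\<in>{1..L}. U $ i j $ c (inv p j))"
      by (rule prod.reindex_bij_betw[OF permutes_imp_bij[OF p]])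
    then show "(\<Prod>j\<in>{1..L}. U $ i (p j) $ c j) = (\<Prod>j\<in>{1..L}. U $ i j $ c (inv p j))"
      by (simp add: permutes_inverses[OF p])
  qed
  also have "\<dots> = (\<Sum>p\<in>?S. \<Sum>a\<in>?P.
      if a = restrict (c \<circ> inv p) {1..L} then P p * (\<Prod>j\<in>{1..L}. U $ i j $ a j) else 0)"
    using fin by (intro sum.cong refl) (simp del: restrict_apply, simp)
  also have "\<dots> = (\<Sum>p\<in>?S. \<Sum>a\<in>?P. if \<forall>j\<in>{1..L}. c j = a (p j) then P p * (\<Prod>j\<in>{1..L}. U $ i j $ a j) else 0)"
  proof (intro sum.cong refl)
    fix p a assume "p \<in> ?S" and a: "a \<in> ?P"
    then have p: "p permutes {1..L}" by simp
    have "a = restrict (c \<circ> inv p) {1..L} \<longleftrightarrow> (\<forall>j\<in>{1..L}. c j = a (p j))"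
    proof
      assume "a = restrict (c \<circ> inv p) {1..L}"
      then show "\<forall>j\<in>{1..L}. c j = a (p j)"
        using permutes_in_image[OF p] by (simp add: permutes_inverses[OF p])
    next
      assume *: "\<forall>j\<in>{1..L}. c j = a (p j)"
      show "a = restrict (c \<circ> inv p) {1..L}"
      proof
        fix j
        show "a j = restrict (c \<circ> inv p) {1..L} j"
        proof (cases "j \<in> {1..L}")
          case True
          then have "inv p j \<in> {1..L}" using permutes_in_image[OF permutes_inv[OF p]] by blast
          with * have "c (inv p j) = a (p (inv p j))" by blast
          with True show ?thesis by (simp add: permutes_inverses[OF p])
        next
          case False
          with a show ?thesis by (auto simp: PiE_def extensional_def)
        qed
      qed
    qed
    then show "(if a = restrict (c \<circ> inv p) {1..L} then P p * (\<Prod>j\<in>{1..L}. U $ i j $ a j) else 0)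
        = (if \<forall>j\<in>{1..L}. c j = a (p j) then P p * (\<Prod>j\<in>{1..L}. U $ i j $ a j) else 0)"
      by simp
  qed
  also have "\<dots> = (\<Sum>a\<in>?P. (\<Prod>j\<in>{1..L}. U $ i j $ a j) * permuted_sum P L a c)"
    unfolding permuted_sum_def sum_distrib_left
    by (subst sum.swap, intro sum.cong refl) simp
  finally show ?thesis .
qed

text \<open>A permutation \<open>p\<close> with \<open>k = i \<circ> p\<close> maps the fibre of
  \<open>k\<close> over \<open>b\<close> onto that of \<open>i\<close>.\<close>

lemma permuted_sum_eq_0:
  assumes "card {j\<in>{1..L}. i j = b} \<noteq> card {j\<in>{1..L}. k j = b}"
  shows "permuted_sum P L i k = 0"
  unfolding permuted_sum_def
proof (rule sum.neutral, rule ballI)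
  fix p assume "p \<in> {p. p permutes {1..L}}"
  then have p: "p permutes {1..L}" by simp
  have "\<not> (\<forall>j\<in>{1..L}. k j = i (p j))"
  proof
    assume *: "\<forall>j\<in>{1..L}. k j = i (p j)"
    have "p ` {j\<in>{1..L}. k j = b} = {j\<in>{1..L}. i j = b}"
    proof (intro equalityI subsetI)
      fix j assume j: "j \<in> {j\<in>{1..L}. i j = b}"
      have "inv p j \<in> {1..L}" using j permutes_in_image[OF permutes_inv[OF p]] by blast
      moreover have "i (p (inv p j)) = b" using j by (simp add: permutes_inverses[OF p])
      ultimately have "inv p j \<in> {j\<in>{1..L}. k j = b}" using * by simp
      then show "j \<in> p ` {j\<in>{1..L}. k j = b}"
        by (rule rev_image_eqI) (simp add: permutes_inverses[OF p])
    qed (use * permutes_in_image[OF p] in auto)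
    then have "card {j\<in>{1..L}. i j = b} = card {j\<in>{1..L}. k j = b}"
      using card_image[OF inj_on_subset[OF permutes_inj_on[OF p, of UNIV]], of "{j\<in>{1..L}. k j = b}"] by simp
    with assms show False by simp
  qed
  then show "(if \<forall>j\<in>{1..L}. k j = i (p j) then P p else 0) = 0" by (rule if_not_P)
qed

lemma permuted_sum_inj:
  assumes i: "inj_on i {1..L}" and p: "p permutes {1..L}" and k: "\<And>j. j \<in> {1..L} \<Longrightarrow> k j = i (p j)"
  shows "permuted_sum P L i k = P p"
proof -
  have "(\<forall>j\<in>{1..L}. k j = i (q j)) \<longleftrightarrow> q = p" if q: "q permutes {1..L}" for q
  proof
    assume *: "\<forall>j\<in>{1..L}. k j = i (q j)"
    show "q = p"
    proof
      fix j show "q j = p j"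
      proof (cases "j \<in> {1..L}")
        case True
        then have "i (q j) = i (p j)" using * k by metis
        then show ?thesis
          using inj_onD[OF i] True permutes_in_image[OF p] permutes_in_image[OF q] by blast
      qed (simp add: permutes_not_in[OF p] permutes_not_in[OF q])
    qed
  qed (simp add: k)
  then have "permuted_sum P L i k = (\<Sum>q | q permutes {1..L}. if q = p then P q else 0)"
    unfolding permuted_sum_def by (intro sum.cong) auto
  then show ?thesis using p by (simp add: finite_permutations)
qed

section \<open>Some unitary matrices\<close>

text \<open>Commutation with this matrix detects how often the index \<open>b\<close> occurs,
  through the power of \<open>w\<close>.\<close>

definition phase_mat :: "'n \<Rightarrow> complex \<Rightarrow> 'n::finite cmat" where
  "phase_mat b w = (\<chi> x y. if x = y then if x = b then w else 1 else 0)"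

lemma phase_mat_unitary:
  assumes "w * cnj w = 1"
  shows "phase_mat b w \<in> unitary_mats"
proof -
  have "cnj w * w = 1" using assms by (simp add: mult.commute)
  with assms show ?thesis
    unfolding unitary_mats_def phase_mat_def adj_def matrix_matrix_mult_def mat_def
    by (auto simp: vec_eq_iff if_distrib[of cnj] if_distribR if_distrib[of "\<lambda>x. x * _"] if_distrib[of "\<lambda>x. _ * x"] cong: if_cong)
qed

definition perm_mat :: "('n \<Rightarrow> 'n) \<Rightarrow> 'n::finite cmat" where
  "perm_mat g = (\<chi> x y. if y = g x then 1 else 0)"

lemma perm_mat_unitary:
  fixes g :: "'n::finite \<Rightarrow> 'n"
  assumes g: "bij g"
  shows "perm_mat g \<in> unitary_mats"
proof -
  have "(\<Sum>x\<in>UNIV. if a = g x \<and> b = g x then 1 else 0 :: complex) = (if a = b then 1 else 0)" for a b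
  proof -
    have "(if a = g x \<and> b = g x then 1 else 0 :: complex) =
        (if x = inv g a then if a = b then 1 else 0 else 0)" for x
      using bij_is_inj[OF g] bij_is_surj[OF g] by (auto simp: surj_f_inv_f)
    then show ?thesis by simp
  qed
  moreover have "g x = g y \<longleftrightarrow> x = y" for x y using bij_is_inj[OF g] by (auto dest: injD)
  ultimately show ?thesis
    unfolding unitary_mats_def perm_mat_def adj_def matrix_matrix_mult_def mat_def
    by (auto simp: vec_eq_iff if_distrib[of cnj] if_distrib[of "\<lambda>x. x * _"] if_distrib[of "\<lambda>x. _ * x"] if_conn cong: if_cong)
qed

lemma perm_mat_conj: "(perm_mat g ** A ** adj (perm_mat g)) $ x $ y = A $ g x $ g y"
  unfolding perm_mat_def adj_def matrix_matrix_mult_def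
  by (simp add: if_distrib[of cnj] if_distrib[of "\<lambda>x. x * _"] if_distrib[of "\<lambda>x. _ * x"] cong: if_cong)

text \<open>An orthogonal reflection mixing the coordinates \<open>a\<close> and \<open>b\<close>.
  Beyond unitarity, what matters is that its entries at \<open>(a, a)\<close> and
  \<open>(b, a)\<close> are non-zero and that it fixes the other coordinates.\<close>

definition hadamard_mat :: "'n \<Rightarrow> 'n \<Rightarrow> 'n::finite cmat" where
  "hadamard_mat a b = (\<chi> x y. if x \<in> {a, b} \<and> y \<in> {a, b}
     then (if x = b \<and> y = b then -1 else 1) / complex_of_real (sqrt 2) else if x = y then 1 else 0)"

lemma hadamard_mat_unitary:
  assumes "a \<noteq> b"
  shows "hadamard_mat a b \<in> unitary_mats"
proof -
  let ?H = "hadamard_mat a b"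
  have adj: "adj ?H = ?H"
    by (auto simp: adj_def hadamard_mat_def vec_eq_iff)
  have two: "complex_of_real (sqrt 2) * complex_of_real (sqrt 2) = 2"
    by (simp flip: of_real_mult)
  have "(\<Sum>z\<in>UNIV. ?H $ x $ z * ?H $ z $ y) = (if x = y then 1 else 0)" for x y
  proof (cases "x \<in> {a, b}")
    case True
    have "(\<Sum>z\<in>UNIV. ?H $ x $ z * ?H $ z $ y) = (\<Sum>z\<in>{a, b}. ?H $ x $ z * ?H $ z $ y)"
      by (rule sum.mono_neutral_right) (use True in \<open>auto simp: hadamard_mat_def\<close>)
    also have "\<dots> = (if x = y then 1 else 0)"
      using assms True two by (auto simp: hadamard_mat_def)
    finally show ?thesis .
  next
    case False
    have "(\<Sum>z\<in>UNIV. ?H $ x $ z * ?H $ z $ y) = (\<Sum>z\<in>{x}. ?H $ x $ z * ?H $ z $ y)"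
      by (rule sum.mono_neutral_right) (use False in \<open>auto simp: hadamard_mat_def\<close>)
    also have "\<dots> = (if x = y then 1 else 0)"
      using False by (auto simp: hadamard_mat_def)
    finally show ?thesis .
  qed
  then have "?H ** ?H = mat 1"
    by (simp add: matrix_matrix_mult_def mat_def vec_eq_iff)
  with adj show ?thesis by (simp add: unitary_mats_def)
qed

section \<open>Moments in terms of permutation monomials\<close>

lemma card_fibres_neq:
  assumes "finite S" "b \<notin> i ` S" "b \<in> c ` S"
  shows "card {j\<in>S. i j = b} \<noteq> card {j\<in>S. c j = b}"
proof -
  have "{j\<in>S. i j = b} = {}" using assms(2) by blast
  moreover have "{j\<in>S. c j = b} \<noteq> {}" using assms(3) by blast
  then have "card {j\<in>S. c j = b} > 0" using assms(1) by (simp only: card_gt_0_iff) simp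
  ultimately show ?thesis by (metis card.empty less_irrefl)
qed

text \<open>Every fibre of \<open>i\<close> has at most one element, hence so has every fibre of
  \<open>c\<close>, over the same values; \<open>p\<close> is \<open>c\<close> followed by the
  inverse of \<open>i\<close>.\<close>

lemma permutation_of_equal_counts:
  fixes i c :: "nat \<Rightarrow> 'n"
  assumes i: "inj_on i {1..L}"
    and counts: "\<And>b. card {j\<in>{1..L}. i j = b} = card {j\<in>{1..L}. c j = b}"
  obtains p where "p permutes {1..L}" "\<And>j. j \<in> {1..L} \<Longrightarrow> c j = i (p j)"
proof -
  have ex: "\<exists>j'\<in>{1..L}. c j = i j'" if j: "j \<in> {1..L}" for j
  proof (rule ccontr)
    assume "\<not> (\<exists>j'\<in>{1..L}. c j = i j')"
    then have "{j'\<in>{1..L}. i j' = c j} = {}" by force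
    then have "card {j'\<in>{1..L}. c j' = c j} = 0" using counts[of "c j"] by (metis card.empty)
    moreover have "finite {j'\<in>{1..L}. c j' = c j}" by simp
    ultimately have "{j'\<in>{1..L}. c j' = c j} = {}" by (simp only: card_0_eq)
    with j show False by blast
  qed
  have c_inj: "inj_on c {1..L}"
  proof (rule inj_onI)
    fix x y assume xy: "x \<in> {1..L}" "y \<in> {1..L}" "c x = c y"
    have fin: "finite {j\<in>{1..L}. i j = c x}" "finite {j\<in>{1..L}. c j = c x}" by simp_all
    have "\<forall>u\<in>{j\<in>{1..L}. i j = c x}. \<forall>v\<in>{j\<in>{1..L}. i j = c x}. u = v"
    proof (intro ballI)
      fix u v assume "u \<in> {j\<in>{1..L}. i j = c x}" "v \<in> {j\<in>{1..L}. i j = c x}"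
      then show "u = v" using inj_onD[OF i, of u v] by simp
    qed
    then have "card {j\<in>{1..L}. c j = c x} \<le> Suc 0"
      unfolding counts[of "c x", symmetric] by (simp only: card_le_Suc0_iff_eq[OF fin(1)])
    then have "\<forall>u\<in>{j\<in>{1..L}. c j = c x}. \<forall>v\<in>{j\<in>{1..L}. c j = c x}. u = v"
      by (simp only: card_le_Suc0_iff_eq[OF fin(2)])
    then show "x = y" using xy by simp
  qed
  define p where "p j = (if j \<in> {1..L} then the_inv_into {1..L} i (c j) else j)" for j
  have ip: "i (p j) = c j" "p j \<in> {1..L}" if j: "j \<in> {1..L}" for j
  proof -
    have "c j \<in> i ` {1..L}" using ex[OF j] by blast
    then show "i (p j) = c j" "p j \<in> {1..L}"
      using j f_the_inv_into_f[OF i] the_inv_into_into[OF i, of "c j" "{1..L}"]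
          by (simp_all only: p_def if_True order.refl)
  qed
  have "inj_on p {1..L}"
    by (rule inj_onI) (metis ip(1) c_inj inj_onD)
  moreover have "p ` {1..L} \<subseteq> {1..L}" using ip(2) by blast
  ultimately have "bij_betw p {1..L} {1..L}"
    by (simp add: bij_betw_def endo_inj_surj)
  then have "p permutes {1..L}" by (rule bij_imp_permutes) (simp only: p_def if_False)
  then show thesis by (rule that) (simp add: ip)
qed

text \<open>The partial bijection from \<open>e j\<close> to \<open>i j\<close> extends because the
  complements of the two images have equal size in a finite type.\<close>

lemma bij_extending:
  fixes i e :: "nat \<Rightarrow> 'n::finite"
  assumes i: "inj_on i S" and e: "inj_on e S"
  obtains g where "bij g" "\<And>j. j \<in> S \<Longrightarrow> g (e j) = i j"
proof -
  have bij: "bij_betw (i \<circ> the_inv_into S e) (e ` S) (i ` S)"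
    using i e by (intro bij_betw_trans[OF bij_betw_the_inv_into]) (auto simp: bij_betw_def)
  have "card (- (e ` S)) = card (- (i ` S))"
    using bij_betw_same_card[OF bij] by (simp add: Compl_eq_Diff_UNIV card_Diff_subset)
  then obtain h where h: "bij_betw h (- (e ` S)) (- (i ` S))"
    using finite_same_card_bij[of "- (e ` S)" "- (i ` S)"] by auto
  let ?g = "\<lambda>x. if x \<in> e ` S then (i \<circ> the_inv_into S e) x else h x"
  have "bij_betw ?g (e ` S) (i ` S)"
    using bij by (rule bij_betw_cong[THEN iffD2, rotated]) simp
  moreover have "bij_betw ?g (- (e ` S)) (- (i ` S))"
    using h by (rule bij_betw_cong[THEN iffD2, rotated]) simp
  ultimately have "bij_betw ?g (e ` S \<union> - (e ` S)) (i ` S \<union> - (i ` S))"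
    by (rule bij_betw_combine) simp
  then have "bij ?g" by simp
  moreover have "?g (e j) = i j" if "j \<in> S" for j
    using that e by (simp add: the_inv_into_f_f)
  ultimately show thesis by (rule that)
qed

context invariant_expectation
begin

text \<open>Commutation with a phase at \<open>b\<close> multiplies the moment by
  \<open>w ^ m\<close> on one side and by \<open>w ^ n\<close> on the other, where \<open>m\<close>
  and \<open>n\<close> are the two counts; it vanishes once these powers differ.\<close>

lemma entry_moment_eq_0:
  assumes ne: "card {j\<in>{1..L}. i j = b} \<noteq> card {j\<in>{1..L}. k j = b}"
  shows "T L i k = 0"
proof -
  let ?P = "{1..L} \<rightarrow>\<^sub>E (UNIV :: 'n set)"
  define i' where "i' = restrict i {1..L}"
  define k' where "k' = restrict k {1..L}"
  have P: "i' \<in> ?P" "k' \<in> ?P" by (auto simp: i'_def k'_def)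
  have fin: "finite ?P" by (simp add: finite_PiE)
  \<comment> \<open>The angles of \<open>w ^ m\<close> for \<open>m \<le> L\<close> are
    \<open>m / (L + 1)\<close>. They lie in \<open>[0, 1]\<close>, hence in \<open>[0, pi]\<close>,
    where the cosine is injective, so these powers are distinct.\<close>
  define w where "w = cis (1 / real (Suc L))"
  have "w * cnj w = 1" by (simp add: w_def cis_cnj cis_mult)
  then have U: "phase_mat b w \<in> unitary_mats" by (rule phase_mat_unitary)
  have prod: "(\<Prod>j\<in>{1..L}. phase_mat b w $ x j $ y j) = (if x = y then w ^ card {j\<in>{1..L}. x j = b} else 0)"
    if xy: "x \<in> ?P" "y \<in> ?P" for x y
  proof (cases "x = y")
    case True
    then show ?thesis by (simp add: phase_mat_def prod.If_cases Int_def)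
  next
    case False
    then obtain j where "j \<in> {1..L}" "x j \<noteq> y j" using PiE_ext[OF xy] by blast
    then show ?thesis using False by (auto simp: phase_mat_def intro!: prod_zero)
  qed
  have "(\<Sum>x\<in>?P. T L i' x * (\<Prod>j\<in>{1..L}. phase_mat b w $ x j $ k' j))
      = (\<Sum>x\<in>?P. (if x = k' then T L i' x * w ^ card {j\<in>{1..L}. x j = b} else 0))"
    by (intro sum.cong refl) (simp only: prod P, simp)
  moreover have "(\<Sum>x\<in>?P. (\<Prod>j\<in>{1..L}. phase_mat b w $ i' j $ x j) * T L x k')
      = (\<Sum>x\<in>?P. (if x = i' then w ^ card {j\<in>{1..L}. x j = b} * T L x k' else 0))"
    by (intro sum.cong refl) (simp only: prod P, auto)
  ultimately have eq: "T L i' k' * w ^ card {j\<in>{1..L}. k' j = b} = w ^ card {j\<in>{1..L}. i' j = b} * T L i' k'"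
    using entry_moment_commute[OF U P(2), of i'] fin P by simp
  define m n where "m = card {j\<in>{1..L}. i' j = b}" and "n = card {j\<in>{1..L}. k' j = b}"
  have card_eq: "{j\<in>{1..L}. i' j = b} = {j\<in>{1..L}. i j = b}" "{j\<in>{1..L}. k' j = b} = {j\<in>{1..L}. k j = b}"
    by (auto simp: i'_def k'_def)
  have le: "m \<le> L" "n \<le> L"
    unfolding m_def n_def using card_mono[of "{1..L}"]
        by (metis (no_types, lifting) card_atLeastAtMost diff_Suc_1 finite_atLeastAtMost mem_Collect_eq subsetI)+
  have "w ^ m \<noteq> w ^ n"
  proof
    assume "w ^ m = w ^ n"
    then have "cis (real m / real (Suc L)) = cis (real n / real (Suc L))"
      by (simp only: w_def Complex.DeMoivre times_divide_eq_right mult_1_right)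
    then have "cos (real m / real (Suc L)) = cos (real n / real (Suc L))"
      by (metis cis.sel(1))
    moreover have "0 \<le> real x / real (Suc L) \<and> real x / real (Suc L) \<le> pi" if "x \<le> L" for x
    proof -
      have "real x / real (Suc L) \<le> 1" using that by simp
      then show ?thesis using pi_gt3 by (intro conjI) (simp, linarith)
    qed
    ultimately have "real m / real (Suc L) = real n / real (Suc L)"
      using le by (metis cos_inj_pi)
    then have "m = n" by simp
    then show False using ne by (simp only: m_def n_def card_eq)
  qed
  moreover have "T L i' k' * w ^ n = w ^ m * T L i' k'" using eq by (simp only: m_def n_def)
  ultimately have "T L i' k' = 0" by (simp add: mult.commute)
  moreover have "T L i k = T L i' k'" by (rule entry_moment_cong) (simp_all add: i'_def k'_def)
  ultimately show ?thesis by simp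
qed

text \<open>Conjugation with the permutation matrix of a bijection taking \<open>e\<close> to
  \<open>i\<close> renames the matrix indices.\<close>

lemma entry_moment_inj:
  assumes i: "inj_on i {1..L}" and e: "inj_on e {1..L}" and p: "p permutes {1..L}"
  shows "T L i (i \<circ> p) = T L e (e \<circ> p)"
proof -
  obtain g where g: "bij g" "\<And>j. j \<in> {1..L} \<Longrightarrow> g (e j) = i j"
    by (rule bij_extending[OF i e]) (rule that)
  have "T L e (e \<circ> p) = E (\<lambda>A. \<Prod>j\<in>{1..L}. (perm_mat g ** A ** adj (perm_mat g)) $ e j $ (e \<circ> p) j)"
    by (simp only: entry_moment_def E_unitary[OF perm_mat_unitary[OF g(1)]])
  also have "\<dots> = E (\<lambda>A. \<Prod>j\<in>{1..L}. A $ i j $ (i \<circ> p) j)"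
    unfolding perm_mat_conj
    by (intro arg_cong[where f = E] ext prod.cong refl) (simp only: comp_def g(2) permutes_in_image[OF p])
  finally show ?thesis by (simp only: entry_moment_def)
qed

text \<open>Reordering the factors by \<open>inv q\<close> moves the conjugation into the choice of
  indices, \<open>e \<circ> q\<close> in place of \<open>e\<close>, to which the value is
  insensitive.\<close>

lemma moment_conjugate:
  assumes e: "inj_on e {1..L}" and p: "p permutes {1..L}" and q: "q permutes {1..L}"
  shows "T L e (e \<circ> (q \<circ> p \<circ> inv q)) = T L e (e \<circ> p)"
proof -
  let ?e = "e \<circ> inv q"
  have qi: "inv q permutes {1..L}" by (rule permutes_inv[OF q])
  have "inj_on ?e {1..L}"
    using e permutes_inj_on[OF qi] permutes_image[OF qi] by (intro comp_inj_on) simp_all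
  have "T L e (e \<circ> (q \<circ> p \<circ> inv q)) = T L (e \<circ> q \<circ> inv q) ((e \<circ> q) \<circ> p \<circ> inv q)"
    by (simp add: comp_assoc permutes_inv_o[OF q])
  also have "\<dots> = T L (e \<circ> q) ((e \<circ> q) \<circ> p)"
    unfolding entry_moment_def comp_apply
    by (intro arg_cong[where f = E] ext prod.reindex_bij_betw[OF permutes_imp_bij[OF qi], of "\<lambda>j. A $ e (q j) $ e (q (p j))" for A])
  also have "\<dots> = T L e (e \<circ> p)"
    by (rule entry_moment_inj[OF _ e p])
      (use e permutes_inj_on[OF q] permutes_image[OF q] in \<open>auto intro: comp_inj_on\<close>)
  finally show ?thesis .
qed

text \<open>
  The difference of the two sides commutes with unitary matrices. If \<open>i\<close> takes the value \<open>a\<close> twice,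
  replace one of these values by a value \<open>b\<close> not taken by \<open>i\<close>. Rotating \<open>a\<close> and \<open>b\<close> into each other
  then isolates the component at \<open>i\<close>, since components with different numbers of \<open>b\<close>'s vanish.
\<close>

theorem entry_moment_eq_permuted_sum:
  assumes e: "inj_on e {1..L}" and L: "L \<le> CARD('n)"
  shows "T L i k = permuted_sum (\<lambda>p. T L e (e \<circ> p)) L i k"
proof -
  let ?P = "{1..L} \<rightarrow>\<^sub>E (UNIV :: 'n set)"
  let ?R = "permuted_sum (\<lambda>p. T L e (e \<circ> p)) L"
  define D where "D i k = T L i k - ?R i k" for i k
  have fin: "finite ?P" by (simp add: finite_PiE)
  have D0: "D i k = 0" if "card {j\<in>{1..L}. i j = b} \<noteq> card {j\<in>{1..L}. k j = b}" for i k b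
    using entry_moment_eq_0[OF that] permuted_sum_eq_0[OF that] by (simp only: D_def diff_self)
  have comm: "(\<Sum>k\<in>?P. D i k * (\<Prod>j\<in>{1..L}. U $ k j $ c j)) = (\<Sum>a\<in>?P. (\<Prod>j\<in>{1..L}. U $ i j $ a j) * D a c)"
    if "U \<in> unitary_mats" "c \<in> ?P" for U i c
    unfolding D_def left_diff_distrib right_diff_distrib sum_subtractf
      entry_moment_commute[OF that] permuted_sum_commute[OF that(2)] ..
  have D: "D i c = 0" if "i \<in> ?P" "c \<in> ?P" for i c
    using that
  \<comment> \<open>The measure counts the positions lost to repeated values; it is 0 exactly for
    injective \<open>i\<close>.\<close>
  proof (induction "L - card (i ` {1..L})" arbitrary: i c rule: less_induct)
    case less
    show ?case
    proof (cases "inj_on i {1..L}")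
      case inj: True
      show ?thesis
      proof (cases "\<forall>b. card {j\<in>{1..L}. i j = b} = card {j\<in>{1..L}. c j = b}")
        case True
        obtain p where p: "p permutes {1..L}" "\<And>j. j \<in> {1..L} \<Longrightarrow> c j = i (p j)"
          using permutation_of_equal_counts[OF inj] True by blast
        have "T L i c = T L i (i \<circ> p)" by (rule entry_moment_cong) (simp_all add: p(2))
        also have "\<dots> = T L e (e \<circ> p)" by (rule entry_moment_inj[OF inj e p(1)])
        also have "\<dots> = ?R i c" by (rule permuted_sum_inj[OF inj p, symmetric])
        finally show ?thesis by (simp add: D_def)
      next
        case False
        then show ?thesis using D0 by blast
      qed
    next
      case False
      then obtain p q where pq: "p \<in> {1..L}" "q \<in> {1..L}" "p \<noteq> q" "i p = i q"
        unfolding inj_on_def by blast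
      have lt: "card (i ` {1..L}) < L"
      proof -
        have "card (i ` {1..L}) \<noteq> card {1..L}" using False by (simp add: inj_on_iff_eq_card)
        moreover have "card (i ` {1..L}) \<le> card {1..L}" by (rule card_image_le) simp
        ultimately show ?thesis by simp
      qed
      have "i ` {1..L} \<noteq> UNIV"
      proof
        assume "i ` {1..L} = UNIV"
        with lt L show False by simp
      qed
      then obtain b where b: "b \<notin> i ` {1..L}" by blast
      define a where "a = i p"
      have ab: "a \<noteq> b" using b pq(1) by (auto simp: a_def)
      show ?thesis
      proof (cases "b \<in> c ` {1..L}")
        case True
        show ?thesis
          by (rule D0[OF card_fibres_neq[OF _ b True]]) simp
      next
        case bc: False
        define i' where "i' = i(p := b)"
        have i': "i' \<in> ?P" using less.prems(1) pq(1) by (auto simp: i'_def PiE_def extensional_def)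
        have "i' ` {1..L} = insert b (i ` {1..L})"
        proof (intro equalityI subsetI)
          fix x assume "x \<in> insert b (i ` {1..L})"
          then consider "x = b" | j where "j \<in> {1..L}" "x = i j" by blast
          then show "x \<in> i' ` {1..L}"
          proof cases
            case 1
            then have "x = i' p" by (simp add: i'_def)
            then show ?thesis using pq(1) by blast
          next
            case (2 j)
            \<comment> \<open>The overwritten value \<open>a = i p\<close> is still attained at
              \<open>q\<close>, so \<open>i'\<close> has exactly one value more than
              \<open>i\<close>.\<close>
            then have "x = i' (if j = p then q else j)" using pq by (auto simp: i'_def)
            then show ?thesis using 2(1) pq(2) by (auto split: if_splits)
          qed
        qed (auto simp: i'_def)
        then have "card (i' ` {1..L}) = Suc (card (i ` {1..L}))" using b by simp
        then have "L - card (i' ` {1..L}) < L - card (i ` {1..L})" using lt by simp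
        from less.hyps[OF this i'] have IH: "D i' k = 0" if "k \<in> ?P" for k using that .
        let ?H = "hadamard_mat a b"
        \<comment> \<open>Commutation is applied at the row \<open>i'\<close>: the side containing
          \<open>D i'\<close> vanishes by the induction hypothesis, and the other side combines the
          components \<open>D x c\<close>.\<close>
        have "0 = (\<Sum>x\<in>?P. (\<Prod>j\<in>{1..L}. ?H $ i' j $ x j) * D x c)"
          using comm[OF hadamard_mat_unitary[OF ab] less.prems(2), of i'] IH by simp
        also have "\<dots> = (\<Sum>x\<in>{i}. (\<Prod>j\<in>{1..L}. ?H $ i' j $ x j) * D x c)"
        proof (rule sum.mono_neutral_right[OF fin])
          show "\<forall>x\<in>?P - {i}. (\<Prod>j\<in>{1..L}. ?H $ i' j $ x j) * D x c = 0"
          proof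
            fix x assume x: "x \<in> ?P - {i}"
            show "(\<Prod>j\<in>{1..L}. ?H $ i' j $ x j) * D x c = 0"
            proof (cases "b \<in> x ` {1..L}")
              case True
              have "D x c = 0"
                by (rule D0[OF card_fibres_neq[OF _ bc True, symmetric]]) simp
              then show ?thesis by simp
            next
              case False
              obtain j where j: "j \<in> {1..L}" "x j \<noteq> i j"
                using PiE_ext[OF _ less.prems(1), of x] x by blast
              have "x j \<noteq> b" using False j(1) by blast
              moreover have "i j \<noteq> b" using b j(1) by blast
              \<comment> \<open>Row \<open>i' j\<close> of the matrix is supported on
                \<open>{a, b}\<close> if \<open>i j = a\<close>, and on \<open>i j\<close> alone
                otherwise; \<open>x j\<close> avoids both \<open>b\<close> and
                \<open>i j\<close>.\<close>
              ultimately have "?H $ i' j $ x j = 0"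
                using j(2) by (auto simp: hadamard_mat_def i'_def a_def)
              then have "(\<Prod>j\<in>{1..L}. ?H $ i' j $ x j) = 0"
                using j(1) by (intro prod_zero) auto
              then show ?thesis by simp
            qed
          qed
        qed (use less.prems(1) in simp)
        finally have "(\<Prod>j\<in>{1..L}. ?H $ i' j $ i j) * D i c = 0" by simp
        moreover have "?H $ i' j $ i j \<noteq> 0" if "j \<in> {1..L}" for j
          using b that by (auto simp: hadamard_mat_def i'_def a_def)
        then have "(\<Prod>j\<in>{1..L}. ?H $ i' j $ i j) \<noteq> 0" by simp
        ultimately show ?thesis by simp
      qed
    qed
  qed
  have "T L i k = T L (restrict i {1..L}) (restrict k {1..L})"
    by (rule entry_moment_cong) simp_all
  also have "\<dots> = ?R (restrict i {1..L}) (restrict k {1..L})"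
    using D[of "restrict i {1..L}" "restrict k {1..L}"] by (simp add: D_def)
  also have "\<dots> = ?R i k"
    unfolding permuted_sum_def using permutes_in_image
        by (intro sum.cong refl if_cong) (fastforce simp del: atLeastAtMost_iff)+
  finally show ?thesis .
qed

theorem power_sum_moment:
  assumes e: "inj_on e {1..L}" and L: "L \<le> CARD('n)" and s: "s permutes {1..L}"
  shows "E (power_sum (cycle_type L s)) = (\<Sum>p | p permutes {1..L}.
    of_nat (card (invariant_colourings (UNIV :: 'n set) L (p \<circ> inv s))) * T L e (e \<circ> p))"
proof -
  let ?P = "{1..L} \<rightarrow>\<^sub>E (UNIV :: 'n set)"
  have fin: "finite ?P" by (simp add: finite_PiE)
  \<comment> \<open>\<open>E_linear\<close> sums over pairs of row and column indices, so the
    colouring \<open>i\<close> is encoded as \<open>(i, i \<circ> s)\<close> with coefficient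
    1.\<close>
  let ?S = "(\<lambda>i. (i, i \<circ> s)) ` ?P"
  have inj: "inj_on (\<lambda>i. (i, i \<circ> s)) ?P" by (simp add: inj_on_def)
  have "power_sum (cycle_type L s) = (\<lambda>A :: 'n cmat. \<Sum>x\<in>?S. 1 * (\<Prod>j\<in>{1..L}. A $ fst x j $ snd x j))"
    unfolding sum.reindex[OF inj] by (simp add: power_sum_cycle_type[OF s] fun_eq_iff)
  then have "E (power_sum (cycle_type L s)) = E (\<lambda>A. \<Sum>x\<in>?S. 1 * (\<Prod>j\<in>{1..L}. A $ fst x j $ snd x j))"
    by (simp only:)
  also have "\<dots> = (\<Sum>x\<in>?S. 1 * T L (fst x) (snd x))"
    unfolding entry_moment_def by (rule E_linear) (intro finite_imageI fin)
  also have "\<dots> = (\<Sum>i\<in>?P. T L i (i \<circ> s))"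
    unfolding sum.reindex[OF inj] by simp
  also have "\<dots> = (\<Sum>i\<in>?P. \<Sum>p | p permutes {1..L}. if \<forall>j\<in>{1..L}. i (s j) = i (p j) then T L e (e \<circ> p) else 0)"
    by (intro sum.cong refl, subst entry_moment_eq_permuted_sum[OF e L]) (simp add: permuted_sum_def)
  also have "\<dots> = (\<Sum>p | p permutes {1..L}. \<Sum>i\<in>?P. if \<forall>j\<in>{1..L}. i (s j) = i (p j) then T L e (e \<circ> p) else 0)"
    by (rule sum.swap)
  also have "\<dots> = (\<Sum>p | p permutes {1..L}.
      of_nat (card (invariant_colourings (UNIV :: 'n set) L (p \<circ> inv s))) * T L e (e \<circ> p))"
  proof (intro sum.cong refl)
    fix p assume "p \<in> {p. p permutes {1..L}}"
    have "(\<forall>j\<in>{1..L}. i (s j) = i (p j)) \<longleftrightarrow> (\<forall>j\<in>{1..L}. i ((p \<circ> inv s) j) = i j)" for i :: "nat \<Rightarrow> 'n"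
    proof
      assume *: "\<forall>j\<in>{1..L}. i (s j) = i (p j)"
      show "\<forall>j\<in>{1..L}. i ((p \<circ> inv s) j) = i j"
      proof
        fix j assume "j \<in> {1..L}"
        then have "inv s j \<in> {1..L}" using permutes_in_image[OF permutes_inv[OF s]] by blast
        with * have "i (s (inv s j)) = i (p (inv s j))" by blast
        then show "i ((p \<circ> inv s) j) = i j" by (simp add: permutes_inverses[OF s])
      qed
    next
      assume *: "\<forall>j\<in>{1..L}. i ((p \<circ> inv s) j) = i j"
      show "\<forall>j\<in>{1..L}. i (s j) = i (p j)"
      proof
        fix j assume "j \<in> {1..L}"
        then have "s j \<in> {1..L}" using permutes_in_image[OF s] by blast
        with * have "i ((p \<circ> inv s) (s j)) = i (s j)" by blast
        then show "i (s j) = i (p j)" by (simp add: permutes_inverses[OF s])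
      qed
    qed
    then have "?P \<inter> {i. \<forall>j\<in>{1..L}. i (s j) = i (p j)} = invariant_colourings UNIV L (p \<circ> inv s)"
      unfolding invariant_colourings_def by blast
    then show "(\<Sum>i\<in>?P. if \<forall>j\<in>{1..L}. i (s j) = i (p j) then T L e (e \<circ> p) else 0)
        = of_nat (card (invariant_colourings (UNIV :: 'n set) L (p \<circ> inv s))) * T L e (e \<circ> p)"
      using fin by (simp only: sum.If_cases sum_constant mult_zero_right add_0_right)
  qed
  finally show ?thesis .
qed

end

section \<open>Class functions\<close>

lemma inv_comp_permutes:
  assumes "p permutes S" "q permutes S"
  shows "inv (p \<circ> q) = inv q \<circ> inv p"
  by (rule o_inv_distrib) (use assms permutes_bij in auto)

lemma comp_inv_cancel:
  assumes "p permutes S"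
  shows "inv p \<circ> (p \<circ> q) = q" "p \<circ> (inv p \<circ> q) = q"
  by (simp_all add: o_assoc permutes_inv_o[OF assms])

lemma sum_permutations_conj:
  assumes q: "q permutes S"
  shows "(\<Sum>p | p permutes S. f p) = (\<Sum>p | p permutes S. f (q \<circ> p \<circ> inv q))"
proof (rule sum.reindex_bij_witness[of _ "\<lambda>p. q \<circ> p \<circ> inv q" "\<lambda>p. inv q \<circ> p \<circ> q"])
  note qi = permutes_inv[OF q]
  fix p assume "p \<in> {p. p permutes S}"
  then have p: "p permutes S" by simp
  show "q \<circ> (inv q \<circ> p \<circ> q) \<circ> inv q = p" "inv q \<circ> (q \<circ> p \<circ> inv q) \<circ> q = p"
    by (simp_all add: comp_assoc comp_inv_cancel[OF q] permutes_inv_o[OF q])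
  show "inv q \<circ> p \<circ> q \<in> {p. p permutes S}" "q \<circ> p \<circ> inv q \<in> {p. p permutes S}"
    using p q qi by (auto intro!: permutes_compose)
  show "f (q \<circ> (inv q \<circ> p \<circ> q) \<circ> inv q) = f p"
    by (simp add: comp_assoc comp_inv_cancel[OF q] permutes_inv_o[OF q])
qed

lemma inv_conj_permutes:
  assumes p: "p permutes S" and q: "q permutes S"
  shows "inv (q \<circ> p \<circ> inv q) = q \<circ> inv p \<circ> inv q"
proof -
  have "inv (q \<circ> p \<circ> inv q) = inv (inv q) \<circ> inv (q \<circ> p)"
    by (rule inv_comp_permutes[OF permutes_compose[OF p q] permutes_inv[OF q]])
  also have "\<dots> = q \<circ> (inv p \<circ> inv q)"
    by (simp only: permutes_inv_inv[OF q] inv_comp_permutes[OF q p])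
  finally show ?thesis by (simp only: comp_assoc)
qed

context
  fixes C :: "'c set" and L :: nat
  assumes C: "finite C" "C \<noteq> {}" and L: "L \<le> card C"
begin

abbreviation (input) "weak_gf_C \<equiv> weak_gf (card C) L"
abbreviation (input) "n_colourings \<equiv> \<lambda>p. real (card (invariant_colourings C L p))"
abbreviation (input) "perms \<equiv> {p. p permutes {1..L}}"

text \<open>\<open>weak_gf_convolution\<close> gives the other order of the product. Only the
  colouring count is known to be a class function so far, so \<open>s\<close> is first conjugated by
  \<open>u\<close>, which leaves that factor unchanged; replacing \<open>s\<close> by
  \<open>inv s \<circ> u\<close> then exchanges the order.\<close>

lemma invariant_colourings_convolution:
  assumes u: "u permutes {1..L}"
  shows "(\<Sum>s\<in>perms. n_colourings (u \<circ> inv s) * weak_gf_C s) = (if u = id then real (card C) ^ L else 0)"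
proof -
  have "(\<Sum>s\<in>perms. n_colourings (u \<circ> inv s) * weak_gf_C s)
      = (\<Sum>s\<in>perms. n_colourings (u \<circ> inv (u \<circ> s \<circ> inv u)) * weak_gf_C (u \<circ> s \<circ> inv u))"
    by (rule sum_permutations_conj[OF u])
  also have "\<dots> = (\<Sum>s\<in>perms. n_colourings (u \<circ> inv s) * weak_gf_C (u \<circ> s \<circ> inv u))"
  proof (intro sum.cong refl)
    fix s assume "s \<in> perms"
    then have s: "s permutes {1..L}" by simp
    have "u \<circ> inv (u \<circ> s \<circ> inv u) = u \<circ> (u \<circ> inv s) \<circ> inv u"
      unfolding inv_conj_permutes[OF s u] by (simp only: comp_assoc)
    then show "n_colourings (u \<circ> inv (u \<circ> s \<circ> inv u)) * weak_gf_C (u \<circ> s \<circ> inv u)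
        = n_colourings (u \<circ> inv s) * weak_gf_C (u \<circ> s \<circ> inv u)"
      by (simp only: card_invariant_colourings_conj[OF permutes_compose[OF permutes_inv[OF s] u] u])
  qed
  also have "\<dots> = (\<Sum>s\<in>perms. n_colourings (u \<circ> inv (inv s \<circ> u)) * weak_gf_C (u \<circ> (inv s \<circ> u) \<circ> inv u))"
    by (subst sum_permutations_compose_right[OF u], subst sum_permutations_inverse) simp
  also have "\<dots> = (\<Sum>s\<in>perms. weak_gf_C (u \<circ> inv s) * n_colourings s)"
  proof (intro sum.cong refl)
    fix s assume "s \<in> perms"
    then have s: "s permutes {1..L}" by simp
    have "inv (inv s \<circ> u) = inv u \<circ> s"
      by (simp add: inv_comp_permutes[OF permutes_inv[OF s] u] permutes_inv_inv[OF s])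
    then show "n_colourings (u \<circ> inv (inv s \<circ> u)) * weak_gf_C (u \<circ> (inv s \<circ> u) \<circ> inv u)
        = weak_gf_C (u \<circ> inv s) * n_colourings s"
      by (simp add: comp_assoc permutes_inv_o[OF u] comp_inv_cancel[OF u])
  qed
  also have "\<dots> = (if u = id then real (card C) ^ L else 0)"
    by (rule weak_gf_convolution[OF u C L])
  finally show ?thesis .
qed

text \<open>The convolution inverse of a class function is a class function.\<close>

lemma weak_gf_conj:
  assumes p: "p permutes {1..L}" and q: "q permutes {1..L}"
  shows "weak_gf_C (q \<circ> p \<circ> inv q) = weak_gf_C p"
proof -
  define d where "d p = weak_gf_C (q \<circ> p \<circ> inv q) - weak_gf_C p" for p
  have N: "real (card C) ^ L \<noteq> 0" using C by simp
  have d0: "(\<Sum>s\<in>perms. d (p \<circ> inv s) * n_colourings s) = 0" if p: "p permutes {1..L}" for p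
  proof -
    have qpq: "q \<circ> p \<circ> inv q permutes {1..L}"
      using p q by (intro permutes_compose permutes_inv)
    have "(\<Sum>s\<in>perms. weak_gf_C (q \<circ> (p \<circ> inv s) \<circ> inv q) * n_colourings s)
        = (\<Sum>s\<in>perms. weak_gf_C ((q \<circ> p \<circ> inv q) \<circ> inv (q \<circ> s \<circ> inv q)) * n_colourings (q \<circ> s \<circ> inv q))"
    proof (intro sum.cong refl)
      fix s assume "s \<in> perms"
      then have s: "s permutes {1..L}" by simp
      have "(q \<circ> p \<circ> inv q) \<circ> inv (q \<circ> s \<circ> inv q) = q \<circ> (p \<circ> inv s) \<circ> inv q"
        unfolding inv_conj_permutes[OF s q] by (simp add: comp_assoc comp_inv_cancel[OF q])
      then show "weak_gf_C (q \<circ> (p \<circ> inv s) \<circ> inv q) * n_colourings s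
          = weak_gf_C ((q \<circ> p \<circ> inv q) \<circ> inv (q \<circ> s \<circ> inv q)) * n_colourings (q \<circ> s \<circ> inv q)"
        by (simp only: card_invariant_colourings_conj[OF s q])
    qed
    also have "\<dots> = (\<Sum>s\<in>perms. weak_gf_C ((q \<circ> p \<circ> inv q) \<circ> inv s) * n_colourings s)"
      by (rule sum_permutations_conj[OF q, symmetric])
    also have "\<dots> = (if q \<circ> p \<circ> inv q = id then real (card C) ^ L else 0)"
      by (rule weak_gf_convolution[OF qpq C L])
    also have "q \<circ> p \<circ> inv q = id \<longleftrightarrow> p = id"
    proof
      assume "q \<circ> p \<circ> inv q = id"
      then have "inv q \<circ> (q \<circ> p \<circ> inv q) \<circ> q = inv q \<circ> id \<circ> q" by simp
      then show "p = id" by (simp add: comp_assoc comp_inv_cancel[OF q] permutes_inv_o[OF q])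
    qed (simp add: permutes_inv_o[OF q])
    finally show ?thesis
      by (simp only: d_def left_diff_distrib sum_subtractf weak_gf_convolution[OF p C L] diff_self)
  qed
  \<comment> \<open>By \<open>d0\<close>, convolving \<open>d\<close> with the colouring count gives
    0. Writing \<open>N ^ L\<close> times the unit as the colouring count convolved with
    \<open>weak_gf\<close> and reassociating forces \<open>d = 0\<close>.\<close>
  have "d p * real (card C) ^ L = (\<Sum>u\<in>perms. d (p \<circ> inv u) * (if u = id then real (card C) ^ L else 0))"
    by (simp add: if_distrib[of "\<lambda>x. _ * x"] finite_permutations permutes_id inv_id cong: if_cong)
  also have "\<dots> = (\<Sum>u\<in>perms. \<Sum>t\<in>perms. d (p \<circ> inv u) * n_colourings (u \<circ> inv t) * weak_gf_C t)"
    by (intro sum.cong refl) (simp add: invariant_colourings_convolution[symmetric] sum_distrib_left mult_ac)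
  also have "\<dots> = (\<Sum>t\<in>perms. (\<Sum>u\<in>perms. d (p \<circ> inv u) * n_colourings (u \<circ> inv t)) * weak_gf_C t)"
    by (subst sum.swap) (simp add: sum_distrib_right)
  also have "\<dots> = (\<Sum>t\<in>perms. 0 * weak_gf_C t)"
  proof (intro sum.cong refl arg_cong2[where f = "(*)"])
    fix t assume "t \<in> perms"
    then have t: "t permutes {1..L}" by simp
    have "(\<Sum>u\<in>perms. d (p \<circ> inv u) * n_colourings (u \<circ> inv t))
        = (\<Sum>s\<in>perms. d (p \<circ> inv (s \<circ> t)) * n_colourings (s \<circ> t \<circ> inv t))"
      by (rule sum_permutations_compose_right[OF t])
    also have "\<dots> = (\<Sum>s\<in>perms. d ((p \<circ> inv t) \<circ> inv s) * n_colourings s)"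
      by (intro sum.cong refl) (simp add: inv_comp_permutes[OF _ t] comp_assoc permutes_inv_o[OF t])
    also have "\<dots> = 0"
      using p t by (intro d0 permutes_compose permutes_inv)
    finally show "(\<Sum>u\<in>perms. d (p \<circ> inv u) * n_colourings (u \<circ> inv t)) = 0" .
  qed
  finally have "d p * real (card C) ^ L = 0" by (simp only: mult_zero_left sum.neutral_const)
  with N have "d p = 0" by (metis mult_eq_0_iff)
  then show ?thesis by (simp add: d_def)
qed

lemma weak_gf_convolution':
  assumes p: "p permutes {1..L}" and s: "s permutes {1..L}"
  shows "(\<Sum>t\<in>perms. weak_gf_C (t \<circ> inv s) * n_colourings (p \<circ> inv t)) =
      (if p = s then real (card C) ^ L else 0)"
proof -
  have "(\<Sum>t\<in>perms. weak_gf_C (t \<circ> inv s) * n_colourings (p \<circ> inv t))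
      = (\<Sum>t\<in>perms. weak_gf_C (t \<circ> s \<circ> inv s) * n_colourings (p \<circ> inv (t \<circ> s)))"
    by (rule sum_permutations_compose_right[OF s])
  also have "\<dots> = (\<Sum>t\<in>perms. n_colourings ((p \<circ> inv s) \<circ> inv t) * weak_gf_C t)"
    by (intro sum.cong refl) (simp add: inv_comp_permutes[OF _ s] comp_assoc permutes_inv_o[OF s])
  also have "\<dots> = (if p \<circ> inv s = id then real (card C) ^ L else 0)"
    using p s by (intro invariant_colourings_convolution permutes_compose permutes_inv)
  also have "p \<circ> inv s = id \<longleftrightarrow> p = s"
  proof
    assume "p \<circ> inv s = id"
    then have "p \<circ> inv s \<circ> s = id \<circ> s" by simp
    then show "p = s" by (simp add: comp_assoc permutes_inv_o[OF s])
  qed (simp add: permutes_inv_o[OF s])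
  finally show ?thesis .
qed

end

section \<open>Sums over conjugacy classes and over partitions\<close>

lemma finite_conj_class: "finite (conj_class lam)"
  by (rule finite_subset[of _ "{p. p permutes {1..sum_mset lam}}"])
    (auto simp: conj_class_def finite_permutations)

lemma conj_class_permutes: "lam \<in> partitions L \<Longrightarrow> p \<in> conj_class lam \<Longrightarrow> p permutes {1..L}"
  by (simp add: conj_class_partition)

lemma sum_conj_class_conj:
  assumes lam: "lam \<in> partitions L" and q: "q permutes {1..L}"
  shows "(\<Sum>s\<in>conj_class lam. f (q \<circ> s \<circ> inv q)) = (\<Sum>s\<in>conj_class lam. f s)"
proof -
  have conj: "q \<circ> s \<circ> inv q \<in> conj_class lam" if "s \<in> conj_class lam" "q permutes {1..L}" for s q
    using that lam cycle_type_conjugate[of s L q]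
    by (auto simp: conj_class_partition intro!: permutes_compose permutes_inv)
  have qi: "inv q permutes {1..L}" by (rule permutes_inv[OF q])
  show ?thesis
    by (rule sum.reindex_bij_witness[of _ "\<lambda>s. inv q \<circ> s \<circ> q" "\<lambda>s. q \<circ> s \<circ> inv q"])
      (use conj[OF _ q] conj[OF _ qi] in
        \<open>auto simp: comp_assoc comp_inv_cancel[OF q] permutes_inv_o[OF q] permutes_inv_inv[OF q]\<close>)
qed

text \<open>Since \<open>1 / aut mu\<close> is the class size over \<open>L!\<close>, a sum over
  partitions with these weights is an average over the symmetric group.\<close>

lemma sum_partitions_class_function:
  fixes Y :: "(nat \<Rightarrow> nat) \<Rightarrow> complex"
  assumes r: "\<And>mu. mu \<in> partitions L \<Longrightarrow> r mu \<in> conj_class mu"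
    and Y: "\<And>p q. p permutes {1..L} \<Longrightarrow> q permutes {1..L} \<Longrightarrow> Y (q \<circ> p \<circ> inv q) = Y p"
  shows "(\<Sum>mu\<in>partitions L. of_real (1 / aut mu) * Y (r mu))
      = of_real (1 / fact L) * (\<Sum>p | p permutes {1..L}. Y p)"
proof -
  let ?S = "{p. p permutes {1..L}}"
  have "of_real (1 / aut mu) * Y (r mu) = of_real (1 / fact L) * (\<Sum>p\<in>{p\<in>?S. cycle_type L p = mu}. Y p)"
    if mu: "mu \<in> partitions L" for mu
  proof -
    have cl: "conj_class mu = {p\<in>?S. cycle_type L p = mu}"
      using conj_class_partition[OF mu] by simp
    have "Y p = Y (r mu)" if "p \<in> conj_class mu" for p
    proof -
      have "r mu permutes {1..L}" "p permutes {1..L}" "cycle_type L (r mu) = cycle_type L p"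
        using that r[OF mu] conj_class_partition[OF mu] by auto
      then obtain c where "c permutes {1..L}" "p = c \<circ> r mu \<circ> inv c"
        by (rule cycle_type_eq_imp_conjugate)
      then show ?thesis using Y[of "r mu" c] \<open>r mu permutes {1..L}\<close> by simp
    qed
    then have "(\<Sum>p\<in>conj_class mu. Y p) = of_nat (card (conj_class mu)) * Y (r mu)" by simp
    moreover have "1 / aut mu = real (card (conj_class mu)) / fact L"
      using mu by (simp add: aut_def partitions_def)
    ultimately show ?thesis by (simp add: cl)
  qed
  then have "(\<Sum>mu\<in>partitions L. of_real (1 / aut mu) * Y (r mu))
      = of_real (1 / fact L) * (\<Sum>mu\<in>partitions L. \<Sum>p\<in>{p\<in>?S. cycle_type L p = mu}. Y p)"
    unfolding sum_distrib_left by (rule sum.cong[OF refl])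
  also have "(\<Sum>mu\<in>partitions L. \<Sum>p\<in>{p\<in>?S. cycle_type L p = mu}. Y p) = (\<Sum>p\<in>?S. Y p)"
    by (rule sum.group) (auto simp: finite_permutations finite_partitions cycle_type_in_partitions)
  finally show ?thesis .
qed

section \<open>Hurwitz numbers\<close>

lemma card_monotone_factorizations:
  assumes mu: "mu \<in> partitions L" and p: "p permutes {1..L}"
  shows "card (monotone_factorizations R L k mu p) = (\<Sum>s\<in>conj_class mu. word_count R L k (p \<circ> inv s))"
proof -
  let ?W = "\<lambda>s. {ts \<in> words R L k. word_perm ts = p \<circ> inv s}"
  have iff: "word_perm ts \<circ> s = p \<longleftrightarrow> word_perm ts = p \<circ> inv s" if "s \<in> conj_class mu" for ts s
  proof -
    have s: "s permutes {1..L}" by (rule conj_class_permutes[OF mu that])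
    show ?thesis
    proof
      assume "word_perm ts \<circ> s = p"
      then have "word_perm ts \<circ> s \<circ> inv s = p \<circ> inv s" by simp
      then show "word_perm ts = p \<circ> inv s" by (simp add: comp_assoc permutes_inv_o[OF s])
    qed (simp add: comp_assoc permutes_inv_o[OF s])
  qed
  have "monotone_factorizations R L k mu p = (\<lambda>(s, ts). (ts, s)) ` Sigma (conj_class mu) ?W"
  proof (intro equalityI subsetI)
    fix x assume x: "x \<in> monotone_factorizations R L k mu p"
    obtain ts s where ts: "x = (ts, s)" by force
    have "s \<in> conj_class mu" "ts \<in> words R L k" "word_perm ts \<circ> s = p"
      using x unfolding ts monotone_factorizations_def words_def by (simp_all add: foldr_transpose)
    then have "(s, ts) \<in> Sigma (conj_class mu) ?W" using iff by simp
    then show "x \<in> (\<lambda>(s, ts). (ts, s)) ` Sigma (conj_class mu) ?W"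
      unfolding ts by (rule rev_image_eqI) simp
  next
    fix x assume "x \<in> (\<lambda>(s, ts). (ts, s)) ` Sigma (conj_class mu) ?W"
    then obtain s ts where x: "x = (ts, s)" "s \<in> conj_class mu" "ts \<in> words R L k" "word_perm ts = p \<circ> inv s"
      by (auto elim!: imageE)
    from iff[OF x(2)] x(4) have "word_perm ts \<circ> s = p" by (rule iffD2)
    with x show "x \<in> monotone_factorizations R L k mu p"
      unfolding monotone_factorizations_def words_def by (simp add: foldr_transpose)
  qed
  moreover have "inj_on (\<lambda>(s, ts). (ts, s)) (Sigma (conj_class mu) ?W)"
    by (auto simp: inj_on_def)
  ultimately have "card (monotone_factorizations R L k mu p) = card (Sigma (conj_class mu) ?W)"
    by (simp add: card_image)
  also have "\<dots> = (\<Sum>s\<in>conj_class mu. card (?W s))"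
    by (rule card_SigmaI) (auto simp: finite_conj_class finite_words)
  finally show ?thesis by (simp add: word_count_def)
qed

lemma hurwitz_eq:
  assumes mu: "mu \<in> partitions L" and lam: "lam \<in> partitions L" and ne: "conj_class lam \<noteq> {}"
  shows "hurwitz R k mu lam
    = (\<Sum>s\<in>conj_class mu. real (word_count R L k ((SOME p. p \<in> conj_class lam) \<circ> inv s))) / aut lam"
proof -
  have p: "(SOME p. p \<in> conj_class lam) permutes {1..L}"
    using ne by (intro conj_class_permutes[OF lam] some_in_eq[THEN iffD2])
  have "sum_mset lam = L" using lam by (simp add: partitions_def)
  then show ?thesis
    unfolding hurwitz_def by (simp add: card_monotone_factorizations[OF mu p])
qed

lemma hurwitz_H_sums:
  assumes mu: "mu \<in> partitions L" and lam: "lam \<in> partitions L" and ne: "conj_class lam \<noteq> {}"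
    and N: "L \<le> N" "0 < N"
  shows "(\<lambda>k. hurwitz_H k mu lam / (- real N) ^ k)
    sums ((\<Sum>s\<in>conj_class mu. weak_gf N L ((SOME p. p \<in> conj_class lam) \<circ> inv s)) / aut lam)"
proof -
  let ?p = "SOME p. p \<in> conj_class lam"
  have "(\<lambda>k. real (word_count (\<le>) L k (?p \<circ> inv s)) / (- real N) ^ k) sums weak_gf N L (?p \<circ> inv s)" for s
    unfolding weak_gf_def
    by (rule summable_sums[OF summable_norm_cancel[OF summable_weak_words[OF N]]])
  then have "(\<lambda>k. (\<Sum>s\<in>conj_class mu. real (word_count (\<le>) L k (?p \<circ> inv s)) / (- real N) ^ k) / aut lam)
      sums ((\<Sum>s\<in>conj_class mu. weak_gf N L (?p \<circ> inv s)) / aut lam)"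
    by (intro sums_divide sums_sum)
  then show ?thesis
    by (simp add: hurwitz_H_def hurwitz_eq[OF mu lam ne] sum_divide_distrib divide_divide_eq_left mult.commute)
qed

lemma hurwitz_E_sums:
  assumes mu: "mu \<in> partitions L" and lam: "lam \<in> partitions L" and ne: "conj_class lam \<noteq> {}"
    and C: "finite C" "C \<noteq> {}"
  shows "(\<lambda>k. hurwitz_E k mu lam / real (card C) ^ k) sums ((\<Sum>s\<in>conj_class mu.
    real (card (invariant_colourings C L ((SOME p. p \<in> conj_class lam) \<circ> inv s))) / real (card C) ^ L) / aut lam)"
proof -
  let ?p = "SOME p. p \<in> conj_class lam"
  have p: "?p permutes {1..L}"
    using ne by (intro conj_class_permutes[OF lam] some_in_eq[THEN iffD2])
  have "(\<lambda>k. real (word_count (<) L k (?p \<circ> inv s)) / real (card C) ^ k)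
      sums (real (card (invariant_colourings C L (?p \<circ> inv s))) / real (card C) ^ L)"
    if s: "s \<in> conj_class mu" for s
    using p conj_class_permutes[OF mu s] C by (intro strict_words_sums permutes_compose permutes_inv)
  then have "(\<lambda>k. (\<Sum>s\<in>conj_class mu. real (word_count (<) L k (?p \<circ> inv s)) / real (card C) ^ k) / aut lam)
      sums ((\<Sum>s\<in>conj_class mu. real (card (invariant_colourings C L (?p \<circ> inv s))) / real (card C) ^ L) / aut lam)"
    by (intro sums_divide sums_sum)
  then show ?thesis
    by (simp add: hurwitz_E_def hurwitz_eq[OF mu lam ne] sum_divide_distrib divide_divide_eq_left mult.commute)
qed

section \<open>The two expansions\<close>

context invariant_expectation
begin

text \<open>Non-empty classes are assumed here and are supplied by the representatives
  \<open>g\<close> of the final theorem. They give meaning to the choice operator in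
  \<open>hurwitz\<close> and make \<open>aut\<close> non-zero.\<close>

context
  fixes e :: "nat \<Rightarrow> 'n" and L :: nat
  assumes e: "inj_on e {1..L}" and L: "L \<le> CARD('n)"
    and ne: "\<And>mu. mu \<in> partitions L \<Longrightarrow> conj_class mu \<noteq> {}"
begin

lemma sum_class_moments:
  assumes lam: "lam \<in> partitions L" and p: "p \<in> conj_class lam"
  shows "of_real (1 / fact L) * (\<Sum>s\<in>conj_class lam. T L e (e \<circ> s)) = T L e (e \<circ> p) / of_real (aut lam)"
proof -
  have "T L e (e \<circ> s) = T L e (e \<circ> p)" if "s \<in> conj_class lam" for s
  proof -
    have "p permutes {1..L}" "s permutes {1..L}" "cycle_type L p = cycle_type L s"
      using that p conj_class_partition[OF lam] by auto
    then obtain c where "c permutes {1..L}" "s = c \<circ> p \<circ> inv c"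
      by (rule cycle_type_eq_imp_conjugate)
    then show ?thesis using moment_conjugate[OF e, of p c] \<open>p permutes {1..L}\<close> by simp
  qed
  moreover have "sum_mset lam = L" using lam by (simp add: partitions_def)
  ultimately show ?thesis by (simp add: aut_def)
qed

lemma some_in_conj_class: "mu \<in> partitions L \<Longrightarrow> (SOME p. p \<in> conj_class mu) \<in> conj_class mu"
  using ne some_in_eq by blast

text \<open>Once the sum over partitions is an average over all \<open>t\<close>, inserting
  \<open>power_sum_moment\<close> turns the sum over \<open>t\<close> into a convolution of inverse
  functions; for each \<open>s\<close> in the class of \<open>lam\<close> only \<open>q = s\<close>
  survives.\<close>

theorem moment_weak_expansion:
  assumes lam: "lam \<in> partitions L" and p: "p \<in> conj_class lam"
  shows "T L e (e \<circ> p) / of_real (aut lam) =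
    (\<Sum>mu\<in>partitions L. of_real (1 / real CARD('n) ^ L * (\<Sum>k. hurwitz_H k lam mu / (- real CARD('n)) ^ k))
      * E (power_sum mu))"
proof -
  let ?N = "real CARD('n)" and ?S = "{p. p permutes {1..L}}"
  let ?F = "\<lambda>p. card (invariant_colourings (UNIV :: 'n set) L p)"
  let ?w = "weak_gf CARD('n) L"
  let ?r = "\<lambda>mu. SOME p. p \<in> conj_class mu"
  have N: "0 < CARD('n)" by simp
  \<comment> \<open>The weight \<open>1 / aut mu\<close> needed for averaging is the normalization
    in \<open>hurwitz\<close>, whose last argument is the class of the fixed product.\<close>
  define Y where "Y t = complex_of_real (1 / ?N ^ L * (\<Sum>s\<in>conj_class lam. ?w (t \<circ> inv s)))
      * E (power_sum (cycle_type L t))" for t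
  have Y: "Y (q \<circ> t \<circ> inv q) = Y t" if t: "t permutes {1..L}" and q: "q permutes {1..L}" for t q
  proof -
    have "(\<Sum>s\<in>conj_class lam. ?w (q \<circ> t \<circ> inv q \<circ> inv s))
        = (\<Sum>s\<in>conj_class lam. ?w (q \<circ> t \<circ> inv q \<circ> inv (q \<circ> s \<circ> inv q)))"
      by (rule sum_conj_class_conj[OF lam q, symmetric])
    also have "\<dots> = (\<Sum>s\<in>conj_class lam. ?w (t \<circ> inv s))"
    proof (intro sum.cong refl)
      fix s assume "s \<in> conj_class lam"
      then have s: "s permutes {1..L}" by (rule conj_class_permutes[OF lam])
      have "q \<circ> t \<circ> inv q \<circ> inv (q \<circ> s \<circ> inv q) = q \<circ> (t \<circ> inv s) \<circ> inv q"
        unfolding inv_conj_permutes[OF s q] by (simp add: comp_assoc comp_inv_cancel[OF q])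
      then show "?w (q \<circ> t \<circ> inv q \<circ> inv (q \<circ> s \<circ> inv q)) = ?w (t \<circ> inv s)"
        using weak_gf_conj[of "UNIV :: 'n set" L "t \<circ> inv s" q] L q
          permutes_compose[OF permutes_inv[OF s] t] by simp
    qed
    finally show ?thesis
      unfolding Y_def by (simp only: cycle_type_conjugate[OF t q])
  qed
  have "(\<Sum>mu\<in>partitions L. of_real (1 / ?N ^ L * (\<Sum>k. hurwitz_H k lam mu / (- ?N) ^ k)) * E (power_sum mu))
      = (\<Sum>mu\<in>partitions L. of_real (1 / aut mu) * Y (?r mu))"
  proof (intro sum.cong refl)
    fix mu assume mu: "mu \<in> partitions L"
    have "cycle_type L (?r mu) = mu" using some_in_conj_class[OF mu] conj_class_partition[OF mu] by simp
    then show "of_real (1 / ?N ^ L * (\<Sum>k. hurwitz_H k lam mu / (- ?N) ^ k)) * E (power_sum mu)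
        = of_real (1 / aut mu) * Y (?r mu)"
      unfolding Y_def sums_unique[OF hurwitz_H_sums[OF lam mu ne[OF mu] L N], symmetric] by simp
  qed
  also have "\<dots> = of_real (1 / fact L) * (\<Sum>t\<in>?S. Y t)"
    by (rule sum_partitions_class_function[of L ?r Y, OF some_in_conj_class Y])
  also have "(\<Sum>t\<in>?S. Y t) = (\<Sum>t\<in>?S. \<Sum>s\<in>conj_class lam. \<Sum>q\<in>?S.
      of_real (?w (t \<circ> inv s) * real (?F (q \<circ> inv t))) * (T L e (e \<circ> q) / of_real (?N ^ L)))"
    by (rule sum.cong[OF refl])
      (simp add: Y_def power_sum_moment[OF e L] sum_distrib_left sum_distrib_right sum_divide_distrib mult_ac,
        rule sum.swap)
  also have "\<dots> = (\<Sum>s\<in>conj_class lam. \<Sum>q\<in>?S. \<Sum>t\<in>?S.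
      of_real (?w (t \<circ> inv s) * real (?F (q \<circ> inv t))) * (T L e (e \<circ> q) / of_real (?N ^ L)))"
    by (subst sum.swap, rule sum.cong[OF refl], rule sum.swap)
  also have "\<dots> = (\<Sum>s\<in>conj_class lam. \<Sum>q\<in>?S.
      of_real (\<Sum>t\<in>?S. ?w (t \<circ> inv s) * real (?F (q \<circ> inv t))) * (T L e (e \<circ> q) / of_real (?N ^ L)))"
    by (simp only: sum_distrib_right of_real_sum)
  also have "\<dots> = (\<Sum>s\<in>conj_class lam. \<Sum>q\<in>?S. if q = s then T L e (e \<circ> q) else 0)"
    by (intro sum.cong refl, subst weak_gf_convolution')
      (use L conj_class_permutes[OF lam] in auto)
  also have "\<dots> = (\<Sum>s\<in>conj_class lam. T L e (e \<circ> s))"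
    using conj_class_permutes[OF lam] by (intro sum.cong refl) (simp add: finite_permutations)
  finally show ?thesis
    using sum_class_moments[OF lam p] by simp
qed

text \<open>After exchanging sums, every \<open>s\<close> in the class of \<open>mu\<close>
  contributes the same expectation by \<open>power_sum_moment\<close>; the class size over
  \<open>L!\<close> is \<open>1 / aut mu\<close>.\<close>

theorem power_sum_strict_expansion:
  assumes mu: "mu \<in> partitions L" and g: "\<And>lam. lam \<in> partitions L \<Longrightarrow> g lam \<in> conj_class lam"
  shows "E (power_sum mu) / of_real (aut mu) =
    (\<Sum>lam\<in>partitions L. of_real (real CARD('n) ^ L * (\<Sum>k. hurwitz_E k mu lam / real CARD('n) ^ k))
      * T L e (e \<circ> g lam))"
proof -
  let ?N = "real CARD('n)" and ?S = "{p. p permutes {1..L}}"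
  let ?F = "\<lambda>p. card (invariant_colourings (UNIV :: 'n set) L p)"
  let ?r = "\<lambda>mu. SOME p. p \<in> conj_class mu"
  define Y where "Y t = of_nat (\<Sum>s\<in>conj_class mu. ?F (t \<circ> inv s)) * T L e (e \<circ> t)" for t
  have Y: "Y (q \<circ> t \<circ> inv q) = Y t" if t: "t permutes {1..L}" and q: "q permutes {1..L}" for t q
  proof -
    have "(\<Sum>s\<in>conj_class mu. ?F (q \<circ> t \<circ> inv q \<circ> inv s))
        = (\<Sum>s\<in>conj_class mu. ?F (q \<circ> t \<circ> inv q \<circ> inv (q \<circ> s \<circ> inv q)))"
      by (rule sum_conj_class_conj[OF mu q, symmetric])
    also have "\<dots> = (\<Sum>s\<in>conj_class mu. ?F (t \<circ> inv s))"
    proof (intro sum.cong refl)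
      fix s assume "s \<in> conj_class mu"
      then have s: "s permutes {1..L}" by (rule conj_class_permutes[OF mu])
      have "q \<circ> t \<circ> inv q \<circ> inv (q \<circ> s \<circ> inv q) = q \<circ> (t \<circ> inv s) \<circ> inv q"
        unfolding inv_conj_permutes[OF s q] by (simp add: comp_assoc comp_inv_cancel[OF q])
      then show "?F (q \<circ> t \<circ> inv q \<circ> inv (q \<circ> s \<circ> inv q)) = ?F (t \<circ> inv s)"
        by (simp only: card_invariant_colourings_conj[OF permutes_compose[OF permutes_inv[OF s] t] q])
    qed
    finally show ?thesis
      unfolding Y_def by (simp only: moment_conjugate[OF e t q])
  qed
  have "(\<Sum>lam\<in>partitions L. of_real (?N ^ L * (\<Sum>k. hurwitz_E k mu lam / ?N ^ k)) * T L e (e \<circ> g lam))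
      = (\<Sum>lam\<in>partitions L. of_real (1 / aut lam) * Y (?r lam))"
  proof (intro sum.cong refl)
    fix lam assume lam: "lam \<in> partitions L"
    have "aut lam \<noteq> 0"
      using ne[OF lam] by (simp add: aut_def finite_conj_class)
    \<comment> \<open>The representative chosen in \<open>hurwitz\<close> need not be
      \<open>g lam\<close>, but the moment depends only on the class.\<close>
    moreover have "T L e (e \<circ> g lam) / of_real (aut lam) = T L e (e \<circ> ?r lam) / of_real (aut lam)"
      using sum_class_moments[OF lam g[OF lam]] sum_class_moments[OF lam some_in_conj_class[OF lam]] by simp
    ultimately have "T L e (e \<circ> g lam) = T L e (e \<circ> ?r lam)" by simp
    moreover have "(\<Sum>k. hurwitz_E k mu lam / ?N ^ k)
        = (\<Sum>s\<in>conj_class mu. real (?F (?r lam \<circ> inv s))) / ?N ^ L / aut lam"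
      using sums_unique[OF hurwitz_E_sums[OF mu lam ne[OF lam], of "UNIV :: 'n set"]]
      by (simp add: sum_divide_distrib)
    ultimately show "of_real (?N ^ L * (\<Sum>k. hurwitz_E k mu lam / ?N ^ k)) * T L e (e \<circ> g lam)
        = of_real (1 / aut lam) * Y (?r lam)"
      by (simp add: Y_def)
  qed
  also have "\<dots> = of_real (1 / fact L) * (\<Sum>t\<in>?S. Y t)"
    by (rule sum_partitions_class_function[of L ?r Y, OF some_in_conj_class Y])
  also have "(\<Sum>t\<in>?S. Y t) = (\<Sum>s\<in>conj_class mu. \<Sum>t\<in>?S. of_nat (?F (t \<circ> inv s)) * T L e (e \<circ> t))"
    by (subst sum.swap) (simp add: Y_def sum_distrib_right)
  also have "\<dots> = (\<Sum>s\<in>conj_class mu. E (power_sum mu))"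
  proof (rule sum.cong[OF refl])
    fix s assume s: "s \<in> conj_class mu"
    then have "cycle_type L s = mu" using conj_class_partition[OF mu] by simp
    then show "(\<Sum>t\<in>?S. of_nat (?F (t \<circ> inv s)) * T L e (e \<circ> t)) = E (power_sum mu)"
      using power_sum_moment[OF e L conj_class_permutes[OF mu s]] by (simp only:)
  qed
  also have "of_real (1 / fact L) * \<dots> = E (power_sum mu) / of_real (aut mu)"
    using mu by (simp add: aut_def partitions_def)
  finally show ?thesis ..
qed

end

end

section \<open>Lebesgue measure and Gaussian integrals\<close>

lemma nn_integral_lborel_plus:
  fixes f :: "'a::euclidean_space \<Rightarrow> ennreal"
  assumes [measurable]: "f \<in> borel_measurable borel"
  shows "(\<integral>\<^sup>+x. f (c + x) \<partial>lborel) = (\<integral>\<^sup>+x. f x \<partial>lborel)"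
  by (subst (2) lborel_distr_plus[of c, symmetric], subst nn_integral_distr) simp_all

text \<open>
  With the indicator function \<open>g\<close> of the unit ball, which is invariant under \<open>T\<close>, both sides are
  compared with the double integral of \<open>f x * g (T y)\<close>, using only translations and Fubini's theorem.
\<close>

lemma distr_lborel_isometry:
  fixes T S :: "'a::euclidean_space \<Rightarrow> 'a"
  assumes T: "linear T" and TS: "\<And>x. T (S x) = x" and norm: "\<And>x. norm (T x) = norm x"
  shows "distr lborel borel T = lborel"
proof -
  have [measurable]: "T \<in> borel_measurable borel"
    by (intro borel_measurable_continuous_onI linear_continuous_on linear_conv_bounded_linear[THEN iffD1] T)
  let ?g = "indicator (ball 0 1) :: 'a \<Rightarrow> ennreal"
  have [measurable]: "?g \<in> borel_measurable borel"
    by (intro borel_measurable_indicator borel_open open_ball)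
  define c where "c = emeasure lborel (ball (0::'a) 1)"
  have c: "c \<noteq> 0" "c \<noteq> \<infinity>"
  proof -
    show "c \<noteq> 0"
      using content_ball_pos[of 1 "0::'a"] by (auto simp: c_def measure_def)
    show "c \<noteq> \<infinity>" unfolding c_def using emeasure_lborel_ball_finite[of "0::'a" 1] by auto
  qed
  have gint: "(\<integral>\<^sup>+x. ?g x \<partial>lborel) = c" by (simp add: c_def)
  have "emeasure (distr lborel borel T) A = emeasure lborel A" if [measurable]: "A \<in> sets borel" for A
  proof -
    let ?f = "indicator A :: 'a \<Rightarrow> ennreal"
    have "c * (\<integral>\<^sup>+x. ?f x \<partial>lborel) = (\<integral>\<^sup>+y. (\<integral>\<^sup>+x. ?g (T y) * ?f x \<partial>lborel) \<partial>lborel)"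
    proof -
      have "?g (T y) = ?g y" for y by (simp add: indicator_def norm)
      moreover have "(\<integral>\<^sup>+y. ?g y * emeasure lborel A \<partial>lborel) = c * emeasure lborel A"
        by (subst nn_integral_multc, measurable) (simp only: gint)
      ultimately show ?thesis
        by (simp add: nn_integral_cmult)
    qed
    also have "\<dots> = (\<integral>\<^sup>+y. (\<integral>\<^sup>+x. ?g (T y) * ?f (T y + x) \<partial>lborel) \<partial>lborel)"
      by (intro nn_integral_cong nn_integral_lborel_plus[symmetric, where f = "\<lambda>x. ?g (T _) * ?f x"]) simp
    also have "\<dots> = (\<integral>\<^sup>+x. (\<integral>\<^sup>+y. ?g (T y) * ?f (T y + x) \<partial>lborel) \<partial>lborel)"
      by (rule lborel_pair.Fubini') measurable
    \<comment> \<open>Translating \<open>y\<close> by \<open>S (- x)\<close> shifts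
      \<open>T y\<close> by \<open>- x\<close>, which moves \<open>x\<close> from the argument of
      \<open>?f\<close> into that of \<open>?g\<close>, where it can be integrated out.\<close>
    also have "\<dots> = (\<integral>\<^sup>+x. (\<integral>\<^sup>+y. ?g (T (S (- x) + y)) * ?f (T (S (- x) + y) + x) \<partial>lborel) \<partial>lborel)"
      by (intro nn_integral_cong nn_integral_lborel_plus[symmetric]) measurable
    also have "\<dots> = (\<integral>\<^sup>+x. (\<integral>\<^sup>+y. ?g (x + - T y) * ?f (T y) \<partial>lborel) \<partial>lborel)"
      by (intro nn_integral_cong) (simp add: linear_add[OF T] TS indicator_def norm_minus_commute)
    also have "\<dots> = (\<integral>\<^sup>+y. (\<integral>\<^sup>+x. ?g (- T y + x) * ?f (T y) \<partial>lborel) \<partial>lborel)"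
      unfolding add.commute[of _ "- T _"] by (rule lborel_pair.Fubini'[symmetric]) measurable
    also have "\<dots> = (\<integral>\<^sup>+y. c * ?f (T y) \<partial>lborel)"
    proof (rule nn_integral_cong)
      fix y
      have "(\<integral>\<^sup>+x. ?g (- T y + x) * ?f (T y) \<partial>lborel) = (\<integral>\<^sup>+x. ?g (- T y + x) \<partial>lborel) * ?f (T y)"
        by (rule nn_integral_multc) measurable
      also have "(\<integral>\<^sup>+x. ?g (- T y + x) \<partial>lborel) = c"
        unfolding gint[symmetric] by (rule nn_integral_lborel_plus) measurable
      finally show "(\<integral>\<^sup>+x. ?g (- T y + x) * ?f (T y) \<partial>lborel) = c * ?f (T y)" .
    qed
    also have "\<dots> = c * (\<integral>\<^sup>+y. ?f (T y) \<partial>lborel)"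
      by (rule nn_integral_cmult) measurable
    also have "(\<integral>\<^sup>+y. ?f (T y) \<partial>lborel) = (\<integral>\<^sup>+y. ?f y \<partial>distr lborel borel T)"
      by (rule nn_integral_distr[symmetric]) measurable
    also have "\<dots> = emeasure (distr lborel borel T) A"
      by (rule nn_integral_indicator) simp
    finally have "c * emeasure lborel A = c * emeasure (distr lborel borel T) A"
      by simp
    then show ?thesis
      using c by (simp add: ennreal_mult_cancel_left)
  qed
  then show ?thesis by (intro measure_eqI) auto
qed

section \<open>Integrability against Gaussians on Euclidean space\<close>

lemma integrable_gaussian_euclidean:
  assumes "0 < b"
  shows "integrable lborel (\<lambda>x::'a::euclidean_space. exp (- b * (norm x)\<^sup>2))"
proof (rule integrableI_bounded)
  have one: "(\<integral>\<^sup>+t. ennreal (exp (- b * t\<^sup>2)) \<partial>lborel) < \<infinity>"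
  proof -
    \<comment> \<open>\<open>s\<close> is the standard deviation for which the normal density is a
      multiple of \<open>exp (- b * t\<^sup>2)\<close>.\<close>
    define s where "s = 1 / sqrt (2 * b)"
    have s: "0 < s" using assms by (simp add: s_def)
    have s2: "2 * s\<^sup>2 = 1 / b" using assms by (simp add: s_def power_divide)
    have "exp (- b * t\<^sup>2) = sqrt (2 * pi * s\<^sup>2) * normal_density 0 s t" for t
      using assms by (simp add: normal_density_def s2 s_def power_divide mult.commute)
    then have "integrable lborel (\<lambda>t. exp (- b * t\<^sup>2))" using s by simp
    then show ?thesis by (simp add: integrable_iff_bounded)
  qed
  have "(\<integral>\<^sup>+(x::'a). ennreal (norm (exp (- b * (norm x)\<^sup>2))) \<partial>lborel)
      = (\<integral>\<^sup>+(x::'a). (\<Prod>i\<in>Basis. ennreal (exp (- b * (x \<bullet> i)\<^sup>2))) \<partial>lborel)"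
  proof (intro nn_integral_cong)
    fix x :: 'a
    have "(norm x)\<^sup>2 = (\<Sum>i\<in>Basis. (x \<bullet> i)\<^sup>2)"
      by (subst power2_norm_eq_inner, subst euclidean_inner) (simp add: power2_eq_square)
    then show "ennreal (norm (exp (- b * (norm x)\<^sup>2))) = (\<Prod>i\<in>Basis. ennreal (exp (- b * (x \<bullet> i)\<^sup>2)))"
      by (simp add: sum_distrib_left exp_sum prod_ennreal sum_negf[symmetric] abs_prod del: exp_minus)
  qed
  also have "\<dots> = (\<Prod>i\<in>(Basis :: 'a set). (\<integral>\<^sup>+t. ennreal (exp (- b * t\<^sup>2)) \<partial>lborel))"
    by (rule nn_integral_lborel_prod) simp_all
  also have "\<dots> < \<infinity>"
  proof -
    obtain r where "0 \<le> r" "(\<integral>\<^sup>+t. ennreal (exp (- b * t\<^sup>2)) \<partial>lborel) = ennreal r"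
      using one by (cases "\<integral>\<^sup>+t. ennreal (exp (- b * t\<^sup>2)) \<partial>lborel" rule: ennreal_cases) auto
    then show ?thesis by (simp only: prod_constant ennreal_power) simp
  qed
  finally show "(\<integral>\<^sup>+(x::'a). ennreal (norm (exp (- b * (norm x)\<^sup>2))) \<partial>lborel) < \<infinity>" .
qed simp

text \<open>This combines \<open>1 + r \<le> exp r\<close> with completion of the square. Only half
  of the Gaussian exponent is spent on the polynomial, so that the other half remains for
  integrability.\<close>

lemma poly_le_gaussian:
  fixes r a :: real
  assumes "0 \<le> r" "0 < a"
  shows "(1 + r) ^ d \<le> exp ((real d)\<^sup>2 / (2 * a)) * exp (a / 2 * r\<^sup>2)"
proof -
  have "(1 + r) ^ d \<le> exp r ^ d"
    using assms by (intro power_mono exp_ge_add_one_self) simp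
  also have "\<dots> = exp (real d * r)" by (simp add: exp_of_nat_mult)
  also have "real d * r \<le> (real d)\<^sup>2 / (2 * a) + a / 2 * r\<^sup>2"
  proof -
    have "0 \<le> (a * r - real d)\<^sup>2 / (2 * a)" using assms by simp
    also have "\<dots> = (real d)\<^sup>2 / (2 * a) + a / 2 * r\<^sup>2 - real d * r"
      using assms by (simp add: power2_eq_square field_simps)
    finally show ?thesis by simp
  qed
  finally show ?thesis by (simp add: exp_add)
qed

lemma integrable_poly_gaussian:
  fixes h :: "'a::euclidean_space \<Rightarrow> complex"
  assumes meas: "h \<in> borel_measurable borel" and a: "0 < a"
    and bound: "\<And>x. norm (h x) \<le> K * (1 + norm x) ^ d * exp (- a * (norm x)\<^sup>2)"
  shows "integrable lborel h"
proof (rule Bochner_Integration.integrable_bound)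
  let ?c = "\<bar>K\<bar> * exp ((real d)\<^sup>2 / (2 * a))"
  show "integrable lborel (\<lambda>x::'a. ?c * exp (- (a / 2) * (norm x)\<^sup>2))"
    using integrable_gaussian_euclidean[where 'a = 'a, of "a / 2"] a by simp
  show "h \<in> borel_measurable lborel" using meas by simp
  show "AE x in lborel. norm (h x) \<le> norm (?c * exp (- (a / 2) * (norm x)\<^sup>2))"
  proof (rule AE_I2)
    fix x :: 'a
    have "norm (h x) \<le> \<bar>K\<bar> * (1 + norm x) ^ d * exp (- a * (norm x)\<^sup>2)"
      by (rule order.trans[OF bound]) (intro mult_right_mono, auto)
    also have "\<dots> \<le> \<bar>K\<bar> * (exp ((real d)\<^sup>2 / (2 * a)) * exp (a / 2 * (norm x)\<^sup>2)) * exp (- a * (norm x)\<^sup>2)"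
      using poly_le_gaussian[OF norm_ge_zero a] by (intro mult_right_mono mult_left_mono) auto
    also have "\<dots> = ?c * exp (- (a / 2) * (norm x)\<^sup>2)"
      by (simp add: mult.assoc mult_exp_exp)
    finally show "norm (h x) \<le> norm (?c * exp (- (a / 2) * (norm x)\<^sup>2))" by simp
  qed
qed

section \<open>Conjugation of hermitian matrices\<close>

lemma adj_mult: "adj (A ** B) = adj B ** adj A"
  by (simp add: adj_def matrix_matrix_mult_def vec_eq_iff mult.commute)

lemma adj_adj [simp]: "adj (adj A) = A"
  by (simp add: adj_def vec_eq_iff)

lemma conj_hermitian: "A \<in> hermitian_mats \<Longrightarrow> U ** A ** adj U \<in> hermitian_mats"
  by (simp add: hermitian_mats_def adj_mult matrix_mul_assoc)

lemma conj_conj_adj: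
  assumes "U \<in> unitary_mats"
  shows "U ** (adj U ** A ** adj (adj U)) ** adj U = A"
proof -
  have "U ** (adj U ** A ** adj (adj U)) ** adj U = (U ** adj U) ** A ** (U ** adj U)"
    by (simp add: matrix_mul_assoc)
  then show ?thesis using assms by (simp add: unitary_mats_def)
qed

lemma linear_conj:
  fixes U :: "'n::finite cmat"
  shows "linear (\<lambda>A. U ** A ** adj U)"
  by (rule linearI)
    (simp_all add: vec_eq_iff matrix_matrix_mult_def sum.distrib sum_distrib_left sum_distrib_right
      distrib_left distrib_right scaleR_sum_right)

lemma tr_pow_conj:
  assumes "U \<in> unitary_mats"
  shows "tr_pow d (U ** A ** adj U) = tr_pow d A"
proof -
  have U: "adj U ** U = mat 1" "U ** adj U = mat 1" using assms by (simp_all add: unitary_mats_def)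
  have "((**) (U ** A ** adj U) ^^ d) (mat 1) = U ** ((**) A ^^ d) (mat 1) ** adj U"
  proof (induction d)
    case (Suc d)
    have "((**) (U ** A ** adj U) ^^ Suc d) (mat 1) = U ** A ** (adj U ** U) ** ((**) A ^^ d) (mat 1) ** adj U"
      by (simp add: Suc matrix_mul_assoc)
    then show ?case by (simp add: U matrix_mul_assoc)
  qed (simp add: U)
  then have "tr_pow d (U ** A ** adj U) = trace (U ** (((**) A ^^ d) (mat 1) ** adj U))"
    by (simp add: tr_pow_def matrix_mul_assoc)
  also have "\<dots> = trace (((**) A ^^ d) (mat 1) ** (adj U ** U))"
    by (subst trace_mul_sym) (simp add: matrix_mul_assoc)
  finally show ?thesis by (simp add: U tr_pow_def)
qed

section \<open>Real coordinates on the hermitian matrices\<close>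

definition real_of_herm :: "'n::finite cmat \<Rightarrow> real ^ 'n ^ 'n" where
  "real_of_herm A = (\<chi> i j. Re (A $ i $ j) + Im (A $ i $ j))"

lemma real_of_herm_of_real [simp]: "real_of_herm (herm_of_real x) = x"
  by (simp add: real_of_herm_def herm_of_real_def vec_eq_iff field_simps)

lemma herm_of_real_of_herm:
  assumes "A \<in> hermitian_mats"
  shows "herm_of_real (real_of_herm A) = A"
proof -
  have "A $ i $ j = cnj (A $ j $ i)" for i j
    using assms by (auto simp: hermitian_mats_def adj_def vec_eq_iff)
  then have re: "Re (A $ i $ j) = Re (A $ j $ i)" and im: "Im (A $ i $ j) = - Im (A $ j $ i)" for i j
    by (metis cnj.sel)+
  have "herm_of_real (real_of_herm A) $ i $ j = A $ i $ j" for i j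
    using re[of i j] im[of i j] by (simp add: real_of_herm_def herm_of_real_def complex_eq_iff)
  then show ?thesis by (simp add: vec_eq_iff)
qed

lemma herm_of_real_hermitian [simp]: "herm_of_real x \<in> hermitian_mats"
  by (simp add: hermitian_mats_def adj_def herm_of_real_def vec_eq_iff complex_eq_iff add.commute field_simps)

lemma linear_herm_of_real: "linear (herm_of_real :: real ^ 'n ^ 'n \<Rightarrow> 'n::finite cmat)"
  by (rule linearI)
    (simp_all add: herm_of_real_def vec_eq_iff complex_eq_iff add_divide_distrib diff_divide_distrib algebra_simps)

lemma linear_real_of_herm: "linear (real_of_herm :: 'n::finite cmat \<Rightarrow> real ^ 'n ^ 'n)"
  by (rule linearI) (simp_all add: real_of_herm_def vec_eq_iff algebra_simps)

text \<open>The squared modulus of the \<open>(i, j)\<close> entry is the mean of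
  \<open>(x $ i $ j)\<^sup>2\<close> and \<open>(x $ j $ i)\<^sup>2\<close>. Hence conjugation,
  which preserves traces, is an isometry in real coordinates, and the Gaussian weight becomes
  radial.\<close>

lemma tr_pow_2_herm_of_real:
  fixes x :: "real ^ 'n::finite ^ 'n"
  shows "tr_pow 2 (herm_of_real x) = of_real ((norm x)\<^sup>2)"
proof -
  have n: "(norm x)\<^sup>2 = (\<Sum>i\<in>UNIV. \<Sum>j\<in>UNIV. (x $ i $ j)\<^sup>2)"
    unfolding power2_norm_eq_inner inner_vec_def by (simp add: power2_eq_square)
  have "tr_pow 2 (herm_of_real x) = (\<Sum>i\<in>UNIV. \<Sum>j\<in>UNIV. herm_of_real x $ i $ j * herm_of_real x $ j $ i)"
    by (simp add: tr_pow_def trace_def matrix_matrix_mult_def numeral_2_eq_2 mat_def if_distrib[of "\<lambda>x. _ * x"] cong: if_cong)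
  also have "\<dots> = (\<Sum>i\<in>UNIV. \<Sum>j\<in>UNIV. of_real (((x $ i $ j)\<^sup>2 + (x $ j $ i)\<^sup>2) / 2))"
    by (intro sum.cong refl) (simp add: herm_of_real_def complex_eq_iff power2_eq_square field_simps)
  also have "\<dots> = of_real (\<Sum>i\<in>UNIV. \<Sum>j\<in>UNIV. ((x $ i $ j)\<^sup>2 + (x $ j $ i)\<^sup>2) / 2)"
    by simp
  also have "(\<Sum>i\<in>UNIV. \<Sum>j\<in>UNIV. ((x $ i $ j)\<^sup>2 + (x $ j $ i)\<^sup>2) / 2)
      = ((\<Sum>i\<in>UNIV. \<Sum>j\<in>UNIV. (x $ i $ j)\<^sup>2) + (\<Sum>i\<in>UNIV. \<Sum>j\<in>UNIV. (x $ j $ i)\<^sup>2)) / 2"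
    by (simp add: sum.distrib add_divide_distrib sum_divide_distrib)
  also have "(\<Sum>i\<in>UNIV. \<Sum>j\<in>UNIV. (x $ j $ i)\<^sup>2) = (\<Sum>i\<in>UNIV. \<Sum>j\<in>UNIV. (x $ i $ j)\<^sup>2)"
    by (rule sum.swap)
  finally show ?thesis by (simp add: n)
qed

lemma linear_borel_measurable:
  fixes T :: "'a::euclidean_space \<Rightarrow> 'b::real_normed_vector"
  shows "linear T \<Longrightarrow> T \<in> borel_measurable borel"
  by (intro borel_measurable_continuous_onI linear_continuous_on linear_conv_bounded_linear[THEN iffD1])

lemma measurable_herm_of_real: "herm_of_real \<in> measurable lborel (restrict_space borel hermitian_mats)"
  by (rule measurable_restrict_space2) (simp_all add: linear_borel_measurable[OF linear_herm_of_real])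

lemma integral_herm_lborel:
  fixes f :: "'n::finite cmat \<Rightarrow> complex"
  assumes "f \<in> borel_measurable borel"
  shows "(\<integral>A. f A \<partial>herm_lborel) = (\<integral>x. f (herm_of_real x) \<partial>lborel)"
  unfolding herm_lborel_def
  by (rule Bochner_Integration.integral_distr[OF measurable_herm_of_real measurable_restrict_space1[OF assms]])

text \<open>In real coordinates, conjugation by \<open>U\<close> is linear and norm-preserving with
  right inverse the conjugation by \<open>adj U\<close>, so \<open>distr_lborel_isometry\<close>
  applies.\<close>

lemma integral_herm_lborel_conj:
  fixes f :: "'n::finite cmat \<Rightarrow> complex"
  assumes f: "f \<in> borel_measurable borel" and U: "U \<in> unitary_mats"
  shows "(\<integral>A. f (U ** A ** adj U) \<partial>herm_lborel) = (\<integral>A. f A \<partial>herm_lborel)"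
proof -
  define T where "T = (\<lambda>V x. real_of_herm (V ** herm_of_real x ** adj V) :: real ^ 'n ^ 'n)"
  have T: "herm_of_real (T V x) = V ** herm_of_real x ** adj V" for V x
    by (simp add: T_def herm_of_real_of_herm conj_hermitian)
  have lin: "linear (T U)"
    unfolding T_def
    using linear_compose[OF linear_herm_of_real linear_compose[OF linear_conj linear_real_of_herm]]
    by (simp add: comp_def)
  have TT: "T U (T (adj U) x) = x" for x
  proof -
    have "T U (T (adj U) x) = real_of_herm (U ** herm_of_real (T (adj U) x) ** adj U)"
      by (simp only: T_def)
    then show ?thesis by (simp only: T conj_conj_adj[OF U] real_of_herm_of_real)
  qed
  have norm: "norm (T U x) = norm x" for x
  proof -
    have "complex_of_real ((norm (T U x))\<^sup>2) = of_real ((norm x)\<^sup>2)"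
      unfolding tr_pow_2_herm_of_real[symmetric] T by (rule tr_pow_conj[OF U])
    then have "(norm (T U x))\<^sup>2 = (norm x)\<^sup>2" by (simp only: of_real_eq_iff)
    then show ?thesis by simp
  qed
  have fc: "(\<lambda>A. f (U ** A ** adj U)) \<in> borel_measurable borel"
    using measurable_compose[OF linear_borel_measurable[OF linear_conj] f] .
  have fh: "(\<lambda>x. f (herm_of_real x)) \<in> borel_measurable borel"
    using measurable_compose[OF linear_borel_measurable[OF linear_herm_of_real] f] .
  have "(\<integral>A. f (U ** A ** adj U) \<partial>herm_lborel) = (\<integral>x. f (herm_of_real (T U x)) \<partial>lborel)"
    by (simp add: integral_herm_lborel[OF fc] T)
  also have "\<dots> = (\<integral>x. f (herm_of_real x) \<partial>distr lborel borel (T U))"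
    by (rule Bochner_Integration.integral_distr[symmetric]) (simp_all add: linear_borel_measurable[OF lin] fh)
  also have "\<dots> = (\<integral>A. f A \<partial>herm_lborel)"
    by (simp add: distr_lborel_isometry[OF lin TT norm] integral_herm_lborel[OF f])
  finally show ?thesis .
qed

section \<open>Polynomially bounded functions\<close>

text \<open>Continuity serves measurability, polynomial growth serves integrability against the
  Gaussian. Closure under sums and products then covers every integrand without its Gaussian
  factor.\<close>

definition poly_bounded :: "('n::finite cmat \<Rightarrow> complex) \<Rightarrow> bool" where
  "poly_bounded f \<longleftrightarrow> continuous_on UNIV f \<and> (\<exists>K d. \<forall>A. norm (f A) \<le> K * (1 + norm A) ^ d)"

lemma poly_boundedI:
  "continuous_on UNIV f \<Longrightarrow> (\<And>A. norm (f A) \<le> K * (1 + norm A) ^ d) \<Longrightarrow> poly_bounded f"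
  by (auto simp: poly_bounded_def)

lemma poly_bounded_const: "poly_bounded (\<lambda>_. c)"
  by (rule poly_boundedI[of _ "norm c" 0]) auto

lemma poly_bounded_entry:
  fixes i j :: "'n::finite"
  shows "poly_bounded (\<lambda>A. A $ i $ j)"
proof (rule poly_boundedI[of _ 1 1])
  show "continuous_on UNIV (\<lambda>A :: 'n cmat. A $ i $ j)" by (intro continuous_intros)
  fix A :: "'n cmat"
  have "norm (A $ i $ j) \<le> norm (A $ i)" by (rule Finite_Cartesian_Product.norm_nth_le)
  also have "\<dots> \<le> norm A" by (rule Finite_Cartesian_Product.norm_nth_le)
  finally show "norm (A $ i $ j) \<le> 1 * (1 + norm A) ^ 1" by simp
qed

lemma poly_bounded_mult:
  assumes "poly_bounded f" "poly_bounded g"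
  shows "poly_bounded (\<lambda>A. f A * g A)"
proof -
  obtain K d K' d' where f: "\<And>A. norm (f A) \<le> K * (1 + norm A) ^ d"
      and g: "\<And>A. norm (g A) \<le> K' * (1 + norm A) ^ d'"
    using assms by (auto simp: poly_bounded_def)
  show ?thesis
  proof (rule poly_boundedI)
    show "continuous_on UNIV (\<lambda>A. f A * g A)"
      using assms by (auto simp: poly_bounded_def intro!: continuous_intros)
    fix A
    have "norm (f A * g A) \<le> (K * (1 + norm A) ^ d) * (K' * (1 + norm A) ^ d')"
      unfolding norm_mult by (intro mult_mono f g order.trans[OF norm_ge_zero f] norm_ge_zero)
    then show "norm (f A * g A) \<le> (K * K') * (1 + norm A) ^ (d + d')"
      by (simp add: power_add mult_ac)
  qed
qed

lemma poly_bounded_add: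
  assumes "poly_bounded f" "poly_bounded g"
  shows "poly_bounded (\<lambda>A. f A + g A)"
proof -
  obtain K d K' d' where f: "\<And>A. norm (f A) \<le> K * (1 + norm A) ^ d"
      and g: "\<And>A. norm (g A) \<le> K' * (1 + norm A) ^ d'"
    using assms by (auto simp: poly_bounded_def)
  show ?thesis
  proof (rule poly_boundedI)
    show "continuous_on UNIV (\<lambda>A. f A + g A)"
      using assms by (auto simp: poly_bounded_def intro!: continuous_intros)
    fix A
    have "norm (f A + g A) \<le> K * (1 + norm A) ^ d + K' * (1 + norm A) ^ d'"
      by (rule norm_triangle_mono[OF f g])
    also have "\<dots> \<le> \<bar>K\<bar> * (1 + norm A) ^ (d + d') + \<bar>K'\<bar> * (1 + norm A) ^ (d + d')"
      by (intro add_mono mult_mono power_increasing) auto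
    finally show "norm (f A + g A) \<le> (\<bar>K\<bar> + \<bar>K'\<bar>) * (1 + norm A) ^ (d + d')"
      by (simp add: distrib_right)
  qed
qed

lemma poly_bounded_sum: "(\<And>s. s \<in> S \<Longrightarrow> poly_bounded (f s)) \<Longrightarrow> poly_bounded (\<lambda>A. \<Sum>s\<in>S. f s A)"
  by (induction S rule: infinite_finite_induct) (auto intro: poly_bounded_const poly_bounded_add)

lemma poly_bounded_prod: "(\<And>s. s \<in> S \<Longrightarrow> poly_bounded (f s)) \<Longrightarrow> poly_bounded (\<lambda>A. \<Prod>s\<in>S. f s A)"
  by (induction S rule: infinite_finite_induct) (auto intro: poly_bounded_const poly_bounded_mult)

lemma poly_bounded_prod_mset:
  "(\<And>s. s \<in># X \<Longrightarrow> poly_bounded (f s)) \<Longrightarrow> poly_bounded (\<lambda>A. \<Prod>s\<in>#X. f s A)"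
  by (induction X) (auto intro: poly_bounded_const poly_bounded_mult)

lemma poly_bounded_prod_list:
  "(\<And>s. s \<in> set xs \<Longrightarrow> poly_bounded (f s)) \<Longrightarrow> poly_bounded (\<lambda>A. \<Prod>s\<leftarrow>xs. f s A)"
  by (induction xs) (auto intro: poly_bounded_const poly_bounded_mult)

lemma poly_bounded_tr_pow: "poly_bounded (tr_pow d :: 'n::finite cmat \<Rightarrow> complex)"
proof -
  have "poly_bounded (\<lambda>A :: 'n cmat. ((**) A ^^ d) (mat 1) $ i $ j)" for i j
  proof (induction d arbitrary: i j)
    case 0
    show ?case by (simp add: poly_bounded_const)
  next
    case (Suc d)
    have "((**) A ^^ Suc d) (mat 1) $ i $ j = (\<Sum>k\<in>UNIV. A $ i $ k * ((**) A ^^ d) (mat 1) $ k $ j)"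
      for A :: "'n cmat"
      by (simp add: matrix_matrix_mult_def)
    then show ?case
      by (simp only:) (intro poly_bounded_sum poly_bounded_mult poly_bounded_entry Suc)
  qed
  then show ?thesis
    unfolding tr_pow_def[abs_def] trace_def by (intro poly_bounded_sum)
qed

lemma poly_bounded_potential: "poly_bounded (potential x :: 'n::finite cmat \<Rightarrow> complex)"
proof (cases x)
  case (Pair h ds)
  have "poly_bounded (\<lambda>A. tr_pow d A / of_nat d)" for d
    using poly_bounded_mult[OF poly_bounded_tr_pow[of d] poly_bounded_const[of "1 / of_nat d"]] by simp
  then have prod: "poly_bounded (\<lambda>A. \<Prod>d\<leftarrow>ds. tr_pow d A / of_nat d)"
    by (intro poly_bounded_prod_list)
  show ?thesis
  proof (cases "ds \<noteq> [] \<and> 0 \<notin> set ds")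
    case True
    then have "potential x = (\<lambda>A :: 'n cmat. of_nat CARD('n) powi (2 - 2 * int h - int (length ds))
        / fact (length ds) * (\<Prod>d\<leftarrow>ds. tr_pow d A / of_nat d))"
      by (simp add: Pair potential_def fun_eq_iff)
    then show ?thesis
      by (simp only:) (intro poly_bounded_mult poly_bounded_const prod)
  next
    case False
    then have "potential x = (\<lambda>A :: 'n cmat. 0)"
      by (intro ext) (simp only: Pair potential_def prod.case if_False)
    then show ?thesis by (simp only: poly_bounded_const)
  qed
qed

definition gaussian_weight :: "'n::finite cmat \<Rightarrow> complex" where
  "gaussian_weight A = exp (- (of_nat CARD('n) * tr_pow 2 A / 2))"

lemma measurable_poly_bounded_gaussian:
  assumes "poly_bounded f"
  shows "(\<lambda>A. f A * gaussian_weight A) \<in> borel_measurable borel"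
proof (rule borel_measurable_continuous_onI)
  have "continuous_on UNIV f" "continuous_on UNIV (tr_pow 2 :: 'a cmat \<Rightarrow> complex)"
    using assms poly_bounded_tr_pow by (auto simp: poly_bounded_def)
  then show "continuous_on UNIV (\<lambda>A. f A * gaussian_weight A)"
    unfolding gaussian_weight_def by (intro continuous_intros) auto
qed

lemma integrable_poly_bounded_gaussian:
  fixes f :: "'n::finite cmat \<Rightarrow> complex"
  assumes f: "poly_bounded f"
  shows "integrable herm_lborel (\<lambda>A. f A * gaussian_weight A)"
proof -
  let ?h = "\<lambda>A :: 'n cmat. f A * gaussian_weight A"
  note m = measurable_poly_bounded_gaussian[OF f]
  obtain K d where K: "\<And>A. norm (f A) \<le> K * (1 + norm A) ^ d"
    using f by (auto simp: poly_bounded_def)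
  obtain B where B: "\<And>x. norm (herm_of_real x :: 'n cmat) \<le> B * norm x" "0 < B"
    using linear_bounded_pos[OF linear_herm_of_real] by blast
  have "integrable lborel (\<lambda>x. ?h (herm_of_real x))"
  proof (rule integrable_poly_gaussian)
    show "(\<lambda>x. ?h (herm_of_real x)) \<in> borel_measurable borel"
      using measurable_compose[OF linear_borel_measurable[OF linear_herm_of_real] m] .
    show "0 < real CARD('n) / 2" by simp
    fix x :: "real ^ 'n ^ 'n"
    have "norm (f (herm_of_real x)) \<le> \<bar>K\<bar> * (1 + norm (herm_of_real x :: 'n cmat)) ^ d"
      by (rule order.trans[OF K]) (intro mult_right_mono, auto)
    also have "\<dots> \<le> \<bar>K\<bar> * ((1 + B) * (1 + norm x)) ^ d"
    proof (intro mult_left_mono power_mono)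
      show "1 + norm (herm_of_real x :: 'n cmat) \<le> (1 + B) * (1 + norm x)"
        using B(1)[of x] B(2) by (simp add: algebra_simps add_increasing)
    qed auto
    finally have "norm (f (herm_of_real x)) \<le> (\<bar>K\<bar> * (1 + B) ^ d) * (1 + norm x) ^ d"
      by (simp add: power_mult_distrib mult_ac)
    moreover have "norm (gaussian_weight (herm_of_real x :: 'n cmat))
        = exp (- (real CARD('n) / 2) * (norm x)\<^sup>2)"
      by (simp add: gaussian_weight_def tr_pow_2_herm_of_real flip: of_real_power)
    ultimately show "norm (?h (herm_of_real x))
        \<le> (\<bar>K\<bar> * (1 + B) ^ d) * (1 + norm x) ^ d * exp (- (real CARD('n) / 2) * (norm x)\<^sup>2)"
      unfolding norm_mult by (simp only:) (intro mult_right_mono, auto)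
  qed
  then show ?thesis
    unfolding herm_lborel_def
    by (subst integrable_distr_eq[OF measurable_herm_of_real measurable_restrict_space1[OF m]])
qed

section \<open>Formal measures\<close>

text \<open>The coefficient of the monomial \<open>X\<close> in the expanded exponential of the
  potential; the factorials come from one exponential series per variable.\<close>

definition potential_weight :: "(nat \<times> nat list) multiset \<Rightarrow> 'n::finite cmat \<Rightarrow> complex" where
  "potential_weight X A = (\<Prod>x\<in>#X. potential x A) / (\<Prod>x\<in>set_mset X. fact (count X x))"

lemma formal_integral_eq:
  "formal_integral f X = (\<integral>A. f A * potential_weight X A * gaussian_weight A \<partial>herm_lborel)"
  by (simp add: formal_integral_def potential_weight_def gaussian_weight_def mult.assoc)

lemma poly_bounded_potential_weight: "poly_bounded (potential_weight X)"
  unfolding potential_weight_def[abs_def] divide_inverse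
  by (intro poly_bounded_mult poly_bounded_prod_mset poly_bounded_potential poly_bounded_const)

lemma potential_weight_conj:
  assumes U: "U \<in> unitary_mats"
  shows "potential_weight X (U ** A ** adj U) = potential_weight X A"
proof -
  have "potential x (U ** A ** adj U) = potential x A" for x
    by (cases x) (simp add: potential_def tr_pow_conj[OF U])
  then show ?thesis by (simp add: potential_weight_def)
qed

lemma formal_integral_linear:
  assumes "finite S" "\<And>s. s \<in> S \<Longrightarrow> poly_bounded (f s)"
  shows "formal_integral (\<lambda>A. \<Sum>s\<in>S. c s * f s A) X = (\<Sum>s\<in>S. c s * formal_integral (f s) X)"
proof -
  have int: "integrable herm_lborel (\<lambda>A. f s A * potential_weight X A * gaussian_weight A)" if "s \<in> S" for s
    using assms(2)[OF that] by (intro integrable_poly_bounded_gaussian poly_bounded_mult poly_bounded_potential_weight)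
  have "formal_integral (\<lambda>A. \<Sum>s\<in>S. c s * f s A) X
      = (\<integral>A. (\<Sum>s\<in>S. c s * (f s A * potential_weight X A * gaussian_weight A)) \<partial>herm_lborel)"
    by (simp add: formal_integral_eq sum_distrib_right mult.assoc)
  also have "\<dots> = (\<Sum>s\<in>S. c s * (\<integral>A. f s A * potential_weight X A * gaussian_weight A \<partial>herm_lborel))"
    using int by (subst Bochner_Integration.integral_sum) auto
  finally show ?thesis by (simp add: formal_integral_eq)
qed

text \<open>Both weights depend only on traces of powers, so a change of variables by conjugation
  affects \<open>f\<close> alone.\<close>

lemma formal_integral_conj:
  assumes f: "poly_bounded f" and U: "U \<in> unitary_mats"
  shows "formal_integral (\<lambda>A. f (U ** A ** adj U)) = formal_integral f"
proof
  fix X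
  let ?h = "\<lambda>A. f A * potential_weight X A * gaussian_weight A"
  have "formal_integral (\<lambda>A. f (U ** A ** adj U)) X = (\<integral>A. ?h (U ** A ** adj U) \<partial>herm_lborel)"
    by (simp add: formal_integral_eq potential_weight_conj[OF U] gaussian_weight_def tr_pow_conj[OF U])
  also have "\<dots> = (\<integral>A. ?h A \<partial>herm_lborel)"
    by (rule integral_herm_lborel_conj[OF measurable_poly_bounded_gaussian U])
      (intro poly_bounded_mult f poly_bounded_potential_weight)
  finally show "formal_integral (\<lambda>A. f (U ** A ** adj U)) X = formal_integral f X"
    by (simp add: formal_integral_eq)
qed

text \<open>The quotient is solved for degree by degree with a fixed denominator, so linearity in
  the numerator propagates by induction on the degree.\<close>

lemma mfps_div_linear:
  assumes "\<And>X. F X = (\<Sum>s\<in>S. c s * G s X)"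
  shows "mfps_div F Z X = (\<Sum>s\<in>S. c s * mfps_div (G s) Z X)"
proof (induction "size X" arbitrary: X rule: less_induct)
  case less
  define B where "B s = (\<Sum>Y | Y \<subset># X. mfps_div (G s) Z Y * Z (X - Y))" for s
  have "(\<Sum>Y | Y \<subset># X. mfps_div F Z Y * Z (X - Y))
      = (\<Sum>Y | Y \<subset># X. (\<Sum>s\<in>S. c s * mfps_div (G s) Z Y) * Z (X - Y))"
    by (intro sum.cong refl arg_cong2[where f = "(*)"] less) (auto dest: mset_subset_size)
  also have "\<dots> = (\<Sum>s\<in>S. c s * B s)"
    by (simp add: B_def sum_distrib_left sum_distrib_right mult.assoc sum.swap[of _ S])
  finally have "mfps_div F Z X = (F X - (\<Sum>s\<in>S. c s * B s)) / Z {#}"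
    by (subst mfps_div.simps) simp
  also have "\<dots> = (\<Sum>s\<in>S. c s * ((G s X - B s) / Z {#}))"
    by (simp add: assms sum_subtractf right_diff_distrib diff_divide_distrib sum_divide_distrib)
  also have "\<dots> = (\<Sum>s\<in>S. c s * mfps_div (G s) Z X)"
    by (subst mfps_div.simps) (simp add: B_def)
  finally show ?case .
qed

lemma poly_bounded_monomial: "poly_bounded (\<lambda>A. \<Prod>j\<in>J. A $ i j $ k j)"
  by (intro poly_bounded_prod poly_bounded_entry)

lemma invariant_expectation_formal:
  "invariant_expectation (\<lambda>f :: 'n::finite cmat \<Rightarrow> complex. formal_expectation f X)"
proof
  fix S :: "((nat \<Rightarrow> 'n) \<times> (nat \<Rightarrow> 'n)) set" and c L
  assume S: "finite S"
  show "formal_expectation (\<lambda>A. \<Sum>s\<in>S. c s * (\<Prod>j\<in>{1..L::nat}. A $ fst s j $ snd s j)) X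
      = (\<Sum>s\<in>S. c s * formal_expectation (\<lambda>A. \<Prod>j\<in>{1..L}. A $ fst s j $ snd s j) X)"
    unfolding formal_expectation_def
    by (rule mfps_div_linear, rule formal_integral_linear[OF S poly_bounded_monomial])
next
  fix U :: "'n cmat" and L i k
  assume U: "U \<in> unitary_mats"
  show "formal_expectation (\<lambda>A. \<Prod>j\<in>{1..L::nat}. (U ** A ** adj U) $ i j $ k j) X
      = formal_expectation (\<lambda>A. \<Prod>j\<in>{1..L}. A $ i j $ k j) X"
    unfolding formal_expectation_def
    by (simp only: formal_integral_conj[OF poly_bounded_monomial[where J = "{1..L}" and i = i and k = k] U])
qed

section \<open>Genuine measures\<close>

lemma invariant_expectation_measure:
  fixes nu :: "'n::finite cmat measure"
  assumes nu: "unitarily_invariant_measure nu" and mom: "finite_moments nu"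
  shows "invariant_expectation (measure_expectation nu)"
proof
  have sets: "sets nu = sets (restrict_space borel hermitian_mats)"
    and inv: "\<And>U. U \<in> unitary_mats \<Longrightarrow> distr nu nu (\<lambda>A. U ** A ** adj U) = nu"
    using nu by (auto simp: unitarily_invariant_measure_def)
  {
    fix S :: "((nat \<Rightarrow> 'n) \<times> (nat \<Rightarrow> 'n)) set" and c and L :: nat
    assume S: "finite S"
    have int: "integrable nu (\<lambda>A. \<Prod>j\<in>{1..L}. A $ fst s j $ snd s j)" for s
    proof -
      \<comment> \<open>\<open>finite_moments\<close> speaks of multisets of index pairs, so the
        positions \<open>{1..L}\<close> are turned into such a multiset, with
        multiplicities.\<close>
      let ?I = "image_mset (\<lambda>j. (fst s j, snd s j)) (mset_set {1..L})"
      have "integrable nu (\<lambda>A. \<Prod>(i, j)\<in>#?I. A $ i $ j)"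
        using mom unfolding finite_moments_def by blast
      then show ?thesis by (simp add: prod_unfold_prod_mset multiset.map_comp comp_def)
    qed
    have "(\<integral>A. (\<Sum>s\<in>S. c s * (\<Prod>j\<in>{1..L}. A $ fst s j $ snd s j)) \<partial>nu)
        = (\<Sum>s\<in>S. c s * (\<integral>A. (\<Prod>j\<in>{1..L}. A $ fst s j $ snd s j) \<partial>nu))"
      using int by (subst Bochner_Integration.integral_sum) auto
    then show "measure_expectation nu (\<lambda>A. \<Sum>s\<in>S. c s * (\<Prod>j\<in>{1..L}. A $ fst s j $ snd s j))
        = (\<Sum>s\<in>S. c s * measure_expectation nu (\<lambda>A. \<Prod>j\<in>{1..L}. A $ fst s j $ snd s j))"
      by (simp add: measure_expectation_def sum_divide_distrib)
  next
    fix U :: "'n cmat" and i k and L :: nat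
    assume U: "U \<in> unitary_mats"
    let ?f = "\<lambda>A :: 'n cmat. \<Prod>j\<in>{1..L}. A $ i j $ k j"
    have f: "?f \<in> borel_measurable nu"
      unfolding measurable_cong_sets[OF sets refl]
      using poly_bounded_monomial[where J = "{1..L}" and i = i and k = k]
      by (intro measurable_restrict_space1 borel_measurable_continuous_onI) (simp add: poly_bounded_def)
    have conj: "(\<lambda>A. U ** A ** adj U) \<in> measurable nu nu"
      unfolding measurable_cong_sets[OF sets sets]
      by (intro measurable_restrict_space2 measurable_restrict_space1 linear_borel_measurable linear_conj)
        (auto simp: space_restrict_space conj_hermitian)
    have "(\<integral>A. ?f (U ** A ** adj U) \<partial>nu) = (\<integral>A. ?f A \<partial>distr nu nu (\<lambda>A. U ** A ** adj U))"
      by (rule Bochner_Integration.integral_distr[OF conj f, symmetric])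
    also have "\<dots> = (\<integral>A. ?f A \<partial>nu)" by (simp only: inv[OF U])
    finally show "measure_expectation nu (\<lambda>A. \<Prod>j\<in>{1..L}. (U ** A ** adj U) $ i j $ k j)
        = measure_expectation nu ?f"
      by (simp only: measure_expectation_def)
  }
qed

theorem theorem1p3:
  fixes e :: "nat \<Rightarrow> 'n::finite"
    and g :: "nat multiset \<Rightarrow> nat \<Rightarrow> nat"
    and E :: "('n cmat \<Rightarrow> complex) \<Rightarrow> complex"
  assumes e: "bij_betw e {1..CARD('n)} UNIV"
    and g: "\<And>L lam. L \<le> CARD('n) \<Longrightarrow> lam \<in> partitions L \<Longrightarrow> g lam \<in> conj_class lam"
    and E: "(\<exists>nu. unitarily_invariant_measure nu \<and> finite_moments nu
               \<and> measure nu (space nu) \<noteq> 0 \<and> E = measure_expectation nu)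
          \<or> (\<exists>X. E = (\<lambda>f. formal_expectation f X))"
  shows "(\<forall>L\<le>CARD('n). \<forall>lam\<in>partitions L.
           (\<forall>mu\<in>partitions L. summable (\<lambda>k. hurwitz_H k lam mu / (- real CARD('n)) ^ k))
           \<and> E (perm_monomial e L (g lam)) / of_real (aut lam) =
               (\<Sum>mu\<in>partitions L.
                  of_real (1 / real CARD('n) ^ L
                      * (\<Sum>k. hurwitz_H k lam mu / (- real CARD('n)) ^ k))
                    * E (power_sum mu)))
       \<and> (\<forall>L\<le>CARD('n). \<forall>mu\<in>partitions L.
           (\<forall>lam\<in>partitions L. summable (\<lambda>k. hurwitz_E k mu lam / real CARD('n) ^ k))
           \<and> E (power_sum mu) / of_real (aut mu) =
               (\<Sum>lam\<in>partitions L.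
                  of_real (real CARD('n) ^ L
                      * (\<Sum>k. hurwitz_E k mu lam / real CARD('n) ^ k))
                    * E (perm_monomial e L (g lam))))"
proof -
  interpret invariant_expectation E
    using E invariant_expectation_measure invariant_expectation_formal by blast
  have inj: "inj_on e {1..L}" if "L \<le> CARD('n)" for L
    using e that by (auto simp: bij_betw_def intro: inj_on_subset)
  have ne: "conj_class mu \<noteq> {}" if "L \<le> CARD('n)" "mu \<in> partitions L" for L mu
    using g[OF that] by blast
  have P: "E (perm_monomial e L (g lam)) = entry_moment E L e (e \<circ> g lam)" for L lam
    by (simp add: entry_moment_def perm_monomial_def[abs_def])
  show ?thesis
  proof (intro conjI allI impI ballI)
    fix L lam mu
    assume L: "L \<le> CARD('n)" and lam: "lam \<in> partitions L" and mu: "mu \<in> partitions L"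
    show "summable (\<lambda>k. hurwitz_H k lam mu / (- real CARD('n)) ^ k)"
      by (rule sums_summable[OF hurwitz_H_sums[OF lam mu ne[OF L mu] L]]) simp
    \<comment> \<open>In the second expansion the names are exchanged: here and below,
      \<open>lam\<close> is the partition of the power sum.\<close>
    show "summable (\<lambda>k. hurwitz_E k lam mu / real CARD('n) ^ k)"
      by (rule sums_summable[OF hurwitz_E_sums[OF lam mu ne[OF L mu], of "UNIV :: 'n set"]]) simp_all
  next
    fix L lam
    assume L: "L \<le> CARD('n)" and lam: "lam \<in> partitions L"
    show "E (perm_monomial e L (g lam)) / of_real (aut lam) =
        (\<Sum>mu\<in>partitions L. of_real (1 / real CARD('n) ^ L
          * (\<Sum>k. hurwitz_H k lam mu / (- real CARD('n)) ^ k)) * E (power_sum mu))"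
      unfolding P by (rule moment_weak_expansion[OF inj[OF L] L ne[OF L] lam g[OF L lam]])
    show "E (power_sum lam) / of_real (aut lam) =
        (\<Sum>mu\<in>partitions L. of_real (real CARD('n) ^ L
          * (\<Sum>k. hurwitz_E k lam mu / real CARD('n) ^ k)) * E (perm_monomial e L (g mu)))"
      unfolding P by (rule power_sum_strict_expansion[OF inj[OF L] L ne[OF L] lam g[OF L]])
  qed
qed

end
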